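(* Let $G$ be a finite simple $2$-connected cubic graph and let $x,y$ be two distinct vertices of $G$. If $P$ is a longest $(x,y)$-path in $G$ (i.e., a path with endpoints $x$ and $y$ of maximum length among all such paths), then $P$ contains at least one internal $P$-bound vertex.
   Context: For a subgraph $H$ of a graph $G$, a vertex $v$ of $H$ is called $H$-bound if all neighbors of $v$ in $G$ lie in $H$, i.e., $N_G(v)\subseteq V(H)$. An internal vertex of a path is a vertex of the path that is not one of its endpoints. *)

theory Defs
  imports "Graph_Theory.Graph_Theory"
begin

text \<open>
  Finite simple graphs are the locale \<^locale>\<open>graph\<close>: each undirected edge is
  represented by its two opposite arcs.  Hence the (undirected) degree of a vertex is its
  out-degree, and its neighbours are the vertices it dominates.
\<close>

definition neighborhood :: "('a, 'b) pre_digraph \<Rightarrow> 'a \<Rightarrow> 'a set" where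
  "neighborhood G v = {w. v \<rightarrow>\<^bsub>G\<^esub> w}"

definition cubic :: "('a, 'b) pre_digraph \<Rightarrow> bool" where
  "cubic G \<longleftrightarrow> (\<forall>v \<in> verts G. out_degree G v = 3)"

text \<open>Intended for finite graphs only, because of the cardinalities.\<close>

definition k_connected :: "nat \<Rightarrow> ('a, 'b) pre_digraph \<Rightarrow> bool" where
  "k_connected k G \<longleftrightarrow> k < card (verts G) \<and>
     (\<forall>X \<subseteq> verts G. card X < k \<longrightarrow> Digraph_Component.connected (G \<restriction> (verts G - X)))"

text \<open>Paths are given by their vertex sequences, which determine them in a simple graph.\<close>

definition xy_path :: "('a, 'b) pre_digraph \<Rightarrow> 'a \<Rightarrow> 'a \<Rightarrow> 'a vwalk \<Rightarrow> bool" where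
  "xy_path G x y p \<longleftrightarrow> vpath p G \<and> hd p = x \<and> last p = y"

definition longest_xy_path :: "('a, 'b) pre_digraph \<Rightarrow> 'a \<Rightarrow> 'a \<Rightarrow> 'a vwalk \<Rightarrow> bool" where
  "longest_xy_path G x y p \<longleftrightarrow> xy_path G x y p \<and>
     (\<forall>q. xy_path G x y q \<longrightarrow> vwalk_length q \<le> vwalk_length p)"

definition internal_vertices :: "'a vwalk \<Rightarrow> 'a set" where
  "internal_vertices p = set p - {hd p, last p}"

text \<open>The subgraph formed by the vertices and edges of a path; both arcs of each edge are kept.\<close>

definition path_graph :: "('a, 'b) pre_digraph \<Rightarrow> 'a vwalk \<Rightarrow> ('a, 'b) pre_digraph" where
  "path_graph G p = \<lparr> verts = set p,
     arcs = {e \<in> arcs G. (tail G e, head G e) \<in> set (vwalk_arcs p) \<union> (set (vwalk_arcs p))\<inverse>},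
     tail = tail G, head = head G \<rparr>"

definition bound_in :: "('a, 'b) pre_digraph \<Rightarrow> ('a, 'b) pre_digraph \<Rightarrow> 'a \<Rightarrow> bool" where
  "bound_in G H v \<longleftrightarrow> v \<in> verts H \<and> neighborhood G v \<subseteq> verts H"

lemma set_vwalk_arcs_subset: "set (vwalk_arcs p) \<subseteq> set p \<times> set p"
  by (induction p rule: vwalk_arcs.induct) auto

lemma subgraph_path_graph:
  assumes "wf_digraph G" and "vwalk p G"
  shows "subgraph (path_graph G p) G"
proof -
  have "wf_digraph (path_graph G p)"
    using set_vwalk_arcs_subset[of p] by unfold_locales (auto simp: path_graph_def)
  with assms show ?thesis
    by (auto simp: subgraph_def compatible_def path_graph_def vwalk_def)
qed

end

theory Submission
  imports Defs "HOL-Library.Z2"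
begin

text \<open>
  Suppose every inner vertex \<open>v\<close> of the longest path \<open>P\<close> has a neighbour \<open>th v\<close> off \<open>P\<close>; since
  the graph is cubic, it is unique.  The \<open>x\<close>-\<open>y\<close>-paths covering a large part of \<open>P\<close> are counted
  modulo 2, in the style of Smith's theorem on Hamiltonian cycles.
  
  A topological form of Hall's theorem gives a set \<open>A\<close> of pairwise non-consecutive inner vertices
  containing exactly one attachment of each component of \<open>G - P\<close> that is not adjacent to \<open>x\<close> or \<open>y\<close>
  and has at least three attachments.  Let \<open>V0\<close> be the set of the other inner vertices.  Counting
  shows that every path covering \<open>V0\<close> is as long as \<open>P\<close>: it misses some vertices of \<open>A\<close> and passes
  through as many vertices off \<open>P\<close>, entering and leaving each of them directly from and to \<open>V0\<close>.
  
  Replacing each component of \<open>G - P\<close> by disjoint chords joining its attachments in pairs gives a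
  multigraph in which all vertices but \<open>x\<close> and \<open>y\<close> have degree 3, so by the lollipop argument it has
  an even number of Hamiltonian \<open>x\<close>-\<open>y\<close>-paths.  Summing over all ways to retain vertices of \<open>A\<close> and
  vertices off \<open>P\<close> with two neighbours in \<open>V0\<close>, one obtains a covering path \<open>r\<close> other than \<open>P\<close> that
  exchanges each missed \<open>a\<close> for a single vertex in the component of \<open>th a\<close>.  Choose \<open>r\<close> with as few
  missed vertices as possible.  A second lollipop argument, on the part of \<open>P\<close> between the missed
  vertices with both exchanges allowed, produces another path: if it uses \<open>P\<close> on one side of a missed
  vertex and \<open>r\<close> on the other, then connecting through the component makes it longer than \<open>P\<close>;
  otherwise it misses fewer vertices than \<open>r\<close>.
\<close>

section \<open>Parity of lollipops\<close>

text \<open>A component of \<open>G - P\<close> can be crossed in many ways, while the lollipop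
  argument needs a graph with odd degrees whose Hamiltonian paths are exactly the covering paths.
  Maximality of \<open>P\<close> reconciles the two: a covering path leaves \<open>P\<close> only
  through single vertices flanked by \<open>V0\<close>, so the attachments may be paired
  arbitrarily; longer chords make the degrees odd, and a Hamiltonian path through one would lift to
  a path that is too long. Pairing needs an even number of remaining attachments. The representative
  in \<open>A\<close>, retained or suppressed, adjusts the parity in a component with at least three
  attachments; by 2-connectedness the other components away from \<open>x\<close> and
  \<open>y\<close> have exactly two. The three is also what the transversal needs: in the complex of
  independent sets of a path, a vertex and its two neighbours are the price of one dimension.
  Barring the first and last inner vertex of \<open>P\<close>, so that \<open>A\<close> has inner
  path neighbours only, costs two attachments in all, which the topological bound just
  allows.\<close>

lemma even_card_involution:
  assumes "finite S" and "\<And>a. a \<in> S \<Longrightarrow> f a \<in> S" and "\<And>a. a \<in> S \<Longrightarrow> f (f a) = a"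
    and "\<And>a. a \<in> S \<Longrightarrow> f a \<noteq> a"
  shows "even (card S)"
  using assms
proof (induction "card S" arbitrary: S rule: less_induct)
  case less
  show ?case
  proof (cases "S = {}")
    case False
    then obtain a where a: "a \<in> S" by blast
    let ?S = "S - {a, f a}"
    have "f a \<in> S" "f a \<noteq> a" using a less.prems by auto
    then have c: "card S = card ?S + 2"
      using a less.prems(1) card_mono[of S "{a, f a}"] by (simp add: card_Diff_subset)
    have "even (card ?S)"
    proof (rule less.hyps)
      show "card ?S < card S" using c by simp
      show "finite ?S" using less.prems(1) by simp
      fix b assume b: "b \<in> ?S"
      then show "f (f b) = b" "f b \<noteq> b" using less.prems by auto
      have "f b \<noteq> a" "f b \<noteq> f a" using b less.prems(3) a by (metis DiffE insertCI)+
      then show "f b \<in> ?S" using b less.prems(2) by auto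
    qed
    then show ?thesis using c by simp
  qed simp
qed

text \<open>
  A dart \<open>(u, l, v)\<close> is an edge from \<open>u\<close> to \<open>v\<close> with direction; its reverse is \<open>(v, rev l, u)\<close>.  The label
  \<open>l\<close> distinguishes parallel edges and will list the vertices suppressed on the edge.
\<close>

fun walk :: "('v \<times> 'l list \<times> 'v) set \<Rightarrow> 'v \<Rightarrow> ('l list \<times> 'v) list \<Rightarrow> bool" where
  "walk E u [] = True"
| "walk E u ((l, v) # s) = ((u, l, v) \<in> E \<and> walk E v s)"

fun final :: "'v \<Rightarrow> ('l list \<times> 'v) list \<Rightarrow> 'v" where
  "final u [] = u"
| "final u ((l, v) # s) = final v s"

fun revs :: "'v \<Rightarrow> ('l list \<times> 'v) list \<Rightarrow> ('l list \<times> 'v) list" where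
  "revs u [] = []"
| "revs u ((l, v) # s) = revs v s @ [(rev l, u)]"

lemma walk_append: "walk E u (s @ t) \<longleftrightarrow> walk E u s \<and> walk E (final u s) t"
  by (induction u s rule: final.induct) auto

lemma final_append: "final u (s @ t) = final (final u s) t"
  by (induction u s rule: final.induct) auto

lemma final_in: "final u s \<in> insert u (set (map snd s))"
  by (induction u s rule: final.induct) auto

lemma final_revs: "final (final u s) (revs u s) = u"
  by (induction u s rule: final.induct) (auto simp: final_append)

lemma walk_revs:
  assumes "\<And>u l v. (u, l, v) \<in> E \<Longrightarrow> (v, rev l, u) \<in> E"
  shows "walk E u s \<Longrightarrow> walk E (final u s) (revs u s)"
  by (induction u s rule: final.induct) (auto simp: walk_append final_revs assms)

lemma revs_append: "revs u (s @ t) = revs (final u s) t @ revs u s"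
  by (induction u s rule: final.induct) auto

lemma revs_revs: "revs (final u s) (revs u s) = s"
  by (induction u s rule: final.induct) (auto simp: revs_append final_revs)

lemma vertices_revs: "final u s # map snd (revs u s) = rev (u # map snd s)"
  by (induction u s rule: final.induct) auto

text \<open>
  Rotation at the end of a walk: a dart leads from the last vertex back to \<open>final x \<alpha>\<close>, and the part
  after \<open>\<alpha>\<close> is traversed backwards.  For \<open>\<beta> = []\<close> the dart must differ from the last step itself.
\<close>

definition "rot_closed E x PP \<longleftrightarrow> (\<forall>\<alpha> l' v' \<beta> l. \<alpha> @ (l', v') # \<beta> \<in> PP \<longrightarrow>
   (final v' \<beta>, l, final x \<alpha>) \<in> E \<longrightarrow> (\<beta> = [] \<longrightarrow> l \<noteq> rev l') \<longrightarrow>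
   \<alpha> @ (rev l, final v' \<beta>) # revs v' \<beta> \<in> PP)"

text \<open>The summand of \<open>s\<close> is the number of its rotations: every dart from the end
  of \<open>s\<close> back to a vertex of \<open>s\<close> gives one, except the reverse of the last
  step. Undoing a rotation is again a rotation, so all rotations of walks in \<open>PP\<close> fall
  into pairs.\<close>

lemma lollipop:
  assumes sym: "\<And>u l v. (u, l, v) \<in> E \<Longrightarrow> (v, rev l, u) \<in> E"
    and loop: "\<And>u l v. (u, l, v) \<in> E \<Longrightarrow> u \<noteq> v"
    and fE: "finite E" and fin: "finite PP"
    and PP: "\<And>s. s \<in> PP \<Longrightarrow> walk E x s \<and> s \<noteq> [] \<and> distinct (x # map snd s)"
    and closed: "rot_closed E x PP"
  shows "even (\<Sum>s\<in>PP. card {(l, z). (final x s, l, z) \<in> E \<and> z \<in> insert x (set (map snd s))} - 1)"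
proof -
  define R where "R s = {(\<alpha>, l', v', \<beta>, l). s = \<alpha> @ (l', v') # \<beta> \<and> (final v' \<beta>, l, final x \<alpha>) \<in> E \<and> (\<beta> = [] \<longrightarrow> l \<noteq> rev l')}" for s
  \<comment> \<open>\<open>f\<close> sends a rotation of \<open>s\<close> to the rotation of the
    resulting walk that leads back to \<open>s\<close>.\<close>
  define f where "f = (\<lambda>(\<alpha>, l', v', \<beta>, l). (\<alpha>, rev l, final v' \<beta>, revs v' \<beta>, rev l') :: (('b list \<times> 'a) list \<times> 'b list \<times> 'a \<times> ('b list \<times> 'a) list \<times> 'b list))"
  have dc: "final x \<alpha> \<in> insert x (set (map snd \<alpha>))" for \<alpha> :: "('b list \<times> 'a) list" by (rule final_in)
  have card_R: "card (R s) = card {(l, z). (final x s, l, z) \<in> E \<and> z \<in> insert x (set (map snd s))} - 1"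
    and fin_R: "finite (R s)" if s: "s \<in> PP" for s
  proof -
    let ?D = "{(l, z). (final x s, l, z) \<in> E \<and> z \<in> insert x (set (map snd s))}"
    obtain s0 l0 v0 where s0: "s = s0 @ [(l0, v0)]" using PP[OF s] by (metis prod.exhaust rev_exhaust)
    have w: "walk E x s" and d: "distinct (x # map snd s)" using PP[OF s] by auto
    have last: "(v0, rev l0, final x s0) \<in> E" using w s0 by (auto simp: walk_append sym)
    have fx: "final x s = v0" using s0 by (simp add: final_append)
    let ?g = "\<lambda>(\<alpha>, l', v', \<beta>, l). (l :: 'b list, final x \<alpha>)"
    \<comment> \<open>The walk visits no vertex twice, so a rotation is determined by its label and
      the vertex to which its dart returns.\<close>
    have eqd: "\<alpha> = \<alpha>'" if "s = \<alpha> @ (l', v') # \<beta>" "s = \<alpha>' @ (l'', v'') # \<beta>'" "final x \<alpha> = final x \<alpha>'" for \<alpha> l' v' \<beta> \<alpha>' l'' v'' \<beta>'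
    proof -
      have idx: "final x a = (x # map snd s) ! length a" "length a < length s" if "s = a @ p # b" for a p b
      proof -
        have "final x a = (x # map snd a) ! length a" by (induction x a rule: final.induct) (auto simp: nth_Cons')
        then show "final x a = (x # map snd s) ! length a" using that by (simp add: nth_append nth_Cons' )
        show "length a < length s" using that by simp
      qed
      have "length \<alpha> = length \<alpha>'" using idx[OF that(1)] idx[OF that(2)] that(3) d
        by (metis length_Cons length_map less_Suc_eq nth_eq_iff_index_eq)
      then show ?thesis using that by simp
    qed
    have inj: "inj_on ?g (R s)"
    proof (rule inj_onI)
      fix p q assume p: "p \<in> R s" and q: "q \<in> R s" and e: "?g p = ?g q"
      obtain \<alpha> l' v' \<beta> l where p': "p = (\<alpha>, l', v', \<beta>, l)" by (cases p) auto
      obtain \<alpha>2 l'2 v'2 \<beta>2 l2 where q': "q = (\<alpha>2, l'2, v'2, \<beta>2, l2)" by (cases q) auto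
      have 1: "s = \<alpha> @ (l', v') # \<beta>" "s = \<alpha>2 @ (l'2, v'2) # \<beta>2" "final x \<alpha> = final x \<alpha>2" "l = l2"
        using p q e unfolding p' q' R_def by auto
      have "\<alpha> = \<alpha>2" by (rule eqd[OF 1(1,2,3)])
      then show "p = q" using 1 unfolding p' q' by simp
    qed
    have img: "?g ` R s = ?D - {(rev l0, final x s0)}"
    proof
      show "?g ` R s \<subseteq> ?D - {(rev l0, final x s0)}"
      proof
        fix t assume "t \<in> ?g ` R s"
        then obtain \<alpha> l' v' \<beta> l where t: "t = (l, final x \<alpha>)" and s': "s = \<alpha> @ (l', v') # \<beta>"
          and e: "(final v' \<beta>, l, final x \<alpha>) \<in> E" and ne: "\<beta> = [] \<longrightarrow> l \<noteq> rev l'" unfolding R_def by auto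
        have "final x s = final v' \<beta>" using s' by (simp add: final_append)
        moreover have "final x \<alpha> \<in> insert x (set (map snd s))" using dc[of \<alpha>] s' by auto
        moreover have "t \<noteq> (rev l0, final x s0)"
        proof
          assume "t = (rev l0, final x s0)"
          then have "final x \<alpha> = final x s0" "l = rev l0" using t by auto
          then have "\<alpha> = s0" using eqd[OF s' s0] by simp
          then show False using s' s0 ne \<open>l = rev l0\<close> by simp
        qed
        ultimately show "t \<in> ?D - {(rev l0, final x s0)}" using e t by auto
      qed
      show "?D - {(rev l0, final x s0)} \<subseteq> ?g ` R s"
      proof
        fix t assume t: "t \<in> ?D - {(rev l0, final x s0)}"
        obtain l z where tz: "t = (l, z)" by (cases t)
        have e: "(v0, l, z) \<in> E" and z: "z \<in> insert x (set (map snd s))" and ne: "(l, z) \<noteq> (rev l0, final x s0)"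
          using t tz fx by auto
        have "z \<noteq> v0" using loop[OF e] by simp
        have "\<exists>\<alpha> l' v' \<beta>. s = \<alpha> @ (l', v') # \<beta> \<and> final x \<alpha> = z"
        proof (cases "z = x")
          case True
          then show ?thesis using PP[OF s] by (metis append_Nil final.simps(1) list.exhaust prod.exhaust)
        next
          case False
          then have "z \<in> set (map snd s)" using z by simp
          then obtain m where "(m, z) \<in> set s" by auto
          then obtain a b where ab: "s = a @ (m, z) # b" by (meson split_list)
          have "b \<noteq> []" using ab s0 \<open>z \<noteq> v0\<close> by auto
          then obtain l' v' \<beta> where "b = (l', v') # \<beta>" by (metis list.exhaust prod.exhaust)
          then have "s = (a @ [(m, z)]) @ (l', v') # \<beta>" "final x (a @ [(m, z)]) = z" using ab by (auto simp: final_append)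
          then show ?thesis by blast
        qed
        then obtain \<alpha> l' v' \<beta> where s': "s = \<alpha> @ (l', v') # \<beta>" and zz: "final x \<alpha> = z" by blast
        have "final v' \<beta> = v0" using s' fx by (simp add: final_append)
        moreover have "\<beta> = [] \<longrightarrow> l \<noteq> rev l'" using s' s0 ne zz by auto
        ultimately have "(\<alpha>, l', v', \<beta>, l) \<in> R s" using s' e zz unfolding R_def by auto
        then show "t \<in> ?g ` R s" using tz zz by force
      qed
    qed
    have fD: "finite ?D"
      by (rule finite_subset[of _ "snd ` E"]) (use fE in force)+
    have "(rev l0, final x s0) \<in> ?D" using last fx s0 dc[of s0] by auto
    then have "card (?D - {(rev l0, final x s0)}) = card ?D - 1" using fD by (simp add: card_Diff_singleton)
    then show "card (R s) = card ?D - 1" using card_image[OF inj] img by simp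
    show "finite (R s)" using finite_imageD[OF _ inj] img fD by simp
  qed
  let ?U = "\<Union>s\<in>PP. R s"
  have "card ?U = (\<Sum>s\<in>PP. card (R s))"
    by (rule card_UN_disjoint) (use fin fin_R in \<open>auto simp: R_def\<close>)
  moreover have "even (card ?U)"
  proof (rule even_card_involution[where f = f])
    show "finite ?U" using fin fin_R by auto
    fix a assume "a \<in> ?U"
    then obtain \<alpha> l' v' \<beta> l where a: "a = (\<alpha>, l', v', \<beta>, l)" and s: "\<alpha> @ (l', v') # \<beta> \<in> PP"
      and e: "(final v' \<beta>, l, final x \<alpha>) \<in> E" and ne: "\<beta> = [] \<longrightarrow> l \<noteq> rev l'" unfolding R_def by auto
    have fa: "f a = (\<alpha>, rev l, final v' \<beta>, revs v' \<beta>, rev l')" using a by (simp add: f_def)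
    have w: "walk E x (\<alpha> @ (l', v') # \<beta>)" and d: "distinct (x # map snd (\<alpha> @ (l', v') # \<beta>))" using PP[OF s] by auto
    have "\<alpha> @ (rev l, final v' \<beta>) # revs v' \<beta> \<in> PP" using closed s e ne unfolding rot_closed_def by blast
    moreover have "(final (final v' \<beta>) (revs v' \<beta>), rev l', final x \<alpha>) \<in> E"
      using w by (simp add: walk_append final_revs sym)
    moreover have "revs v' \<beta> = [] \<longrightarrow> rev l' \<noteq> rev (rev l)"
      using ne by (metis list.simps(3) neq_Nil_conv revs.simps(1) revs_revs rev_rev_ident)
    ultimately show "f a \<in> ?U" unfolding fa R_def by auto
    show "f (f a) = a" unfolding fa by (simp add: f_def a revs_revs final_revs)
    \<comment> \<open>A fixed point has \<open>final v' \<beta> = v'\<close>, hence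
      \<open>\<beta> = []\<close> by distinctness, and then \<open>l = rev l'\<close>, which
      \<open>R\<close> excludes.\<close>
    show "f a \<noteq> a"
    proof
      assume "f a = a"
      then have "final v' \<beta> = v'" "rev l = l'" unfolding fa unfolding a by auto
      moreover have "\<beta> \<noteq> [] \<Longrightarrow> final v' \<beta> \<in> set (map snd \<beta>)" by (cases \<beta>) (auto, metis final_in insert_iff list.set_map)
      ultimately show False using ne d by (cases "\<beta> = []") auto
    qed
  qed
  ultimately show ?thesis using card_R by simp
qed

section \<open>Independent transversals\<close>

text \<open>
  Chains over the two-element field in the complex of independent sets of the path \<open>0, 1, 2, \<dots>\<close>.  The
  empty set is a face, so homology is reduced.
\<close>

type_synonym chain = "nat set \<Rightarrow> bit"

text \<open>The coefficient of the face \<open>t\<close> in the simplicial boundary, read off from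
  the cofaces of \<open>t\<close>; modulo 2 there are no signs.\<close>

definition boundary :: "nat set \<Rightarrow> chain \<Rightarrow> chain" where
  "boundary W c t = (\<Sum>v\<in>W - t. c (insert v t))"

definition spread :: "nat set \<Rightarrow> bool" where
  "spread s \<longleftrightarrow> (\<forall>i\<in>s. Suc i \<notin> s)"

text \<open>\<open>k\<close> counts vertices, so it is the dimension plus one; over a finite
  \<open>W\<close> the empty face spans \<open>chains W 0\<close>.\<close>

definition chains :: "nat set \<Rightarrow> nat \<Rightarrow> chain set" where
  "chains W k = {c. \<forall>s. c s \<noteq> 0 \<longrightarrow> s \<subseteq> W \<and> card s = k \<and> spread s}"

lemma bit_add_eq_0: "(a :: bit) + b = 0 \<longleftrightarrow> a = b"
  by (cases a; cases b) auto

lemma bit_add_cancel: "(a :: bit) + (b + a) = b"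
  by (cases a; cases b) auto

text \<open>Each unordered pair of distinct elements occurs twice. This makes the boundary of a
  boundary vanish, and later the sum over the facets of a simplex a cycle.\<close>

lemma bit_sum_cancel:
  fixes g :: "'a \<Rightarrow> 'a \<Rightarrow> bit"
  assumes "finite W" and "\<And>v w. v \<in> W \<Longrightarrow> w \<in> W \<Longrightarrow> g v w = g w v"
  shows "(\<Sum>v\<in>W. \<Sum>w\<in>W - {v}. g v w) = 0"
  using assms
proof (induction W rule: finite_induct)
  case (insert a W)
  have "(\<Sum>v\<in>insert a W. \<Sum>w\<in>insert a W - {v}. g v w) =
      (\<Sum>w\<in>W. g a w) + (\<Sum>v\<in>W. \<Sum>w\<in>insert a W - {v}. g v w)"
    using insert by simp
  also have "(\<Sum>v\<in>W. \<Sum>w\<in>insert a W - {v}. g v w) = (\<Sum>v\<in>W. g v a + (\<Sum>w\<in>W - {v}. g v w))"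
  proof (rule sum.cong)
    fix v assume "v \<in> W"
    then have "insert a W - {v} = insert a (W - {v})" using insert by auto
    then show "(\<Sum>w\<in>insert a W - {v}. g v w) = g v a + (\<Sum>w\<in>W - {v}. g v w)" using insert by simp
  qed simp
  also have "\<dots> = (\<Sum>v\<in>W. g v a) + (\<Sum>v\<in>W. \<Sum>w\<in>W - {v}. g v w)" by (rule sum.distrib)
  also have "(\<Sum>v\<in>W. \<Sum>w\<in>W - {v}. g v w) = 0" using insert by blast
  also have "(\<Sum>w\<in>W. g a w) = (\<Sum>v\<in>W. g v a)" by (rule sum.cong) (use insert in auto)
  finally show ?case by simp
qed simp

lemma boundary_boundary:
  assumes "finite W"
  shows "boundary W (boundary W c) t = 0"
proof -
  have "boundary W (boundary W c) t = (\<Sum>v\<in>W - t. \<Sum>w\<in>(W - t) - {v}. c (insert w (insert v t)))"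
    unfolding boundary_def by (intro sum.cong) auto
  also have "\<dots> = 0"
    by (rule bit_sum_cancel) (use assms in \<open>auto simp: insert_commute\<close>)
  finally show ?thesis .
qed

text \<open>It permits computing every boundary in one common ground set.\<close>

lemma boundary_mono:
  assumes "finite W'" "W \<subseteq> W'" "c \<in> chains W k"
  shows "boundary W' c t = boundary W c t"
  unfolding boundary_def
proof (rule sum.mono_neutral_right)
  show "\<forall>v\<in>W' - t - (W - t). c (insert v t) = 0"
  proof
    fix v assume "v \<in> W' - t - (W - t)"
    then have "\<not> insert v t \<subseteq> W" by auto
    then show "c (insert v t) = 0" using assms(3) unfolding chains_def by blast
  qed
qed (use assms in auto)

lemma boundary_add: "boundary W (\<lambda>s. c s + c' s) t = boundary W c t + boundary W c' t"
  unfolding boundary_def by (rule sum.distrib)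

lemma chains_add: "c \<in> chains W k \<Longrightarrow> c' \<in> chains W k \<Longrightarrow> (\<lambda>s. c s + c' s) \<in> chains W k"
  unfolding chains_def
proof (intro CollectI allI impI)
  fix s assume c: "c \<in> {c. \<forall>s. c s \<noteq> 0 \<longrightarrow> s \<subseteq> W \<and> card s = k \<and> spread s}"
    "c' \<in> {c. \<forall>s. c s \<noteq> 0 \<longrightarrow> s \<subseteq> W \<and> card s = k \<and> spread s}" and "c s + c' s \<noteq> 0"
  then have "c s \<noteq> 0 \<or> c' s \<noteq> 0" by force
  then show "s \<subseteq> W \<and> card s = k \<and> spread s" using c by blast
qed

lemma chainsD: "c \<in> chains W k \<Longrightarrow> c s \<noteq> 0 \<Longrightarrow> s \<subseteq> W \<and> card s = k \<and> spread s"
  unfolding chains_def by blast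

lemma chainsI: "(\<And>s. c s \<noteq> 0 \<Longrightarrow> s \<subseteq> W \<and> card s = k \<and> spread s) \<Longrightarrow> c \<in> chains W k"
  unfolding chains_def by blast

lemma chains_mono: "c \<in> chains W k \<Longrightarrow> W \<subseteq> W' \<Longrightarrow> c \<in> chains W' k"
  unfolding chains_def by blast

definition cone :: "nat \<Rightarrow> chain \<Rightarrow> chain" where
  "cone r c s = (if r \<in> s then c (s - {r}) else 0)"

text \<open>A vertex without neighbours in \<open>W\<close> can be added to every independent subset
  of \<open>W\<close>.\<close>

lemma cone_chains:
  assumes "finite W" "c \<in> chains W k" "r \<notin> W" "\<And>i. i \<in> W \<Longrightarrow> r \<noteq> Suc i \<and> i \<noteq> Suc r"
  shows "cone r c \<in> chains (insert r W) (Suc k)"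
  unfolding chains_def
proof (intro CollectI allI impI)
  fix s assume "cone r c s \<noteq> 0"
  then have r: "r \<in> s" and "c (s - {r}) \<noteq> 0" unfolding cone_def by presburger+
  then have c: "s - {r} \<subseteq> W" "card (s - {r}) = k" "spread (s - {r})" using assms(2) unfolding chains_def by blast+
  have "finite s" using c(1) assms(1) finite_subset by fastforce
  then have "card s = Suc k" using c(2) r by (metis card_Suc_Diff1)
  moreover have "spread s" unfolding spread_def
  proof
    fix i assume "i \<in> s"
    consider "i = r" | "Suc i = r" "i \<noteq> r" | "i \<noteq> r" "Suc i \<noteq> r" by blast
    then show "Suc i \<notin> s"
    proof cases
      case 1
      then show ?thesis using c(1) assms(4)[of "Suc i"] by auto
    next
      case 2
      then show ?thesis using \<open>i \<in> s\<close> c(1) assms(4)[of i] by auto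
    next
      case 3
      then show ?thesis using \<open>i \<in> s\<close> c(3) unfolding spread_def by blast
    qed
  qed
  ultimately show "s \<subseteq> insert r W \<and> card s = Suc k \<and> spread s" using c(1) by blast
qed

text \<open>The usual cone formula: removing \<open>r\<close> returns \<open>c\<close>, and removing
  any other vertex commutes with coning.\<close>

lemma boundary_cone:
  assumes "finite W" "c \<in> chains W k" "r \<notin> W"
  shows "boundary (insert r W) (cone r c) t = c t + cone r (boundary W c) t"
proof (cases "r \<in> t")
  case True
  have "boundary (insert r W) (cone r c) t = (\<Sum>v\<in>W - t. c (insert v (t - {r})))"
    unfolding boundary_def using True assms by (intro sum.cong) (auto simp: cone_def insert_Diff_if)
  also have "\<dots> = boundary W c (t - {r})" unfolding boundary_def using assms by (intro sum.cong) auto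
  finally have e: "boundary (insert r W) (cone r c) t = boundary W c (t - {r})" .
  have "c t = 0" using True assms(3) chainsD[OF assms(2), of t] by blast
  then show ?thesis unfolding e using True by (simp add: cone_def)
next
  case False
  have e: "insert r W - t = insert r (W - t)" using False by auto
  have "boundary (insert r W) (cone r c) t = c (insert r t - {r}) + (\<Sum>v\<in>W - t. cone r c (insert v t))"
    unfolding boundary_def e using assms by (simp add: cone_def)
  also have "(\<Sum>v\<in>W - t. cone r c (insert v t)) = 0"
    by (rule sum.neutral) (use False assms in \<open>auto simp: cone_def\<close>)
  finally have e: "boundary (insert r W) (cone r c) t = c (insert r t - {r})" by simp
  have "insert r t - {r} = t" using False by auto
  then show ?thesis unfolding e using False by (simp add: cone_def)
qed

text \<open>
  The largest \<open>r \<in> W\<close> is a cone point if \<open>r - 1 \<notin> W\<close>.  Otherwise write the cycle as \<open>(r - 1) * a + b\<close>; the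
  link \<open>a\<close> is a cycle avoiding \<open>r\<close>, \<open>r - 1\<close> and \<open>r - 2\<close>, so it bounds by induction, which lets us
  remove \<open>r - 1\<close> and then cone with \<open>r\<close>.
\<close>

lemma cycle_bounds:
  assumes "finite W" "card W + 2 \<ge> 3 * Suc k" "y \<in> chains W k" "\<And>t. boundary W y t = 0"
  shows "\<exists>c \<in> chains W (Suc k). \<forall>t. boundary W c t = y t"
  using assms
proof (induction k arbitrary: W y)
  case 0
  then obtain r where r: "r \<in> W" by fastforce
  let ?W = "{}::nat set"
  have y: "y \<in> chains {} 0"
  proof (rule chainsI)
    fix s assume "y s \<noteq> 0"
    then have "s \<subseteq> W" "card s = 0" using chainsD[OF 0(3)] by auto
    then have "s = {}" using 0(1) finite_subset by fastforce
    then show "s \<subseteq> {} \<and> card s = 0 \<and> spread s" by (simp add: spread_def)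
  qed
  have "cone r y \<in> chains (insert r {}) (Suc 0)" by (rule cone_chains) (use y in auto)
  moreover have "boundary W (cone r y) t = y t" for t
  proof -
    have "boundary W (cone r y) t = boundary {r} (cone r y) t" by (rule boundary_mono[of _ _ _ 1]) (use calculation r 0 in auto)
    also have "\<dots> = y t + cone r (boundary {} y) t" by (rule boundary_cone) (use y in auto)
    also have "cone r (boundary {} y) t = 0" by (simp add: cone_def boundary_def)
    finally show ?thesis by simp
  qed
  ultimately show ?case using chains_mono[of _ "{r}" 1 W] r by auto
next
  case (Suc k)
  define r where "r = Max W"
  have "W \<noteq> {}" using Suc.prems(2) by auto
  then have r: "r \<in> W" "\<And>i. i \<in> W \<Longrightarrow> i \<le> r" using Suc.prems(1) r_def by auto
  \<comment> \<open>If \<open>r\<close> has no neighbour in \<open>W'\<close>, the complex on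
    \<open>W'\<close> is a cone: the part \<open>z0\<close> of \<open>z\<close> that avoids
    \<open>r\<close>, coned with \<open>r\<close>, has boundary \<open>z\<close>.\<close>
  have iso: "\<exists>c \<in> chains W' (Suc (Suc k)). \<forall>t. boundary W c t = z t"
    if W': "W' \<subseteq> W" "r \<in> W'" "\<And>i. i \<in> W' \<Longrightarrow> r \<noteq> Suc i" and z: "z \<in> chains W' (Suc k)" "\<And>t. boundary W z t = 0" for z W'
  proof -
    define z1 z0 where "z1 = (\<lambda>s. if r \<in> s then 0 else z (insert r s))" and "z0 = (\<lambda>s. if r \<in> s then 0 else z s)"
    let ?W = "W' - {r}"
    have fin: "finite W'" using W'(1) Suc.prems(1) finite_subset by blast
    have z0: "z0 \<in> chains ?W (Suc k)"
    proof (rule chainsI)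
      fix s assume "z0 s \<noteq> 0"
      then have "r \<notin> s" "z s \<noteq> 0" unfolding z0_def by presburger+
      then show "s \<subseteq> ?W \<and> card s = Suc k \<and> spread s" using chainsD[OF z(1)] by blast
    qed
    have cz: "cone r z0 \<in> chains (insert r ?W) (Suc (Suc k))"
      by (rule cone_chains) (use z0 fin W' r(2) in fastforce)+
    have iw: "insert r ?W = W'" using W' by auto
    have "boundary W (cone r z0) t = z t" for t
    proof -
      have "boundary W (cone r z0) t = boundary (insert r ?W) (cone r z0) t" unfolding iw
        by (rule boundary_mono) (use Suc.prems(1) W' cz iw in auto)
      also have "\<dots> = z0 t + cone r (boundary ?W z0) t" by (rule boundary_cone) (use z0 fin in auto)
      also have "\<dots> = z t"
      proof (cases "r \<in> t")
        case False then show ?thesis by (simp add: cone_def z0_def)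
      next
        case True
        let ?t = "t - {r}"
        \<comment> \<open>The cycle condition at \<open>t - {r}\<close> identifies the link of
          \<open>r\<close> in \<open>z\<close> with the boundary of \<open>z0\<close>.\<close>
        have "0 = boundary W z ?t" using z(2) by simp
        also have "\<dots> = boundary W' z ?t" by (rule boundary_mono) (use Suc.prems(1) W' z in auto)
        also have "\<dots> = z (insert r ?t) + (\<Sum>v\<in>?W - ?t. z (insert v ?t))"
        proof -
          have "W' - ?t = insert r (?W - ?t)" using W'(2) by auto
          then show ?thesis unfolding boundary_def using fin by simp
        qed
        also have "(\<Sum>v\<in>?W - ?t. z (insert v ?t)) = boundary ?W z0 ?t"
          unfolding boundary_def z0_def by (rule sum.cong) auto
        finally have "z (insert r ?t) + boundary ?W z0 ?t = 0" by (rule sym)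
        then have "z t = boundary ?W z0 ?t" unfolding bit_add_eq_0 using True by (simp add: insert_absorb)
        then show ?thesis using True by (simp add: cone_def z0_def)
      qed
      finally show ?thesis .
    qed
    then show ?thesis using cz iw by auto
  qed
  show ?case
  proof (cases "\<exists>q. r = Suc q \<and> q \<in> W")
    case False
    then show ?thesis using iso[of W y] Suc.prems r by auto
  next
    case True
    then obtain q where q: "r = Suc q" "q \<in> W" by blast
    \<comment> \<open>A face that contains \<open>q\<close> contains neither \<open>r\<close> nor
      \<open>q - 1\<close>. At most three vertices are lost, which is what the factor 3 in the bound
      allows when \<open>k\<close> drops by one.\<close>
    define N where "N = {i \<in> W. i = r \<or> i = q \<or> Suc i = q}"
    define W1 where "W1 = W - N"
    have "N \<subseteq> {r, q, q - 1}" unfolding N_def by auto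
    then have "card N \<le> card {r, q, q - 1}" by (rule card_mono[rotated]) simp
    also have "\<dots> \<le> 3" by (simp add: card_insert_if)
    finally have cN: "card N \<le> 3" .
    have fW1: "finite W1" unfolding W1_def using Suc.prems(1) by simp
    have "card W1 \<ge> card W - 3" unfolding W1_def using cN diff_card_le_card_Diff[of N W] Suc.prems(1) N_def by auto
    then have cW1: "card W1 + 2 \<ge> 3 * Suc k" using Suc.prems(2) by simp
    define a where "a = (\<lambda>s. if q \<in> s then 0 else y (insert q s))"
    have a: "a \<in> chains W1 k" unfolding chains_def
    proof (intro CollectI allI impI)
      fix s assume "a s \<noteq> 0"
      then have "q \<notin> s" "y (insert q s) \<noteq> 0" unfolding a_def by presburger+
      then have 1: "insert q s \<subseteq> W" "card (insert q s) = Suc k" "spread (insert q s)"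
        using Suc.prems(3) unfolding chains_def by blast+
      moreover have "finite s" using 1(1) Suc.prems(1) finite_subset by (metis finite_insert)
      ultimately show "s \<subseteq> W1 \<and> card s = k \<and> spread s" using \<open>q \<notin> s\<close> q
        unfolding W1_def N_def spread_def by auto
    qed
    have ca: "boundary W1 a t = 0" for t
    proof -
      have *: "boundary W1 a t = boundary W a t" by (rule boundary_mono[symmetric]) (use a Suc.prems(1) W1_def in auto)
      show ?thesis
      proof (cases "q \<in> t")
        case True then show ?thesis unfolding * boundary_def a_def by simp
      next
        case False
        have "boundary W a t = (\<Sum>v\<in>W - insert q t. y (insert v (insert q t)))"
          unfolding boundary_def a_def using Suc.prems(1)
          by (intro sum.mono_neutral_cong_right) (auto simp: insert_commute False)
        also have "\<dots> = boundary W y (insert q t)" unfolding boundary_def by simp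
        finally show ?thesis using * Suc.prems(4) by simp
      qed
    qed
    obtain a' where a': "a' \<in> chains W1 (Suc k)" "\<And>t. boundary W1 a' t = a t"
      using Suc.IH[OF fW1 cW1 a ca] by blast
    have q1: "q \<notin> W1" unfolding W1_def N_def using q by auto
    have ca': "cone q a' \<in> chains (insert q W1) (Suc (Suc k))"
      by (rule cone_chains) (use fW1 a' q1 q in \<open>auto simp: W1_def N_def\<close>)
    have bca: "boundary W (cone q a') t = a' t + cone q a t" for t
    proof -
      have "boundary W (cone q a') t = boundary (insert q W1) (cone q a') t"
        by (rule boundary_mono) (use Suc.prems(1) q(2) ca' W1_def in auto)
      also have "\<dots> = a' t + cone q (boundary W1 a') t" by (rule boundary_cone) (use fW1 a' q1 in auto)
      also have "cone q (boundary W1 a') t = cone q a t" using a'(2) by (simp add: cone_def)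
      finally show ?thesis .
    qed
    \<comment> \<open>Adding this boundary replaces the part of \<open>y\<close> on faces through
      \<open>q\<close> by \<open>a'\<close>; no face of \<open>z\<close> contains \<open>q\<close>,
      so \<open>r\<close> has become isolated.\<close>
    define z where "z = (\<lambda>t. y t + boundary W (cone q a') t)"
    have zz: "z t = (if q \<in> t then 0 else y t) + a' t" for t
    proof (cases "q \<in> t")
      case True
      then have "cone q a t = y t" by (simp add: cone_def a_def insert_absorb)
      then show ?thesis unfolding z_def bca using True bit_add_cancel[of "y t" "a' t"] by simp
    next
      case False then show ?thesis unfolding z_def bca by (simp add: cone_def)
    qed
    have "z \<in> chains (W - {q}) (Suc k)"
    proof -
      have "(\<lambda>t. if q \<in> t then 0 else y t) \<in> chains (W - {q}) (Suc k)"
      proof (rule chainsI)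
        fix s assume "(if q \<in> s then 0 else y s) \<noteq> 0"
        then have "q \<notin> s" "y s \<noteq> 0" by presburger+
        then show "s \<subseteq> W - {q} \<and> card s = Suc k \<and> spread s" using chainsD[OF Suc.prems(3)] by blast
      qed
      moreover have "a' \<in> chains (W - {q}) (Suc k)" by (rule chains_mono[OF a'(1)]) (use q1 W1_def in auto)
      ultimately have "(\<lambda>t. (if q \<in> t then 0 else y t) + a' t) \<in> chains (W - {q}) (Suc k)" by (rule chains_add)
      then show ?thesis using zz by presburger
    qed
    moreover have "boundary W z t = 0" for t
      unfolding z_def boundary_add using Suc.prems(4) boundary_boundary[OF Suc.prems(1)] by simp
    ultimately obtain c where c: "c \<in> chains (W - {q}) (Suc (Suc k))" "\<And>t. boundary W c t = z t"
      using iso[of "W - {q}" z] r q by auto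
    have "(\<lambda>s. c s + cone q a' s) \<in> chains W (Suc (Suc k))"
      by (rule chains_add) (use chains_mono[OF c(1)] chains_mono[OF ca'] q(2) W1_def in auto)
    moreover have "boundary W (\<lambda>s. c s + cone q a' s) t = y t" for t
      unfolding boundary_add c(2) z_def by (cases "boundary W (cone q a') t") simp_all
    ultimately show ?thesis by (intro bexI[of _ "\<lambda>s. c s + cone q a' s"]) auto
  qed
qed

lemma sum_bit: "finite S \<Longrightarrow> (\<Sum>a\<in>S. g a :: bit) = of_nat (card {a \<in> S. g a = 1})"
proof (induction S rule: finite_induct)
  case (insert a S)
  have "{b \<in> insert a S. g b = 1} = (if g a = 1 then insert a {b \<in> S. g b = 1} else {b \<in> S. g b = 1})" by auto
  then show ?case using insert by (cases "g a") auto
qed simp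

lemma sum_bit_involution:
  fixes g :: "'a \<Rightarrow> bit"
  assumes "finite S" and "\<And>a. a \<in> S \<Longrightarrow> f a \<in> S" and "\<And>a. a \<in> S \<Longrightarrow> f (f a) = a"
    and "\<And>a. a \<in> S \<Longrightarrow> f a \<noteq> a" and "\<And>a. a \<in> S \<Longrightarrow> g (f a) = g a"
  shows "sum g S = 0"
proof -
  have "even (card {a \<in> S. g a = 1})"
    by (rule even_card_involution[where f = f]) (use assms in auto)
  then obtain k where "card {a \<in> S. g a = 1} = k + k" by (metis dvdE mult_2)
  then have "sum g S = of_nat k + of_nat k" unfolding sum_bit[OF assms(1)] by (simp only: of_nat_add)
  then show ?thesis unfolding bit_add_eq_0 by simp
qed

text \<open>
  Sperner's argument: chains \<open>c J\<close> are built over all \<open>J \<subseteq> T\<close> as images of the faces of a simplex, and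
  the number of rainbow faces turns out to be odd.
\<close>

lemma spread_transversal:
  fixes T :: "'i set" and V :: "'i \<Rightarrow> nat set"
  assumes fT: "finite T" and fV: "\<And>t. t \<in> T \<Longrightarrow> finite (V t)"
    and dis: "\<And>t t'. t \<in> T \<Longrightarrow> t' \<in> T \<Longrightarrow> t \<noteq> t' \<Longrightarrow> V t \<inter> V t' = {}"
    and big: "\<And>J. J \<subseteq> T \<Longrightarrow> J \<noteq> {} \<Longrightarrow> card (\<Union> (V ` J)) + 2 \<ge> 3 * card J"
  shows "\<exists>S. spread S \<and> S \<subseteq> \<Union> (V ` T) \<and> (\<forall>t\<in>T. card (S \<inter> V t) = 1)"
proof -
  define U where "U J = \<Union> (V ` J)" for J
  have fU: "finite (U J)" if "J \<subseteq> T" for J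
    unfolding U_def by (rule finite_UN_I[OF finite_subset[OF that fT]]) (use that fV in blast)
  have Umono: "U J \<subseteq> U K" if "J \<subseteq> K" for J K unfolding U_def using that by auto
  \<comment> \<open>The conditions say that \<open>z\<close> is an augmented chain map from the full
    simplex on \<open>T\<close>, sending each face to a chain inside the union of its colour classes
    \<open>V j\<close>.\<close>
  define ok where "ok z J \<longleftrightarrow> z J \<in> chains (U J) (card J) \<and>
     (J = {} \<longrightarrow> z J {} = 1) \<and> (J \<noteq> {} \<longrightarrow> (\<forall>t. boundary (U T) (z J) t = (\<Sum>j\<in>J. z (J - {j}) t)))" for z :: "'i set \<Rightarrow> chain" and J
  have "\<exists>z. \<forall>J \<subseteq> T. card J \<le> m \<longrightarrow> ok z J" for m
  proof (induction m)
    case 0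
    define z0 :: "'i set \<Rightarrow> chain" where "z0 J s = (if s = {} then 1 else 0)" for J s
    have "z0 {} \<in> chains (U {}) (card ({}::'i set))"
    proof (rule chainsI)
      fix s assume "z0 {} s \<noteq> 0"
      then have "s = {}" unfolding z0_def by presburger
      then show "s \<subseteq> U {} \<and> card s = card ({}::'i set) \<and> spread s" by (simp add: spread_def)
    qed
    moreover have "z0 {} {} = 1" unfolding z0_def by simp
    ultimately have "ok z0 {}" unfolding ok_def by blast
    moreover have "J = {}" if "J \<subseteq> T" "card J \<le> 0" for J
      using that finite_subset[OF that(1) fT] by simp
    ultimately show ?case by blast
  next
    case (Suc m)
    then obtain z where z: "\<And>J. J \<subseteq> T \<Longrightarrow> card J \<le> m \<Longrightarrow> ok z J" by blast
    have ex: "\<exists>c. c \<in> chains (U J) (Suc m) \<and> (\<forall>t. boundary (U T) c t = (\<Sum>j\<in>J. z (J - {j}) t))" if J: "J \<subseteq> T" "card J = Suc m" for J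
    proof -
      have fJ: "finite J" using J fT finite_subset by blast
      have cj: "card (J - {j}) = m" if "j \<in> J" for j using that J fJ by simp
      have okj: "ok z (J - {j})" if "j \<in> J" for j by (rule z) (use J cj that in auto)
      let ?y = "\<lambda>t. \<Sum>j\<in>J. z (J - {j}) t"
      have y: "?y \<in> chains (U J) m"
      proof (rule chainsI)
        fix s assume "?y s \<noteq> 0"
        then obtain j where j: "j \<in> J" "z (J - {j}) s \<noteq> 0" by (meson sum.neutral)
        have "z (J - {j}) \<in> chains (U (J - {j})) m" using okj[OF j(1)] cj[OF j(1)] unfolding ok_def by simp
        from chainsD[OF this j(2)] show "s \<subseteq> U J \<and> card s = m \<and> spread s" using Umono[of "J - {j}" J] by blast
      qed
      have bdy: "boundary (U J) ?y t = 0" for t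
      \<comment> \<open>For \<open>m = 0\<close> the chain sits on the empty face, which has no
        boundary; the recursive equation in \<open>ok\<close> starts only at nonempty index
        sets.\<close>
      proof (cases "m = 0")
        case True
        then obtain j where "J = {j}" using J card_1_singletonE by auto
        have "?y s = 0" if "s \<noteq> {}" for s
        proof (rule ccontr)
          assume "?y s \<noteq> 0"
          from chainsD[OF y this] have "s \<subseteq> U J" "card s = 0" using True by auto
          then show False using that finite_subset[OF \<open>s \<subseteq> U J\<close> fU[OF J(1)]] by simp
        qed
        then show ?thesis unfolding boundary_def by (intro sum.neutral) auto
      next
        case False
        have "boundary (U J) ?y t = boundary (U T) ?y t" by (rule boundary_mono[symmetric, OF fU _ y]) (use J Umono in auto)
        also have "\<dots> = (\<Sum>j\<in>J. boundary (U T) (z (J - {j})) t)" unfolding boundary_def by (rule sum.swap)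
        also have "\<dots> = (\<Sum>j\<in>J. \<Sum>i\<in>J - {j}. z (J - {j} - {i}) t)"
        proof (rule sum.cong)
          fix j assume j: "j \<in> J"
          have "J - {j} \<noteq> {}" using cj[OF j] False by (metis card.empty)
          then show "boundary (U T) (z (J - {j})) t = (\<Sum>i\<in>J - {j}. z (J - {j} - {i}) t)" using okj[OF j] unfolding ok_def by simp
        qed simp
        also have "\<dots> = 0"
        proof (rule bit_sum_cancel[OF fJ])
          fix v w
          have "J - {v} - {w} = J - {w} - {v}" by auto
          then show "z (J - {v} - {w}) t = z (J - {w} - {v}) t" by (simp only:)
        qed
        finally show ?thesis .
      qed
      \<comment> \<open>The assumption \<open>big\<close> is exactly the bound of
        \<open>cycle_bounds\<close> when \<open>Suc k\<close> is the size of
        \<open>J\<close>.\<close>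
      obtain c where c: "c \<in> chains (U J) (Suc m)" "\<And>t. boundary (U J) c t = ?y t"
      proof -
        have "J \<noteq> {}" using J by auto
        then have "3 * Suc m \<le> card (U J) + 2" using big[OF J(1)] J(2) unfolding U_def by simp
        from cycle_bounds[OF fU[OF J(1)] this y bdy] show thesis using that by blast
      qed
      have "boundary (U T) c t = boundary (U J) c t" for t by (rule boundary_mono[OF fU _ c(1)]) (use J Umono in auto)
      then show ?thesis using c by auto
    qed
    define z' where "z' J = (if card J = Suc m then (SOME c. c \<in> chains (U J) (Suc m) \<and> (\<forall>t. boundary (U T) c t = (\<Sum>j\<in>J. z (J - {j}) t))) else z J)" for J
    have "ok z' J" if J: "J \<subseteq> T" "card J \<le> Suc m" for J
    proof -
      have fJ: "finite J" using J fT finite_subset by blast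
      have zz: "z' (J - {j}) = z (J - {j})" if "j \<in> J" for j using J card_Diff1_less[OF fJ that] unfolding z'_def by auto
      show ?thesis
      proof (cases "card J = Suc m")
        case True
        have "z' J \<in> chains (U J) (Suc m) \<and> (\<forall>t. boundary (U T) (z' J) t = (\<Sum>j\<in>J. z (J - {j}) t))"
          using someI_ex[OF ex[OF J(1) True]] True unfolding z'_def by simp
        then show ?thesis using True zz unfolding ok_def by auto
      next
        case False
        then have "ok z J" using z J by auto
        then show ?thesis using zz False unfolding ok_def by (auto simp: z'_def)
      qed
    qed
    then show ?case by blast
  qed
  then obtain z where z: "\<And>J. J \<subseteq> T \<Longrightarrow> ok z J" by (metis card_mono fT)
  \<comment> \<open>The rainbow faces of \<open>J\<close>.\<close>
  define tr where "tr J = {s. s \<subseteq> U J \<and> (\<forall>j\<in>J. card (s \<inter> V j) = 1)}" for J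
  have ftr: "finite (tr J)" if "J \<subseteq> T" for J
    by (rule finite_subset[of _ "Pow (U J)"]) (use fU[OF that] in \<open>auto simp: tr_def\<close>)
  have "(\<Sum>s\<in>tr J. z J s) = 1" if "J \<subseteq> T" for J
    using finite_subset[OF that fT] that
  proof (induction J rule: finite_induct)
    case empty
    have "tr {} = {{}}" unfolding tr_def U_def by auto
    then show ?case using z[of "{}"] unfolding ok_def by simp
  next
    case (insert j K)
    let ?J = "insert j K"
    have JT: "?J \<subseteq> T" "K \<subseteq> T" "j \<in> T" using insert by auto
    have okJ: "ok z ?J" by (rule z[OF JT(1)])
    have UJ: "U ?J = V j \<union> U K" unfolding U_def by auto
    have dj: "V j \<inter> U K = {}" unfolding U_def using dis JT insert(2) by fastforce
    have Vin: "V i \<subseteq> U K" if "i \<in> K" for i using that unfolding U_def by auto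
    have "(\<Sum>u\<in>tr K. boundary (U T) (z ?J) u) = (\<Sum>u\<in>tr K. \<Sum>i\<in>?J. z (?J - {i}) u)"
      using okJ unfolding ok_def by simp
    also have "\<dots> = (\<Sum>u\<in>tr K. z K u)"
    proof (rule sum.cong)
      fix u assume u: "u \<in> tr K"
      \<comment> \<open>\<open>u\<close> has a vertex of colour \<open>i\<close>, but the chain
        \<open>z (?J - {i})\<close> uses no such vertex.\<close>
      have "z (?J - {i}) u = 0" if "i \<in> K" for i
      proof (rule ccontr)
        assume n: "z (?J - {i}) u \<noteq> 0"
        have "ok z (?J - {i})" by (rule z) (use JT in auto)
        then have "z (?J - {i}) \<in> chains (U (?J - {i})) (card (?J - {i}))" unfolding ok_def by blast
        from chainsD[OF this n] have "u \<subseteq> U (?J - {i})" by blast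
        moreover have "V i \<inter> U (?J - {i}) = {}" unfolding U_def using dis JT that by fastforce
        ultimately have "u \<inter> V i = {}" by auto
        then show False using u that unfolding tr_def by auto
      qed
      moreover have "?J - {j} = K" using insert by auto
      ultimately show "(\<Sum>i\<in>?J. z (?J - {i}) u) = z K u" using insert by simp
    qed simp
    also have "\<dots> = 1" using insert JT by simp
    finally have 1: "(\<Sum>u\<in>tr K. boundary (U T) (z ?J) u) = 1" .
    have b: "boundary (U T) (z ?J) u = boundary (U ?J) (z ?J) u" for u
      by (rule boundary_mono[OF fU]) (use okJ JT Umono in \<open>auto simp: ok_def\<close>)
    \<comment> \<open>A coface of a rainbow face \<open>u\<close> of \<open>K\<close> either gains
      the colour \<open>j\<close>, and is rainbow for \<open>?J\<close>, or repeats a colour of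
      \<open>K\<close>. \<open>A\<close> and \<open>B\<close> separate the two kinds.\<close>
    define A where "A = (SIGMA u : tr K. V j)"
    define B where "B = (SIGMA u : tr K. U K - u)"
    have fin: "finite (tr K)" "finite (V j)" "finite (U K)" using ftr fV fU JT by auto
    have "boundary (U ?J) (z ?J) u = (\<Sum>v\<in>V j. z ?J (insert v u)) + (\<Sum>v\<in>U K - u. z ?J (insert v u))" if "u \<in> tr K" for u
    proof -
      have e: "U ?J - u = V j \<union> (U K - u)" using that dj UJ unfolding tr_def by auto
      show ?thesis unfolding boundary_def e by (rule sum.union_disjoint) (use fin dj in auto)
    qed
    then have "(\<Sum>u\<in>tr K. boundary (U T) (z ?J) u) =
        (\<Sum>u\<in>tr K. (\<Sum>v\<in>V j. z ?J (insert v u)) + (\<Sum>v\<in>U K - u. z ?J (insert v u)))"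
      unfolding b by (intro sum.cong) (simp_all only:)
    also have "\<dots> = (\<Sum>u\<in>tr K. \<Sum>v\<in>V j. z ?J (insert v u)) + (\<Sum>u\<in>tr K. \<Sum>v\<in>U K - u. z ?J (insert v u))"
      by (rule sum.distrib)
    also have "(\<Sum>u\<in>tr K. \<Sum>v\<in>V j. z ?J (insert v u)) = (\<Sum>(u, v)\<in>A. z ?J (insert v u))"
      unfolding A_def by (rule sum.Sigma) (use fin in auto)
    also have "(\<Sum>u\<in>tr K. \<Sum>v\<in>U K - u. z ?J (insert v u)) = (\<Sum>(u, v)\<in>B. z ?J (insert v u))"
      unfolding B_def by (rule sum.Sigma) (use fin in auto)
    finally have AB: "(\<Sum>u\<in>tr K. boundary (U T) (z ?J) u) = (\<Sum>(u, v)\<in>A. z ?J (insert v u)) + (\<Sum>(u, v)\<in>B. z ?J (insert v u))" .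
    \<comment> \<open>A set in which one colour occurs twice arises from two pairs, according to
      which of its two equally coloured vertices is called \<open>v\<close>; their terms
      cancel.\<close>
    moreover have "(\<Sum>(u, v)\<in>B. z ?J (insert v u)) = 0"
    proof -
      define i where "i v = (THE i. i \<in> K \<and> v \<in> V i)" for v
      have i_eq: "i v = k" if "k \<in> K" "v \<in> V k" for v k
        unfolding i_def
      proof (rule the_equality)
        fix k' assume "k' \<in> K \<and> v \<in> V k'"
        then show "k' = k" using dis[of k' k] that JT(2) by blast
      qed (use that in blast)
      have i: "i v \<in> K \<and> v \<in> V (i v)" if "v \<in> U K" for v
      proof -
        obtain k where "k \<in> K" "v \<in> V k" using \<open>v \<in> U K\<close> unfolding U_def by blast
        then show ?thesis using i_eq[of k v] by simp
      qed
      define w where "w u v = the_elem (u \<inter> V (i v))" for u v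
      have w: "u \<inter> V (i v) = {w u v}" if "u \<in> tr K" "v \<in> U K" for u v
      proof -
        have "card (u \<inter> V (i v)) = 1" using that i[OF that(2)] unfolding tr_def by blast
        then obtain e where "u \<inter> V (i v) = {e}" using card_1_singletonE by blast
        then show ?thesis unfolding w_def by simp
      qed
      define f where "f = (\<lambda>(u, v). (insert v u - {w u v}, w u v))"
      show ?thesis
      proof (rule sum_bit_involution[where f = f])
        show "finite B" unfolding B_def using fin by auto
        fix a assume "a \<in> B"
        then obtain u v where a: "a = (u, v)" and u: "u \<in> tr K" and v: "v \<in> U K" "v \<notin> u" unfolding B_def by auto
        have key: "x = w u v" if "x \<in> u" "x \<in> V (i v)" for x using w[OF u v(1)] that by blast
        have wu1: "w u v \<in> u" "w u v \<in> V (i v)" using w[OF u v(1)] by blast+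
        then have wu: "w u v \<in> u" "w u v \<in> V (i v)" "w u v \<noteq> v" using v by metis+
        have iv: "i v \<in> K" "v \<in> V (i v)" using i[OF v(1)] by auto
        let ?u = "insert v u - {w u v}"
        have fa: "f a = (?u, w u v)" unfolding f_def a by simp
        have eqi: "?u \<inter> V (i v) = {v}" using key iv wu by blast
        have "card (?u \<inter> V k) = 1" if k: "k \<in> K" for k
        proof (cases "k = i v")
          case False
          then have "V k \<inter> V (i v) = {}" using dis k iv JT by blast
          then have "?u \<inter> V k = u \<inter> V k" using iv wu by auto
          then show ?thesis using u k unfolding tr_def by auto
        qed (use eqi in simp)
        moreover have "?u \<subseteq> U K" using u v unfolding tr_def by auto
        ultimately have u': "?u \<in> tr K" unfolding tr_def by auto
        have wU: "w u v \<in> U K" using Vin iv wu by blast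
        show "f a \<in> B" unfolding fa B_def using u' wU by auto
        have "i (w u v) = i v" by (rule i_eq) (use iv wu in auto)
        then have "w ?u (w u v) = v" unfolding w_def[of ?u] using eqi by simp
        then show "f (f a) = a" unfolding fa unfolding f_def a using v wu by auto
        show "f a \<noteq> a" using fa a wu by (metis prod.inject)
        show "(case f a of (u, v) \<Rightarrow> z ?J (insert v u)) = (case a of (u, v) \<Rightarrow> z ?J (insert v u))"
        proof -
          have "insert (w u v) ?u = insert v u" using wu by blast
          then show ?thesis unfolding fa unfolding a by (simp only: prod.case)
        qed
      qed
    qed
    moreover have "(\<Sum>(u, v)\<in>A. z ?J (insert v u)) = (\<Sum>s\<in>tr ?J. z ?J s)"
      unfolding case_prod_beta'
    proof (rule sum.reindex_bij_betw)
      show "bij_betw (\<lambda>p. insert (snd p) (fst p)) A (tr ?J)"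
      proof (rule bij_betw_imageI)
        show "inj_on (\<lambda>p. insert (snd p) (fst p)) A"
        proof (rule inj_onI)
          fix p q assume "p \<in> A" "q \<in> A" and e: "insert (snd p) (fst p) = insert (snd q) (fst q)"
          then have p: "fst p \<subseteq> U K" "snd p \<in> V j" and q: "fst q \<subseteq> U K" "snd q \<in> V j" unfolding A_def tr_def by auto
          have "snd p \<in> insert (snd q) (fst q)" using e by blast
          then have "snd p = snd q" using p q dj by blast
          moreover have "fst p = insert (snd p) (fst p) \<inter> U K" "fst q = insert (snd q) (fst q) \<inter> U K" using p q dj by blast+
          then have "fst p = fst q" using e by simp
          ultimately show "p = q" by (simp add: prod_eq_iff)
        qed
        show "(\<lambda>p. insert (snd p) (fst p)) ` A = tr ?J"
        proof (intro equalityI subsetI)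
          fix s assume "s \<in> (\<lambda>p. insert (snd p) (fst p)) ` A"
          then obtain u v where s: "s = insert v u" and u: "u \<in> tr K" and v: "v \<in> V j" unfolding A_def by auto
          have "s \<inter> V j = {v}" using s u v dj unfolding tr_def by auto
          then have "card (s \<inter> V j) = 1" by simp
          moreover have "s \<inter> V k = u \<inter> V k" if "k \<in> K" for k using s v dj Vin[OF that] by auto
          moreover have "s \<subseteq> U ?J" using s u v unfolding tr_def UJ by blast
          moreover have "card (u \<inter> V k) = 1" if "k \<in> K" for k using u that unfolding tr_def by blast
          ultimately show "s \<in> tr ?J" unfolding tr_def by simp
        next
          fix s assume s: "s \<in> tr ?J"
          then have "card (s \<inter> V j) = 1" unfolding tr_def by auto
          then obtain v where v: "s \<inter> V j = {v}" using card_1_singletonE by blast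
          have "s - {v} \<subseteq> U K" using s v unfolding tr_def UJ by auto
          moreover have "(s - {v}) \<inter> V k = s \<inter> V k" if "k \<in> K" for k using v dj Vin[OF that] by auto
          moreover have "card (s \<inter> V k) = 1" if "k \<in> K" for k using s that unfolding tr_def by blast
          ultimately have "s - {v} \<in> tr K" unfolding tr_def by simp
          then have "(s - {v}, v) \<in> A" unfolding A_def using v by auto
          moreover have "insert (snd (s - {v}, v)) (fst (s - {v}, v)) = s" using v by auto
          ultimately show "s \<in> (\<lambda>p. insert (snd p) (fst p)) ` A" by (metis (no_types, lifting) image_eqI)
        qed
      qed
    qed
    ultimately show ?case using 1 AB by (simp only: add_0_right)
  qed
  from this[of T] have "(\<Sum>s\<in>tr T. z T s) \<noteq> 0" by simp
  then obtain s where s: "s \<in> tr T" "z T s \<noteq> 0" by (meson sum.neutral)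
  have "z T \<in> chains (U T) (card T)" using z[of T] unfolding ok_def by blast
  from chainsD[OF this s(2)] show ?thesis using s(1) unfolding tr_def U_def by blast
qed

section \<open>Linkages\<close>

locale ugraph =
  fixes adj :: "'a \<Rightarrow> 'a \<Rightarrow> bool"
  assumes adj_sym: "adj u v \<Longrightarrow> adj v u" and adj_irrefl: "\<not> adj u u"
    and fin_nbrs: "finite {w. adj v w}" and deg3: "card {w. adj v w} \<le> 3"
begin

text \<open>Connectedness as a building sequence: read backwards it deletes vertices one at a time,
  each adjacent to a remaining one.\<close>

inductive grown :: "'a set \<Rightarrow> bool" where
  "grown {z}"
| "grown D \<Longrightarrow> z \<notin> D \<Longrightarrow> e \<in> D \<Longrightarrow> adj z e \<Longrightarrow> grown (insert z D)"

definition chord :: "'a set \<Rightarrow> 'a set \<Rightarrow> ('a \<Rightarrow> 'a) \<Rightarrow> 'a \<Rightarrow> 'a list \<Rightarrow> 'a \<Rightarrow> bool" where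
  "chord D T th u l v \<longleftrightarrow> u \<in> T \<and> v \<in> T \<and> u \<noteq> v \<and> successively adj (u # l @ [v]) \<and>
     distinct l \<and> set l \<subseteq> D \<and> l \<noteq> [] \<and> hd l = th u"

text \<open>Closure under reversal makes the one-sided clauses two-sided: a chord also ends at the
  attachment of its target, and chords that meet have the same pair of ends.\<close>

definition linkage :: "'a set \<Rightarrow> 'a set \<Rightarrow> ('a \<Rightarrow> 'a) \<Rightarrow> ('a \<times> 'a list \<times> 'a) set \<Rightarrow> bool" where
  "linkage D T th C \<longleftrightarrow> (\<forall>u l v. (u, l, v) \<in> C \<longrightarrow> chord D T th u l v \<and> (v, rev l, u) \<in> C) \<and>
     (\<forall>u\<in>T. \<exists>!p. (u, p) \<in> C) \<and>
     (\<forall>u l v u' l' v'. (u, l, v) \<in> C \<longrightarrow> (u', l', v') \<in> C \<longrightarrow> set l \<inter> set l' \<noteq> {} \<longrightarrow> u' = u \<or> u' = v)"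

lemma linkageD:
  assumes "linkage D T th C" "(u, l, v) \<in> C"
  shows "chord D T th u l v" "(v, rev l, u) \<in> C"
  using assms(1)[unfolded linkage_def, THEN conjunct1, rule_format, OF assms(2)] by simp_all

lemma linkage_ex1:
  assumes "linkage D T th C" "u \<in> T"
  shows "\<exists>!p. (u, p) \<in> C"
  using assms(1)[unfolded linkage_def, THEN conjunct2, THEN conjunct1, rule_format, OF assms(2)] .

lemma linkage_disj:
  assumes "linkage D T th C" "(u, l, v) \<in> C" "(u', l', v') \<in> C" "w \<in> set l" "w \<in> set l'"
  shows "u' = u \<or> u' = v"
  using assms(1)[unfolded linkage_def, THEN conjunct2, THEN conjunct2, rule_format, OF assms(2,3)] assms(4,5) by blast

lemma linkage_Un:
  assumes "linkage D T th C" "linkage D' T' th C'" "D \<inter> D' = {}" "T \<inter> T' = {}"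
  shows "linkage (D \<union> D') (T \<union> T') th (C \<union> C')"
  unfolding linkage_def
proof (intro conjI allI impI ballI)
  fix u l v assume "(u, l, v) \<in> C \<union> C'"
  then show "chord (D \<union> D') (T \<union> T') th u l v" "(v, rev l, u) \<in> C \<union> C'"
    using linkageD[OF assms(1)] linkageD[OF assms(2)] unfolding chord_def by blast+
next
  fix u assume "u \<in> T \<union> T'"
  have *: "(u, p) \<in> C \<Longrightarrow> u \<in> T" "(u, p) \<in> C' \<Longrightarrow> u \<in> T'" for p
    using linkageD(1)[OF assms(1)] linkageD(1)[OF assms(2)] unfolding chord_def by (cases p; blast)+
  show "\<exists>!p. (u, p) \<in> C \<union> C'" using \<open>u \<in> T \<union> T'\<close> linkage_ex1[OF assms(1)] linkage_ex1[OF assms(2)] * assms(4) by blast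
next
  fix u l v u' l' v' assume "(u, l, v) \<in> C \<union> C'" "(u', l', v') \<in> C \<union> C'" and ne: "set l \<inter> set l' \<noteq> {}"
  moreover have "set l \<subseteq> D" if "(u, l, v) \<in> C" for u l v using linkageD(1)[OF assms(1) that] unfolding chord_def by blast
  moreover have "set l \<subseteq> D'" if "(u, l, v) \<in> C'" for u l v using linkageD(1)[OF assms(2) that] unfolding chord_def by blast
  ultimately have "((u, l, v) \<in> C \<and> (u', l', v') \<in> C) \<or> ((u, l, v) \<in> C' \<and> (u', l', v') \<in> C')" using assms(3) by blast
  moreover obtain w where "w \<in> set l" "w \<in> set l'" using ne by blast
  ultimately show "u' = u \<or> u' = v" using linkage_disj[OF assms(1)] linkage_disj[OF assms(2)] by metis
qed

lemma linkage_mono: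
  assumes "linkage D T th C" "D \<subseteq> D'"
  shows "linkage D' T th C"
  unfolding linkage_def
proof (intro conjI allI impI ballI)
  fix u l v assume "(u, l, v) \<in> C"
  from linkageD[OF assms(1) this] show "chord D' T th u l v" "(v, rev l, u) \<in> C"
    using assms(2) unfolding chord_def by auto
next
  fix u assume "u \<in> T" then show "\<exists>!p. (u, p) \<in> C" by (rule linkage_ex1[OF assms(1)])
next
  fix u l v u' l' v' assume "(u, l, v) \<in> C" "(u', l', v') \<in> C" "set l \<inter> set l' \<noteq> {}"
  then show "u' = u \<or> u' = v" using linkage_disj[OF assms(1)] by blast
qed

lemma linkage_pair:
  assumes "b \<noteq> c" "adj b z" "adj c z" "th b = z" "th c = z"
  shows "linkage {z} {b, c} th {(b, [z], c), (c, [z], b)}"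
  unfolding linkage_def chord_def using assms adj_sym[OF assms(2)] adj_sym[OF assms(3)]
  by (auto simp: successively_Cons)

lemma linkage_empty: "linkage D {} th {}"
  unfolding linkage_def by simp

text \<open>Induction on the building sequence. The last vertex \<open>z\<close> has a neighbour
  \<open>e\<close> in \<open>D\<close>, so by the degree bound at most two terminals attach at
  \<open>z\<close>: two are joined through \<open>z\<close>, while a single one is replaced by
  \<open>z\<close> itself, now attached at \<open>e\<close>.\<close>

theorem linkage_exists:
  assumes "grown D" "finite T" "even (card T)" "T \<inter> D = {}" "\<And>u. u \<in> T \<Longrightarrow> th u \<in> D \<and> adj u (th u)"
  shows "\<exists>C. linkage D T th C"
  using assms
proof (induction D arbitrary: T th rule: grown.induct)
  case (1 z)
  have "T \<subseteq> {w. adj z w}" using 1 adj_sym by auto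
  then have "card T \<le> 3" using card_mono[OF fin_nbrs] deg3 le_trans by blast
  then have "card T = 0 \<or> card T = 2" using 1(2) by (auto elim!: evenE)
  then show ?case
  proof
    assume "card T = 0"
    then have "T = {}" using 1 by simp
    then show ?thesis using linkage_empty by blast
  next
    assume "card T = 2"
    then obtain b c where T: "T = {b, c}" "b \<noteq> c" by (meson card_2_iff)
    then have "th b = z" "adj b z" "th c = z" "adj c z" using 1(4)[of b] 1(4)[of c] by auto
    then have "linkage {z} T th {(b, [z], c), (c, [z], b)}" unfolding T(1) by (intro linkage_pair T)
    then show ?thesis by blast
  qed
next
  case (2 D z e)
  note prems = "2.prems" "2.hyps" and IH = "2.IH"
  have attachment: "th u \<in> insert z D" "adj u (th u)" if "u \<in> T" for u using "2.prems"(4)[OF that] by auto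
  define Z where "Z = {u \<in> T. th u = z}"
  have "Z \<subseteq> {w. adj z w} - {e}"
  proof
    fix u assume u: "u \<in> Z"
    then have "adj u z" "u \<in> T" using attachment unfolding Z_def by auto
    then show "u \<in> {w. adj z w} - {e}" using prems adj_sym by auto
  qed
  moreover have "card ({w. adj z w} - {e}) \<le> 2" using deg3[of z] fin_nbrs[of z] prems by (simp add: card_Diff_singleton)
  ultimately have "card Z \<le> 2" using card_mono[of "{w. adj z w} - {e}" Z] fin_nbrs by (meson finite_Diff le_trans)
  moreover have fZ: "finite Z" using prems unfolding Z_def by simp
  ultimately consider "Z = {}" | b where "Z = {b}" | b c where "Z = {b, c}" "b \<noteq> c"
    by (metis One_nat_def card_1_singleton_iff card_2_iff card_eq_0_iff le_SucE le_zero_eq numeral_2_eq_2)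
  then show ?case
  proof cases
    case 1
    have "\<exists>C. linkage D T th C" by (rule IH) (use prems 1 in \<open>auto simp: Z_def\<close>)
    then show ?thesis using linkage_mono by blast
  next
    case (3 b c)
    have bc: "b \<in> T" "c \<in> T" "th b = z" "th c = z" using 3 unfolding Z_def by blast+
    have T: "T = {b, c} \<union> (T - {b, c})" using bc by auto
    have "card T = card (T - {b, c}) + 2" using bc 3 prems by (subst T, subst card_Un_disjoint) auto
    then have "\<exists>C. linkage D (T - {b, c}) th C"
      by (intro IH) (use prems 3 in \<open>auto simp: Z_def\<close>)
    then obtain C where C: "linkage D (T - {b, c}) th C" by blast
    have "linkage ({z} \<union> D) ({b, c} \<union> (T - {b, c})) th ({(b, [z], c), (c, [z], b)} \<union> C)"
    proof (rule linkage_Un[OF linkage_pair C])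
      show "adj b z" "adj c z" using attachment[OF bc(1)] attachment[OF bc(2)] bc by auto
    qed (use 3 bc prems in auto)
    then show ?thesis using T by auto
  next
    case (2 b)
    have b: "b \<in> T" "th b = z" "\<And>u. u \<in> T \<Longrightarrow> u \<noteq> b \<Longrightarrow> th u \<in> D" using 2 prems unfolding Z_def by blast+
    define T' where "T' = insert z (T - {b})"
    define th' where "th' = th(z := e)"
    have zT: "z \<notin> T" using prems by auto
    have "card T' = card T" unfolding T'_def using zT prems(1) card.remove[OF prems(1) b(1)] by simp
    have "\<exists>C. linkage D T' th' C"
    proof (rule IH)
      show "finite T'" "even (card T')" "T' \<inter> D = {}" using prems \<open>card T' = card T\<close> unfolding T'_def by auto
      fix u assume "u \<in> T'"
      then show "th' u \<in> D \<and> adj u (th' u)" using b prems zT unfolding T'_def th'_def by auto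
    qed
    then obtain C where C: "linkage D T' th' C" by blast
    obtain l0 v0 where l0: "(z, l0, v0) \<in> C" using linkage_ex1[OF C, of z] unfolding T'_def by auto
    have uz: "l = l0 \<and> v = v0" if "(z, l, v) \<in> C" for l v using linkage_ex1[OF C, of z] l0 that unfolding T'_def by blast
    have c0: "chord D T' th' z l0 v0" "(v0, rev l0, z) \<in> C" "chord D T' th' v0 (rev l0) z" using linkageD[OF C] l0 by blast+
    have uv: "l = rev l0 \<and> v = z" if "(v0, l, v) \<in> C" for l v
      using linkage_ex1[OF C, of v0] c0(1,2) that unfolding chord_def by blast
    have v0: "v0 \<in> T" "v0 \<noteq> b" "v0 \<noteq> z" using c0(1) unfolding chord_def T'_def by auto
    have nb: "(b, p) \<notin> C" "(u, l, b) \<notin> C" for p u l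
    proof -
      have "b \<notin> T'" unfolding T'_def using b(1) zT by auto
      then show "(b, p) \<notin> C" "(u, l, b) \<notin> C" using linkageD(1)[OF C] unfolding chord_def by (cases p; blast)+
    qed
    \<comment> \<open>The chord that started at \<open>z\<close> is prolonged to \<open>b\<close>;
      its other end \<open>v0\<close> stays.\<close>
    let ?C = "{d \<in> C. fst d \<noteq> z \<and> snd (snd d) \<noteq> z} \<union> {(b, z # l0, v0), (v0, rev l0 @ [z], b)}"
    have zv: "u = v0 \<and> l = rev l0" if "(u, l, z) \<in> C" for u l using uz[OF linkageD(2)[OF C that]] by auto
    have old: "u \<in> T - {b, v0} \<and> v \<in> T - {b, v0}" if "(u, l, v) \<in> C" "u \<noteq> z" "v \<noteq> z" for u l v
    proof -
      have "u \<noteq> v0" using uv that by blast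
      moreover have "v \<noteq> v0" using uv linkageD(2)[OF C that(1)] that(2) by blast
      ultimately show ?thesis using linkageD(1)[OF C that(1)] that nb unfolding chord_def T'_def by auto
    qed
    have mem: "(p, q, r) \<in> ?C \<longleftrightarrow> ((p, q, r) \<in> C \<and> p \<noteq> z \<and> r \<noteq> z) \<or> (p = b \<and> q = z # l0 \<and> r = v0) \<or> (p = v0 \<and> q = rev l0 @ [z] \<and> r = b)" for p q r
      by auto
    have "linkage (insert z D) T th ?C" unfolding linkage_def
    proof (intro conjI allI impI ballI)
      fix u l v assume uv1: "(u, l, v) \<in> ?C"
      show "chord (insert z D) T th u l v"
      proof (cases "(u, l, v) \<in> C \<and> u \<noteq> z \<and> v \<noteq> z")
        case True
        then show ?thesis using linkageD(1)[OF C, of u l v] old[of u l v] unfolding chord_def th'_def by auto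
      next
        case False
        then consider "u = b" "l = z # l0" "v = v0" | "u = v0" "l = rev l0 @ [z]" "v = b" using uv1 by auto
        then show ?thesis
        proof cases
          case 1
          then show ?thesis using c0(1) v0 b prems unfolding chord_def th'_def by auto
        next
          case 2
          have "successively adj (v0 # rev l0 @ [z])" using c0(3) unfolding chord_def by simp
          moreover have "adj z b" using b prems adj_sym by blast
          ultimately have "successively adj ((v0 # rev l0 @ [z]) @ [b])"
            by (subst successively_append_iff) auto
          then show ?thesis using 2 c0(1,3) v0 b prems unfolding chord_def th'_def by auto
        qed
      qed
      show "(v, rev l, u) \<in> ?C" using uv1 linkageD(2)[OF C, of u l v] by auto
    next
      fix u assume u: "u \<in> T"
      consider "u = b" | "u = v0" | "u \<noteq> b" "u \<noteq> v0" by blast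
      then show "\<exists>!p. (u, p) \<in> ?C"
      proof cases
        case 1
        show ?thesis by (rule ex1I[of _ "(z # l0, v0)"]) (use 1 nb v0 in auto)
      next
        case 2
        show ?thesis by (rule ex1I[of _ "(rev l0 @ [z], b)"]) (use 2 uv v0 in auto)
      next
        case 3
        then have uT: "u \<in> T'" "u \<noteq> z" using u zT unfolding T'_def by auto
        obtain l v where p: "(u, l, v) \<in> C" "\<And>q. (u, q) \<in> C \<Longrightarrow> q = (l, v)"
          using linkage_ex1[OF C uT(1)] by (metis surj_pair)
        have "v \<noteq> z" using zv p(1) 3 by blast
        show ?thesis
        proof (rule ex1I)
          show "(u, l, v) \<in> ?C" using p(1) uT(2) \<open>v \<noteq> z\<close> by simp
          fix q assume "(u, q) \<in> ?C"
          then have "(u, q) \<in> C" using 3 by blast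
          then show "q = (l, v)" by (rule p(2))
        qed
      qed
    next
      fix u l v u' l' v' assume a: "(u, l, v) \<in> ?C" "(u', l', v') \<in> ?C" "set l \<inter> set l' \<noteq> {}"
      have sD: "set l \<subseteq> D" if "(u, l, v) \<in> C" for u l v using linkageD(1)[OF C that] unfolding chord_def by blast
      have n0: "w \<noteq> z \<and> w \<notin> set l0" if c: "(u, l, v) \<in> C" "u \<noteq> z" "v \<noteq> z" and w: "w \<in> set l" for u l v w
      proof
        show "w \<noteq> z" using sD[OF c(1)] w prems(6) by blast
        show "w \<notin> set l0"
        proof
          assume "w \<in> set l0"
          then have "u = z \<or> u = v0" using linkage_disj[OF C l0 c(1) _ w] by blast
          then show False using old[OF c] c(2) by blast
        qed
      qed
      obtain w where w: "w \<in> set l" "w \<in> set l'" using a(3) by blast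
      show "u' = u \<or> u' = v"
      proof (cases "(u, l, v) \<in> C \<and> u \<noteq> z \<and> v \<noteq> z")
        case True
        then have "w \<noteq> z \<and> w \<notin> set l0" using n0[OF _ _ _ w(1)] by blast
        then have "l' \<noteq> z # l0" "l' \<noteq> rev l0 @ [z]" using w(2) by auto
        then have "(u', l', v') \<in> C" using a(2)[unfolded mem] by blast
        then show ?thesis using linkage_disj[OF C _ _ w] True by blast
      next
        case False
        then have "u = b \<and> l = z # l0 \<and> v = v0 \<or> u = v0 \<and> l = rev l0 @ [z] \<and> v = b" using a(1)[unfolded mem] by blast
        then have 1: "w = z \<or> w \<in> set l0" "u = b \<and> v = v0 \<or> u = v0 \<and> v = b" using w(1) by auto
        then have "\<not> ((u', l', v') \<in> C \<and> u' \<noteq> z \<and> v' \<noteq> z)" using n0[OF _ _ _ w(2)] by blast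
        then have "u' = b \<or> u' = v0" using a(2)[unfolded mem] by blast
        then show ?thesis using 1(2) by blast
      qed
    qed
    then show ?thesis by blast
  qed
qed

text \<open>A maximal subset of \<open>D\<close> with a building sequence is closed under adjacency
  inside \<open>D\<close>.\<close>

lemma grownI:
  assumes fD: "finite D" and ne: "D \<noteq> {}"
    and conn: "\<And>S. S \<subseteq> D \<Longrightarrow> S \<noteq> {} \<Longrightarrow> (\<And>u v. u \<in> S \<Longrightarrow> v \<in> D \<Longrightarrow> adj u v \<Longrightarrow> v \<in> S) \<Longrightarrow> S = D"
  shows "grown D"
proof -
  obtain z where z: "z \<in> D" using ne by blast
  let ?F = "{S. S \<subseteq> D \<and> grown S}"
  have "finite ?F" by (rule finite_subset[of _ "Pow D"]) (use fD in auto)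
  moreover have "{z} \<in> ?F" using z grown.intros(1) by auto
  ultimately obtain S where S: "S \<in> ?F" "\<And>S'. S' \<in> ?F \<Longrightarrow> S \<subseteq> S' \<Longrightarrow> S' = S"
    using finite_has_maximal2 by (metis (no_types, lifting))
  have "S \<noteq> {}" using S(1) grown.cases by fastforce
  moreover have "v \<in> S" if "u \<in> S" "v \<in> D" "adj u v" for u v
  proof (rule ccontr)
    assume n: "v \<notin> S"
    then have "grown (insert v S)" using grown.intros(2) S(1) that adj_sym by blast
    then have "insert v S \<in> ?F" using S(1) that(2) by simp
    then have "insert v S = S" using S(2) by blast
    then show False using n by blast
  qed
  ultimately have "S = D" using conn S(1) by blast
  then show ?thesis using S by blast
qed

end

section \<open>Paths covering the vertices outside an independent set\<close>

definition nb :: "'a list \<Rightarrow> 'a \<Rightarrow> 'a set" where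
  "nb r v = {u. \<exists>\<alpha> \<beta>. r = \<alpha> @ [u, v] @ \<beta> \<or> r = \<alpha> @ [v, u] @ \<beta>}"

lemma nb_sym: "u \<in> nb r v \<longleftrightarrow> v \<in> nb r u"
  unfolding nb_def by auto

lemma nb_set: "u \<in> nb r v \<Longrightarrow> u \<in> set r \<and> v \<in> set r"
  unfolding nb_def by auto

lemma nb_eq:
  assumes "distinct r" "r = \<alpha> @ [a, v, b] @ \<beta>"
  shows "nb r v = {a, b}"
proof -
  have u: "ys = \<gamma> \<and> zs = \<delta>" if "r = ys @ v # zs" "r = \<gamma> @ v # \<delta>" for ys zs \<gamma> \<delta>
  proof -
    have "distinct (ys @ v # zs)" "distinct (\<gamma> @ v # \<delta>)" using assms(1) that by metis+
    then have n: "v \<notin> set ys" "v \<notin> set zs" by auto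
    have "ys @ v # zs = \<gamma> @ v # \<delta>" using that by metis
    then show ?thesis unfolding append_Cons_eq_iff[OF n] .
  qed
  have r: "r = (\<alpha> @ [a]) @ v # (b # \<beta>)" using assms(2) by simp
  show ?thesis
  proof (intro equalityI subsetI)
    fix w assume "w \<in> nb r v"
    then obtain \<gamma> \<delta> where "r = \<gamma> @ [w, v] @ \<delta> \<or> r = \<gamma> @ [v, w] @ \<delta>" unfolding nb_def by auto
    then have "r = (\<gamma> @ [w]) @ v # \<delta> \<or> r = \<gamma> @ v # (w # \<delta>)" by simp
    then have "\<alpha> @ [a] = \<gamma> @ [w] \<or> b # \<beta> = w # \<delta>" using u[OF r] by blast
    then show "w \<in> {a, b}" by auto
  next
    fix w assume "w \<in> {a, b}"
    moreover have "r = \<alpha> @ [a, v] @ (b # \<beta>)" "r = (\<alpha> @ [a]) @ [v, b] @ \<beta>" using assms(2) by auto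
    ultimately show "w \<in> nb r v" unfolding nb_def by blast
  qed
qed

lemma inner_split:
  assumes "v \<in> set r" "v \<noteq> hd r" "v \<noteq> last r"
  shows "\<exists>\<alpha> a b \<beta>. r = \<alpha> @ [a, v, b] @ \<beta>"
proof -
  obtain s t where r: "r = s @ v # t" using assms(1) by (meson split_list)
  have "s \<noteq> []" using assms(2) r by auto
  then obtain \<alpha> a where s: "s = \<alpha> @ [a]" by (metis rev_exhaust)
  have "t \<noteq> []" using assms(3) r by auto
  then obtain b \<beta> where "t = b # \<beta>" by (metis list.exhaust)
  then show ?thesis using r s by auto
qed

lemma card_nb:
  assumes "distinct r" "v \<in> set r" "v \<noteq> hd r" "v \<noteq> last r"
  shows "card (nb r v) = 2" "finite (nb r v)"
proof -
  obtain \<alpha> a b \<beta> where r: "r = \<alpha> @ [a, v, b] @ \<beta>" using inner_split assms by metis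
  then have "a \<noteq> b" using assms(1) by auto
  then show "card (nb r v) = 2" "finite (nb r v)" using nb_eq[OF assms(1) r] by auto
qed

text \<open>
  \<open>unbound\<close> is the negation of the theorem, so the locale turns out to be inconsistent.
\<close>

locale cubic_longest = ugraph +
  fixes V :: "'a set" and P :: "'a list" and x y :: 'a
  assumes finV: "finite V" and adjV: "adj u v \<Longrightarrow> u \<in> V"
    and cubic: "v \<in> V \<Longrightarrow> card {w. adj v w} = 3"
    and two_conn: "\<lbrakk>z \<in> V; S \<subseteq> V - {z}; S \<noteq> {}; \<And>u v. u \<in> S \<Longrightarrow> v \<in> V - {z} \<Longrightarrow> adj u v \<Longrightarrow> v \<in> S\<rbrakk> \<Longrightarrow> S = V - {z}"
    and xV: "x \<in> V" and yV: "y \<in> V" and xy: "x \<noteq> y"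
    and P_path: "distinct P" "successively adj P" "P \<noteq> []" "hd P = x" "last P = y"
    and longest: "\<And>q. distinct q \<Longrightarrow> successively adj q \<Longrightarrow> q \<noteq> [] \<Longrightarrow> hd q = x \<Longrightarrow> last q = y \<Longrightarrow> length q \<le> length P"
    and unbound: "\<And>v. v \<in> set P \<Longrightarrow> v \<noteq> x \<Longrightarrow> v \<noteq> y \<Longrightarrow> \<exists>w. adj v w \<and> w \<notin> set P"
begin

definition xypath :: "'a list \<Rightarrow> bool" where
  "xypath q \<longleftrightarrow> distinct q \<and> successively adj q \<and> q \<noteq> [] \<and> hd q = x \<and> last q = y"

lemma xypath_P: "xypath P"
  unfolding xypath_def using P_path by simp

lemma xypath_le: "xypath q \<Longrightarrow> length q \<le> length P"
  unfolding xypath_def by (elim conjE) (rule longest)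

lemma nb_adj:
  assumes "successively adj r" "u \<in> nb r v"
  shows "adj v u"
proof -
  obtain \<alpha> \<beta> where "r = \<alpha> @ [u, v] @ \<beta> \<or> r = \<alpha> @ [v, u] @ \<beta>" using assms(2) unfolding nb_def by blast
  then have "adj u v \<or> adj v u" using assms(1) by (auto simp: successively_append_iff)
  then show ?thesis using adj_sym[of u v] by blast
qed

lemma xypath_V:
  assumes "xypath r"
  shows "set r \<subseteq> V"
proof
  fix v assume v: "v \<in> set r"
  show "v \<in> V"
  proof (cases "v = x \<or> v = y")
    case False
    then have "card (nb r v) = 2" using card_nb[of r v] assms v unfolding xypath_def by auto
    then obtain u where "u \<in> nb r v" by fastforce
    then show ?thesis using nb_adj assms adjV unfolding xypath_def by blast
  qed (use xV yV in auto)
qed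

lemma xypath_xy: "xypath r \<Longrightarrow> x \<in> set r \<and> y \<in> set r"
  using hd_in_set[of r] last_in_set[of r] unfolding xypath_def by simp

lemma card_nb_xypath: "xypath r \<Longrightarrow> v \<in> set r \<Longrightarrow> v \<noteq> x \<Longrightarrow> v \<noteq> y \<Longrightarrow> card (nb r v) = 2 \<and> finite (nb r v)"
  using card_nb[of r v] unfolding xypath_def by simp

lemma nb_adj_xypath: "xypath r \<Longrightarrow> u \<in> nb r v \<Longrightarrow> adj v u"
  using nb_adj[of r u v] unfolding xypath_def by simp

definition I :: "'a set" where "I = set P - {x, y}"

definition th :: "'a \<Rightarrow> 'a" where "th v = (SOME w. adj v w \<and> w \<notin> set P)"

definition off :: "'a set" where "off = V - set P"

lemma th: "v \<in> I \<Longrightarrow> adj v (th v) \<and> th v \<notin> set P"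
  unfolding th_def by (rule someI_ex, rule unbound) (auto simp: I_def)

lemma th_off: "v \<in> I \<Longrightarrow> th v \<in> off"
  using th[of v] adjV[OF adj_sym[of v "th v"]] unfolding off_def by simp

text \<open>The two path neighbours and \<open>th v\<close> exhaust the degree; in particular
  \<open>P\<close> has no chord at an inner vertex.\<close>

lemma nbrs_I:
  assumes "v \<in> I"
  shows "{w. adj v w} = insert (th v) (nb P v)" "th v \<notin> nb P v" "card (nb P v) = 2" "finite (nb P v)"
proof -
  have v: "v \<in> set P" "v \<noteq> x" "v \<noteq> y" "v \<in> V" using assms xypath_V[OF xypath_P] unfolding I_def by auto
  show 2: "card (nb P v) = 2" and f: "finite (nb P v)" using card_nb_xypath[OF xypath_P] v by blast+
  show t: "th v \<notin> nb P v" using th[OF assms] nb_set by metis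
  have "insert (th v) (nb P v) \<subseteq> {w. adj v w}" using th[OF assms] nb_adj_xypath[OF xypath_P] by auto
  moreover have "card (insert (th v) (nb P v)) = 3" using 2 f t by simp
  ultimately show "{w. adj v w} = insert (th v) (nb P v)"
    using card_subset_eq[OF fin_nbrs[of v]] cubic[OF v(4)] by metis
qed

lemma adj_off_I: "v \<in> I \<Longrightarrow> adj v w \<Longrightarrow> w \<notin> set P \<Longrightarrow> w = th v"
  using nbrs_I(1) nb_set by (metis insertE mem_Collect_eq)

lemma adj_P_I: "v \<in> I \<Longrightarrow> adj v w \<Longrightarrow> w \<in> set P \<Longrightarrow> w \<in> nb P v"
  using nbrs_I(1) th by (metis insertE mem_Collect_eq)

end

text \<open>\<open>nb P a \<subseteq> I - A\<close> says at once that no two vertices of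
  \<open>A\<close> are consecutive on \<open>P\<close> and that none is next to \<open>x\<close> or
  \<open>y\<close>.\<close>

locale reps = cubic_longest +
  fixes A :: "'a set"
  assumes A_I: "A \<subseteq> I" and A_nb: "\<And>a. a \<in> A \<Longrightarrow> nb P a \<subseteq> I - A"
begin

definition V0 :: "'a set" where "V0 = I - A"

definition covering :: "'a list set" where "covering = {r. xypath r \<and> V0 \<subseteq> set r}"

definition leaving :: "'a list \<Rightarrow> 'a set" where "leaving r = {v \<in> V0. th v \<in> nb r v}"

lemma finite_I: "finite I" unfolding I_def by simp

lemma P_covering: "P \<in> covering" unfolding covering_def V0_def I_def using xypath_P by auto

text \<open>On \<open>r\<close> the vertex \<open>q\<close> needs two of its three neighbours. With
  \<open>a\<close> missed these can only be \<open>th q\<close> and the other path neighbour, so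
  \<open>q\<close> leaves \<open>P\<close> and its other path neighbour is not missed.\<close>

lemma missed_nb:
  assumes r: "r \<in> covering" and a: "a \<in> A - set r" and q: "q \<in> nb P a"
  shows "q \<in> leaving r" "\<And>a'. a' \<in> A - set r \<Longrightarrow> q \<in> nb P a' \<Longrightarrow> a' = a"
proof -
  have q0: "q \<in> V0" "q \<in> I" using A_nb a q unfolding V0_def by auto
  have rx: "xypath r" and qr: "q \<in> set r" using r q0 unfolding covering_def by auto
  have qxy: "q \<noteq> x" "q \<noteq> y" using q0 unfolding I_def by auto
  have aq: "a \<in> nb P q" using q nb_sym by metis
  have 2: "card (nb r q) = 2" using card_nb_xypath[OF rx qr qxy] by blast
  have sub: "nb r q \<subseteq> insert (th q) (nb P q - {a'})" if "a' \<in> A - set r" for a'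
    using nb_adj_xypath[OF rx] nbrs_I(1)[OF q0(2)] nb_set[of _ r q] that by blast
  have c1: "card (nb P q - {a}) = 1" using nbrs_I(3,4)[OF q0(2)] aq by simp
  show "q \<in> leaving r"
  proof (rule ccontr)
    assume "q \<notin> leaving r"
    then have "th q \<notin> nb r q" using q0 unfolding leaving_def by auto
    then have "nb r q \<subseteq> nb P q - {a}" using sub[OF a] by blast
    then have "card (nb r q) \<le> 1" using card_mono[of "nb P q - {a}"] nbrs_I(4)[OF q0(2)] c1 by auto
    then show False using 2 by simp
  qed
  fix a' assume a': "a' \<in> A - set r" "q \<in> nb P a'"
  show "a' = a"
  proof (rule ccontr)
    assume ne: "a' \<noteq> a"
    have "nb P q - {a} - {a'} = {}"
    proof -
      have "a' \<in> nb P q - {a}" using a'(2) nb_sym[of q P a'] ne by blast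
      then show ?thesis using c1 by (metis Diff_cancel card_1_singletonE singletonD)
    qed
    then have "nb r q \<subseteq> {th q}" using sub[OF a] sub[OF a'(1)] by blast
    then have "card (nb r q) \<le> 1" using card_mono[of "{th q}"] by fastforce
    then show False using 2 by simp
  qed
qed

text \<open>
  Each missed vertex forces its two path neighbours to leave \<open>P\<close>, each vertex off \<open>P\<close> serves at most
  two of them, and \<open>r\<close> is not longer than \<open>P\<close>; hence equality holds throughout.
\<close>

lemma equality_case:
  assumes r: "r \<in> covering"
  shows "card (set r - set P) = card (A - set r)"
    and "leaving r = (\<Union>a\<in>A - set r. nb P a)"
    and "\<And>d. d \<in> set r - set P \<Longrightarrow> nb r d \<subseteq> leaving r"
    and "length r = length P"
proof -
  let ?U = "set r - set P" and ?M = "A - set r"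
  have rx: "xypath r" using r unfolding covering_def by auto
  have fA: "finite A" using A_I finite_I finite_subset by metis
  have "set r = (V0 \<union> {x, y}) \<union> (A \<inter> set r) \<union> ?U"
    using r xypath_xy[OF rx] A_I unfolding covering_def V0_def I_def by auto
  moreover have "(V0 \<union> {x, y}) \<inter> (A \<inter> set r) = {}" "((V0 \<union> {x, y}) \<union> (A \<inter> set r)) \<inter> ?U = {}"
    using A_I xypath_xy[OF xypath_P] unfolding V0_def I_def by auto
  moreover have fin: "finite V0" unfolding V0_def using finite_I by simp
  ultimately have cr: "card (set r) = card (V0 \<union> {x, y}) + card (A \<inter> set r) + card ?U"
    using fA by (metis List.finite_set card_Un_disjoint finite_Diff finite_Int finite_Un finite.emptyI finite.insertI)
  have "set P = (V0 \<union> {x, y}) \<union> A" using xypath_xy[OF xypath_P] A_I unfolding V0_def I_def by auto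
  moreover have "(V0 \<union> {x, y}) \<inter> A = {}" using A_I unfolding V0_def I_def by auto
  ultimately have cP: "card (set P) = card (V0 \<union> {x, y}) + card A"
    using fA fin by (metis card_Un_disjoint finite_Un finite.emptyI finite.insertI)
  have cA: "card A = card (A \<inter> set r) + card ?M" using fA by (metis card_Int_Diff)
  have lr: "length r = card (set r)" "length P = card (set P)" using rx xypath_P distinct_card unfolding xypath_def by metis+
  \<comment> \<open>Here the maximality of \<open>P\<close> enters the counting.\<close>
  have UM: "card ?U \<le> card ?M" using xypath_le[OF rx] lr cr cP cA by linarith
  have leaving_V0: "leaving r \<subseteq> V0" unfolding leaving_def by auto
  have fT: "finite (leaving r)" using fin leaving_V0 finite_subset by metis
  have "card (\<Union>a\<in>?M. nb P a) = (\<Sum>a\<in>?M. card (nb P a))"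
  proof (rule card_UN_disjoint)
    show "\<forall>a\<in>?M. finite (nb P a)" using nbrs_I(4) A_I by blast
    show "\<forall>a\<in>?M. \<forall>b\<in>?M. a \<noteq> b \<longrightarrow> nb P a \<inter> nb P b = {}" using missed_nb(2)[OF r] by blast
  qed (use fA in simp)
  also have "\<dots> = (\<Sum>a\<in>?M. 2)" by (rule sum.cong) (use nbrs_I(3) A_I in auto)
  finally have c1: "card (\<Union>a\<in>?M. nb P a) = 2 * card ?M" by simp
  have s1: "(\<Union>a\<in>?M. nb P a) \<subseteq> leaving r" using missed_nb(1)[OF r] by blast
  have l1: "2 * card ?M \<le> card (leaving r)" using card_mono[OF fT s1] c1 by simp
  have th_U: "th v \<in> ?U" if "v \<in> leaving r" for v
  proof -
    have v: "v \<in> I" "th v \<in> nb r v" using that unfolding leaving_def V0_def by simp_all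
    show ?thesis using th[OF v(1)] nb_set[OF v(2)] by simp
  qed
  \<comment> \<open>Every leaving vertex is next to its own \<open>th\<close> on \<open>r\<close>,
    which is a vertex off \<open>P\<close>.\<close>
  have T_eq: "leaving r = (\<Union>d\<in>?U. leaving r \<inter> nb r d)"
  proof (intro equalityI subsetI)
    fix v assume v: "v \<in> leaving r"
    then have "v \<in> nb r (th v)" using nb_sym[of v r "th v"] unfolding leaving_def by simp
    then show "v \<in> (\<Union>d\<in>?U. leaving r \<inter> nb r d)" using th_U[OF v] v by blast
  qed blast
  have dxy: "d \<noteq> x" "d \<noteq> y" "d \<in> set r" if "d \<in> ?U" for d using that xypath_xy[OF xypath_P] by auto
  have n2: "card (nb r d) = 2" "finite (nb r d)" if "d \<in> ?U" for d using card_nb_xypath[OF rx] dxy[OF that] by blast+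
  have le2: "card (leaving r \<inter> nb r d) \<le> 2" if "d \<in> ?U" for d using card_mono[OF n2(2)[OF that], of "leaving r \<inter> nb r d"] n2(1)[OF that] by simp
  have "card (leaving r) = card (\<Union>d\<in>?U. leaving r \<inter> nb r d)" using T_eq by simp
  also have "\<dots> \<le> (\<Sum>d\<in>?U. card (leaving r \<inter> nb r d))" by (rule card_UN_le) simp
  finally have l2: "card (leaving r) \<le> (\<Sum>d\<in>?U. card (leaving r \<inter> nb r d))" .
  have "(\<Sum>d\<in>?U. card (leaving r \<inter> nb r d)) \<le> (\<Sum>d\<in>?U. 2)" by (rule sum_mono) (use le2 in auto)
  then have l3: "(\<Sum>d\<in>?U. card (leaving r \<inter> nb r d)) \<le> 2 * card ?U" by simp
  show eqc: "card ?U = card ?M" using l1 l2 l3 UM by linarith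
  then show "length r = length P" using lr cr cP cA by linarith
  have "card (leaving r) = 2 * card ?M" using l1 l2 l3 eqc by linarith
  then show "leaving r = (\<Union>a\<in>?M. nb P a)" using card_subset_eq[OF fT s1] c1 by simp
  fix d assume d: "d \<in> ?U"
  have "card (leaving r \<inter> nb r d) = 2"
  proof (rule ccontr)
    assume "card (leaving r \<inter> nb r d) \<noteq> 2"
    then have "card (leaving r \<inter> nb r d) < 2" using le2[OF d] by simp
    then have "(\<Sum>d\<in>?U. card (leaving r \<inter> nb r d)) < (\<Sum>d\<in>?U. 2)"
      using sum_strict_mono_ex1[of ?U "\<lambda>d. card (leaving r \<inter> nb r d)" "\<lambda>_. 2"] le2 d by blast
    then show False using l1 l2 eqc by simp
  qed
  then have "leaving r \<inter> nb r d = nb r d" using n2[OF d] card_subset_eq[of "nb r d"] by simp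
  then show "nb r d \<subseteq> leaving r" by blast
qed

lemma off_nb:
  assumes r: "r \<in> covering" and d: "d \<in> set r - set P" and v: "v \<in> nb r d"
  shows "v \<in> V0" "th v = d" "v \<in> leaving r"
proof -
  show T: "v \<in> leaving r" using equality_case(3)[OF r d] v by blast
  then show "v \<in> V0" unfolding leaving_def by simp
  then have "v \<in> I" unfolding V0_def by simp
  moreover have "adj v d" using nb_adj_xypath[of r] r v adj_sym unfolding covering_def by blast
  ultimately show "th v = d" using adj_off_I d by auto
qed

end

section \<open>Components off the path\<close>

lemma nb_nth:
  assumes "distinct r" "0 < i" "Suc i < length r"
  shows "nb r (r ! i) = {r ! (i - 1), r ! Suc i}"
proof (rule nb_eq[OF assms(1)])
  obtain j where j: "i = Suc j" using assms(2) by (cases i) auto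
  have "drop j r = r ! j # r ! Suc j # r ! Suc (Suc j) # drop (Suc (Suc (Suc j))) r"
    using assms(3) j by (simp add: Cons_nth_drop_Suc)
  then have "r = take j r @ [r ! j, r ! Suc j, r ! Suc (Suc j)] @ drop (Suc (Suc (Suc j))) r"
    by (metis append_Cons append_Nil append_take_drop_id)
  then show "r = take (i - 1) r @ [r ! (i - 1), r ! i, r ! Suc i] @ drop (Suc (Suc i)) r" using j by simp
qed

context cubic_longest
begin

definition offrel :: "('a \<times> 'a) set" where "offrel = {(u, v). u \<in> off \<and> v \<in> off \<and> adj u v}"

definition comp :: "'a \<Rightarrow> 'a set" where "comp d = offrel\<^sup>* `` {d}"

definition comps :: "'a set set" where "comps = comp ` off"

text \<open>The attachments among the inner vertices. Adjacency to \<open>x\<close> or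
  \<open>y\<close> is recorded separately by \<open>xyD\<close>, since these two may have several
  neighbours off \<open>P\<close>.\<close>

definition cl :: "'a set \<Rightarrow> 'a set" where "cl D = {v \<in> I. th v \<in> D}"

definition ends :: "'a \<Rightarrow> 'a set" where "ends d = {v \<in> I. th v = d}"

definition xyD :: "'a set \<Rightarrow> bool" where "xyD D \<longleftrightarrow> (\<exists>d\<in>D. adj x d \<or> adj y d)"

lemma comp_self: "d \<in> comp d" unfolding comp_def by simp

lemma comp_step: "u \<in> comp d \<Longrightarrow> u \<in> off \<Longrightarrow> v \<in> off \<Longrightarrow> adj u v \<Longrightarrow> v \<in> comp d"
  unfolding comp_def using rtrancl_into_rtrancl[of d u offrel v] by (simp add: offrel_def)

lemma comp_off: "d \<in> off \<Longrightarrow> comp d \<subseteq> off"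
proof
  fix e assume d: "d \<in> off" and "e \<in> comp d"
  then have "(d, e) \<in> offrel\<^sup>*" unfolding comp_def by simp
  then show "e \<in> off" using d by (induction) (auto simp: offrel_def)
qed

lemma comp_eq:
  assumes "e \<in> comp d"
  shows "comp e = comp d"
proof -
  have "sym (offrel\<^sup>*)" by (rule sym_rtrancl, rule symI) (use adj_sym in \<open>simp add: offrel_def\<close>)
  moreover have "(d, e) \<in> offrel\<^sup>*" using assms unfolding comp_def by simp
  ultimately have "(e, d) \<in> offrel\<^sup>*" "(d, e) \<in> offrel\<^sup>*" unfolding sym_def by blast+
  then show ?thesis unfolding comp_def using rtrancl_trans[of _ _ offrel] by blast
qed

lemma compsE: "D \<in> comps \<Longrightarrow> d \<in> D \<Longrightarrow> D = comp d \<and> d \<in> off"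
proof -
  assume "D \<in> comps" "d \<in> D"
  then obtain e where e: "e \<in> off" "D = comp e" unfolding comps_def by blast
  then show ?thesis using comp_eq[of d e] comp_off[of e] \<open>d \<in> D\<close> by blast
qed

lemma comps_disj: "D \<in> comps \<Longrightarrow> D' \<in> comps \<Longrightarrow> d \<in> D \<Longrightarrow> d \<in> D' \<Longrightarrow> D = D'"
  using compsE[of D d] compsE[of D' d] by simp

lemma comps_step: "D \<in> comps \<Longrightarrow> u \<in> D \<Longrightarrow> v \<in> off \<Longrightarrow> adj u v \<Longrightarrow> v \<in> D"
  using compsE[of D u] comp_step[of u u v] comp_self[of u] by simp

lemma comps_ne: "D \<in> comps \<Longrightarrow> D \<noteq> {}"
  unfolding comps_def using comp_self by auto

lemma comps_off: "D \<in> comps \<Longrightarrow> D \<subseteq> off"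
  unfolding comps_def using comp_off by auto

lemma comps_conn:
  assumes "D \<in> comps" "S \<subseteq> D" "S \<noteq> {}" and cl: "\<And>u v. u \<in> S \<Longrightarrow> v \<in> D \<Longrightarrow> adj u v \<Longrightarrow> v \<in> S"
  shows "S = D"
proof -
  obtain s where s: "s \<in> S" using assms(3) by blast
  have D: "D = comp s" using compsE[OF assms(1)] s assms(2) by blast
  have "e \<in> S" if "(s, e) \<in> offrel\<^sup>*" for e
    using that
  proof (induction)
    case (step e f)
    have "f \<in> D" using comps_step[OF assms(1), of e f] step assms(2) unfolding offrel_def by auto
    then show ?case using cl[of e f] step unfolding offrel_def by auto
  qed (use s in simp)
  then show ?thesis using assms(2) unfolding D comp_def by auto
qed

lemma th_comps: "v \<in> I \<Longrightarrow> comp (th v) \<in> comps \<and> th v \<in> comp (th v)"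
  using th_off comp_self unfolding comps_def by auto

lemma finite_off: "finite off" unfolding off_def using finV by simp

lemma comps_nbr:
  assumes "D \<in> comps" "d \<in> D" "adj d w"
  shows "w \<in> D \<or> (w \<in> I \<and> th w = d) \<or> (w \<in> {x, y} \<and> xyD D)"
proof (cases "w \<in> set P")
  case True
  then show ?thesis using assms adj_off_I[of w d] adj_sym[OF assms(3)] comps_off[OF assms(1)] unfolding I_def xyD_def off_def by blast
next
  case False
  then have "w \<in> off" using adjV[OF adj_sym[OF assms(3)]] unfolding off_def by blast
  then show ?thesis using comps_step[OF assms(1,2) _ assms(3)] by blast
qed

lemma D_sub: "D \<in> comps \<Longrightarrow> D \<subseteq> V - set P" using comps_off unfolding off_def by blast

text \<open>With fewer than two attachments a single vertex would separate the component from
  \<open>x\<close>, against 2-connectedness.\<close>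

lemma cl_two:
  assumes D: "D \<in> comps" "\<not> xyD D"
  shows "card (cl D) \<ge> 2"
proof (rule ccontr)
  assume "\<not> card (cl D) \<ge> 2"
  moreover have "finite (cl D)" unfolding cl_def I_def by simp
  ultimately have "cl D = {} \<or> (\<exists>v. cl D = {v})"
    by (metis One_nat_def card_1_singletonE card_eq_0_iff less_2_cases not_le)
  then obtain z where z: "cl D \<subseteq> {z}" "z \<in> set P" "z \<noteq> x"
  proof
    assume "cl D = {}"
    \<comment> \<open>Without attachments, any vertex of \<open>P\<close> other than
      \<open>x\<close> serves as the separating vertex; \<open>y\<close> is one.\<close>
    then show thesis using that[of y] xypath_xy[OF xypath_P] xy by auto
  next
    assume "\<exists>v. cl D = {v}"
    then obtain v where v: "cl D = {v}" by blast
    then have "v \<in> I" unfolding cl_def by blast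
    then show thesis using that[of v] v unfolding I_def by auto
  qed
  have "D = V - {z}"
  proof (rule two_conn)
    show "z \<in> V" using z xypath_V[OF xypath_P] by blast
    show "D \<subseteq> V - {z}" using D_sub[OF D(1)] z by blast
    show "D \<noteq> {}" using comps_ne D by blast
    fix u v assume a: "u \<in> D" "v \<in> V - {z}" "adj u v"
    then show "v \<in> D" using comps_nbr[OF D(1) a(1,3)] D(2) z(1) unfolding cl_def by blast
  qed
  then have "x \<in> D" using xV z by blast
  then show False using D_sub[OF D(1)] xypath_xy[OF xypath_P] by blast
qed

lemma ends_cl: "D \<in> comps \<Longrightarrow> d \<in> D \<Longrightarrow> ends d \<subseteq> cl D"
  unfolding ends_def cl_def by auto

text \<open>If both attachments hang on \<open>d\<close>, the third neighbour of \<open>d\<close>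
  lies in the component, and \<open>d\<close> separates the rest of the component from
  \<open>x\<close>.\<close>

lemma no_pair_cherry:
  assumes D: "D \<in> comps" "\<not> xyD D" and d: "d \<in> D" and c: "cl D = ends d" "card (cl D) = 2"
  shows False
proof -
  have dV: "d \<in> V" using D_sub[OF D(1)] d by blast
  have "ends d \<subseteq> {w. adj d w}" unfolding ends_def using th adj_sym by auto
  moreover have "card {w. adj d w} = 3" using cubic dV by blast
  ultimately obtain e where e: "adj d e" "e \<notin> ends d" using c by (metis mem_Collect_eq subsetI subset_antisym numeral_eq_iff semiring_norm(88) num.distinct(5) num.inject(1) num.distinct(1))
  have "e \<in> D" using comps_nbr[OF D(1) d e(1)] e(2) D(2) unfolding ends_def by blast
  have "D - {d} = V - {d}"
  proof (rule two_conn[OF dV])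
    show "D - {d} \<subseteq> V - {d}" using D_sub[OF D(1)] by blast
    show "D - {d} \<noteq> {}" using \<open>e \<in> D\<close> e(1) adj_irrefl by blast
    fix u v assume a: "u \<in> D - {d}" "v \<in> V - {d}" "adj u v"
    have "v \<in> D \<or> (v \<in> I \<and> th v = u)" using comps_nbr[OF D(1) _ a(3)] a(1) D(2) by blast
    moreover have "\<not> (v \<in> I \<and> th v = u)"
    proof
      assume "v \<in> I \<and> th v = u"
      then have "v \<in> cl D" using a unfolding cl_def by blast
      then have "th v = d" using c(1) unfolding ends_def by blast
      then show False using \<open>v \<in> I \<and> th v = u\<close> a(1) by blast
    qed
    ultimately show "v \<in> D - {d}" using a(2) by blast
  qed
  then have "x \<in> D" using xV d xypath_xy[OF xypath_P] D_sub[OF D(1)] by blast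
  then show False using D_sub[OF D(1)] xypath_xy[OF xypath_P] by blast
qed

definition big :: "'a set \<Rightarrow> bool" where "big D \<longleftrightarrow> \<not> xyD D \<and> card (cl D) \<ge> 3"

lemma cl_disj: "D \<in> comps \<Longrightarrow> D' \<in> comps \<Longrightarrow> D \<noteq> D' \<Longrightarrow> cl D \<inter> cl D' = {}"
  using comps_disj[of D D'] unfolding cl_def by blast

lemma finite_cl: "finite (cl D)" unfolding cl_def I_def by simp

lemma finite_comps: "finite comps" unfolding comps_def using finite_off by simp

text \<open>Positions 1 and \<open>length P - 2\<close> are barred so that the path neighbours of
  \<open>A\<close> are inner vertices. This costs at most two of all the attachments of any family
  of big components, each of which has three; hence the summand 2 in the transversal bound.\<close>

theorem exists_reps:
  "\<exists>A. reps adj V P x y A \<and> (\<forall>D\<in>comps. if big D then card (A \<inter> cl D) = 1 else A \<inter> cl D = {})"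
proof -
  let ?n = "length P"
  define T where "T = {D \<in> comps. big D}"
  define W where "W D = {i. 2 \<le> i \<and> i + 2 < ?n \<and> P ! i \<in> cl D}" for D
  have dP: "distinct P" using xypath_P unfolding xypath_def by blast
  have Pne: "P \<noteq> []" using xypath_P unfolding xypath_def by blast
  have P0: "P ! 0 = x" "P ! (?n - 1) = y" using xypath_P last_conv_nth[OF Pne] hd_conv_nth[OF Pne] unfolding xypath_def by metis+
  have inj: "inj_on ((!) P) {..<?n}" by (rule inj_on_nth[OF dP]) simp
  have "\<exists>S. spread S \<and> S \<subseteq> \<Union> (W ` T) \<and> (\<forall>t\<in>T. card (S \<inter> W t) = 1)"
  proof (rule spread_transversal)
    show "finite T" unfolding T_def using finite_comps by simp
    show "finite (W t)" for t by (rule finite_subset[of _ "{..<?n}"]) (auto simp: W_def)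
    show "W t \<inter> W t' = {}" if "t \<in> T" "t' \<in> T" "t \<noteq> t'" for t t'
      using cl_disj[of t t'] that unfolding W_def T_def by blast
    fix J assume J: "J \<subseteq> T" "J \<noteq> {}"
    let ?C = "\<Union> (cl ` J)"
    have fJ: "finite J" using finite_subset[OF J(1)] finite_comps unfolding T_def by simp
    have JC: "D \<in> comps" "3 \<le> card (cl D)" if "D \<in> J" for D using J(1) that unfolding T_def big_def by blast+
    have "card ?C = (\<Sum>D\<in>J. card (cl D))"
    proof (rule card_UN_disjoint[OF fJ])
      show "\<forall>D\<in>J. finite (cl D)" using finite_cl by simp
      show "\<forall>D\<in>J. \<forall>D'\<in>J. D \<noteq> D' \<longrightarrow> cl D \<inter> cl D' = {}" using cl_disj JC(1) by simp
    qed
    moreover have "(\<Sum>D\<in>J. card (cl D)) \<ge> (\<Sum>D\<in>J. 3)" by (rule sum_mono) (rule JC(2))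
    ultimately have c3: "card ?C \<ge> 3 * card J" by simp
    have fW: "finite (\<Union> (W ` J))" by (rule finite_subset[of _ "{..<?n}"]) (auto simp: W_def)
    have "?C \<subseteq> (!) P ` (\<Union> (W ` J) \<union> {1, ?n - 2})"
    proof
      fix v assume v: "v \<in> ?C"
      then have vI: "v \<in> I" unfolding cl_def by blast
      then obtain i where i: "i < ?n" "P ! i = v" unfolding I_def by (auto simp: in_set_conv_nth)
      have "v \<noteq> x" "v \<noteq> y" using vI unfolding I_def by auto
      then have "i \<noteq> 0" "i \<noteq> ?n - 1" using i P0 by metis+
      then have "(2 \<le> i \<and> i + 2 < ?n) \<or> i = 1 \<or> i = ?n - 2" using i by linarith
      then have "i \<in> \<Union> (W ` J) \<union> {1, ?n - 2}" using i v unfolding W_def by blast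
      then show "v \<in> (!) P ` (\<Union> (W ` J) \<union> {1, ?n - 2})" using i by blast
    qed
    then have "card ?C \<le> card (\<Union> (W ` J) \<union> {1, ?n - 2})" using fW by (meson finite.emptyI finite.insertI finite_Un surj_card_le)
    also have "\<dots> \<le> card (\<Union> (W ` J)) + card {1, ?n - 2}" by (rule card_Un_le)
    also have "card {1, ?n - 2} \<le> 2" by (simp add: card_insert_if)
    finally show "3 * card J \<le> card (\<Union> (W ` J)) + 2" using c3 by simp
  qed
  then obtain S where S: "spread S" "S \<subseteq> \<Union> (W ` T)" "\<And>t. t \<in> T \<Longrightarrow> card (S \<inter> W t) = 1" by blast
  define A where "A = (!) P ` S"
  have Si: "2 \<le> i \<and> i + 2 < ?n" if "i \<in> S" for i using S(2) that unfolding W_def by blast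
  have inI: "P ! i \<in> I" if "0 < i" "Suc i < ?n" for i
  proof -
    have "P ! i \<noteq> P ! 0" "P ! i \<noteq> P ! (?n - 1)" 
    proof -
      have "i < ?n" "?n - 1 < ?n" "0 < ?n" "i \<noteq> 0" "i \<noteq> ?n - 1" using that by linarith+
      then show "P ! i \<noteq> P ! 0" "P ! i \<noteq> P ! (?n - 1)" using nth_eq_iff_index_eq[OF dP] by metis+
    qed
    then show ?thesis using that P0 unfolding I_def by simp
  qed
  have "reps adj V P x y A"
  proof
    show "A \<subseteq> I"
    proof
      fix a assume "a \<in> A"
      then obtain i where "i \<in> S" "a = P ! i" unfolding A_def by blast
      then show "a \<in> I" using inI[of i] Si[of i] by simp
    qed
    fix a assume "a \<in> A"
    then obtain i where i: "i \<in> S" "a = P ! i" unfolding A_def by blast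
    have b: "2 \<le> i" "i + 2 < ?n" using Si[OF i(1)] by auto
    have nbP: "nb P a = {P ! (i - 1), P ! Suc i}" unfolding i(2) by (rule nb_nth[OF dP]) (use b in auto)
    have "P ! j \<notin> A" if "j < ?n" "j \<notin> S" for j
    proof
      assume "P ! j \<in> A"
      then obtain k where "k \<in> S" "P ! k = P ! j" unfolding A_def by auto
      moreover have "k < ?n" using Si[OF calculation(1)] by linarith
      ultimately show False using that nth_eq_iff_index_eq[OF dP, of k j] by blast
    qed
    moreover have "i - 1 \<notin> S" "Suc i \<notin> S" using S(1) i(1) b 
    proof -
      obtain j where j: "i = Suc j" using b(1) by (cases i) auto
      then have "j \<notin> S" "Suc i \<notin> S" using S(1) i(1) unfolding spread_def by blast+
      then show "i - 1 \<notin> S" "Suc i \<notin> S" using j by simp_all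
    qed
    ultimately have "P ! (i - 1) \<notin> A" "P ! Suc i \<notin> A" using b by simp_all
    then show "nb P a \<subseteq> I - A" unfolding nbP using inI[of "i - 1"] inI[of "Suc i"] b by simp
  qed
  moreover have "if big D then card (A \<inter> cl D) = 1 else A \<inter> cl D = {}" if D: "D \<in> comps" for D
  proof -
    have AW: "A \<inter> cl D = (!) P ` (S \<inter> W D)"
    proof (intro equalityI subsetI)
      fix a assume "a \<in> A \<inter> cl D"
      then obtain i where "i \<in> S" "a = P ! i" "P ! i \<in> cl D" unfolding A_def by blast
      then have "i \<in> S \<inter> W D" using Si unfolding W_def by blast
      then show "a \<in> (!) P ` (S \<inter> W D)" using \<open>a = P ! i\<close> by blast
    qed (auto simp: A_def W_def)
    show ?thesis
    proof (cases "big D")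
      case True
      have "inj_on ((!) P) (S \<inter> W D)" by (rule inj_on_subset[OF inj]) (auto simp: W_def)
      then have "card (A \<inter> cl D) = card (S \<inter> W D)" unfolding AW by (rule card_image)
      then show ?thesis using True S(3) D unfolding T_def by auto
    next
      case False
      have "S \<inter> W D = {}"
      proof (rule ccontr)
        assume "S \<inter> W D \<noteq> {}"
        then obtain i D' where i: "i \<in> W D" "i \<in> W D'" "D' \<in> T" using S(2) by blast
        have "D' \<in> comps" "D' \<noteq> D" using i(3) False unfolding T_def by blast+
        then have "cl D \<inter> cl D' = {}" using cl_disj[OF D] by metis
        then show False using i unfolding W_def by blast
      qed
      then show ?thesis using False AW by simp
    qed
  qed
  ultimately show ?thesis by blast
qed

end

section \<open>The Smith parity theorem for labelled multigraphs\<close>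

definition ham_walks :: "('v \<times> 'l list \<times> 'v) set \<Rightarrow> 'v set \<Rightarrow> 'v \<Rightarrow> 'v \<Rightarrow> ('l list \<times> 'v) list set" where
  "ham_walks E W x y = {s. walk E x s \<and> distinct (x # map snd s) \<and> set (map snd s) = W - {x} \<and> final x s = y}"

lemma finite_walks:
  assumes "finite E"
  shows "finite {s. walk E x s \<and> distinct (map snd s)}"
proof -
  let ?L = "snd ` E"
  have *: "walk E x s \<Longrightarrow> set s \<subseteq> ?L" for s x
  proof (induction s arbitrary: x)
    case (Cons p s)
    obtain l v where p: "p = (l, v)" by force
    then have "(x, l, v) \<in> E" "walk E v s" using Cons.prems by simp_all
    moreover have "(l, v) \<in> ?L" using image_eqI[OF _ calculation(1), of "(l, v)" snd] by simp
    ultimately show ?case using Cons.IH[of v] p by simp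
  qed simp
  have "length s \<le> card (snd ` ?L)" if "walk E x s" "distinct (map snd s)" for s
  proof -
    have "length s = card (set (map snd s))" using distinct_card[OF that(2)] by simp
    also have "\<dots> \<le> card (snd ` ?L)" using *[OF that(1)] assms by (intro card_mono) auto
    finally show ?thesis .
  qed
  then have "{s. walk E x s \<and> distinct (map snd s)} \<subseteq> {s. set s \<subseteq> ?L \<and> length s \<le> card (snd ` ?L)}"
    using * by blast
  then show ?thesis by (rule finite_subset[OF _ finite_lists_length_le]) (use assms in simp)
qed

lemma odd_pred: "odd (n + m) \<Longrightarrow> n \<noteq> 0 \<Longrightarrow> even (n - 1 + (m :: nat))"
  by (cases n) auto

text \<open>The lollipop lemma is applied to the walks from \<open>x\<close> through all vertices
  except \<open>y\<close>. The end of such a walk has odd degree, split into darts back into the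
  walk and darts to \<open>y\<close>. So modulo 2 the number of its rotations equals the number of
  its completions to Hamiltonian walks.\<close>

theorem smith:
  fixes E :: "('v \<times> 'l list \<times> 'v) set"
  assumes sym: "\<And>u l v. (u, l, v) \<in> E \<Longrightarrow> (v, rev l, u) \<in> E"
    and loop: "\<And>u l v. (u, l, v) \<in> E \<Longrightarrow> u \<noteq> v"
    and EW: "\<And>u l v. (u, l, v) \<in> E \<Longrightarrow> v \<in> W"
    and fE: "finite E" and xy: "x \<noteq> y" "x \<in> W" "y \<in> W"
    and odd: "\<And>v. v \<in> W \<Longrightarrow> v \<noteq> x \<Longrightarrow> v \<noteq> y \<Longrightarrow> odd (card {(l, z). (v, l, z) \<in> E})"
    and ne: "W - {x, y} \<noteq> {}"
  shows "even (card (ham_walks E W x y))"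
proof -
  define PP where "PP = {s. walk E x s \<and> distinct (x # map snd s) \<and> set (map snd s) = W - {x, y}}"
  have fPP: "finite PP" unfolding PP_def
    by (rule finite_subset[OF _ finite_walks[OF fE, of x]]) auto
  define ex where "ex s = {l. (final x s, l, y) \<in> E}" for s :: "('l list \<times> 'v) list"
  let ?d = "\<lambda>s :: ('l list \<times> 'v) list. card {(l, z). (final x s, l, z) \<in> E \<and> z \<in> insert x (set (map snd s))}"
  have fin_s: "final x s \<in> W - {x, y}" if "s \<in> PP" for s
  proof -
    have "s \<noteq> []" using that ne unfolding PP_def by auto
    then obtain s' l v where "s = s' @ [(l, v)]" by (metis rev_exhaust surj_pair)
    then have "final x s \<in> set (map snd s)" by (simp add: final_append)
    then show ?thesis using that unfolding PP_def by simp
  qed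
  have even1: "even (\<Sum>s\<in>PP. ?d s - 1)"
  proof (rule lollipop[OF sym loop fE fPP])
    fix s assume "s \<in> PP"
    then show "walk E x s \<and> s \<noteq> [] \<and> distinct (x # map snd s)" using ne unfolding PP_def by auto
  next
    show "rot_closed E x PP" unfolding rot_closed_def
    proof (intro allI impI)
      fix \<alpha> l' v' \<beta> l assume a: "\<alpha> @ (l', v') # \<beta> \<in> PP" "(final v' \<beta>, l, final x \<alpha>) \<in> E"
      have v: "final v' \<beta> # map snd (revs v' \<beta>) = rev (v' # map snd \<beta>)" by (rule vertices_revs)
      have "set (map snd (\<alpha> @ (rev l, final v' \<beta>) # revs v' \<beta>)) = set (map snd \<alpha>) \<union> set (final v' \<beta> # map snd (revs v' \<beta>))" by simp
      also have "\<dots> = set (map snd (\<alpha> @ (l', v') # \<beta>))" unfolding v by simp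
      finally have e: "set (map snd (\<alpha> @ (rev l, final v' \<beta>) # revs v' \<beta>)) = set (map snd (\<alpha> @ (l', v') # \<beta>))" .
      have "set (map snd (\<alpha> @ (l', v') # \<beta>)) = W - {x, y}" using a(1) unfolding PP_def by blast
      then have "set (map snd (\<alpha> @ (rev l, final v' \<beta>) # revs v' \<beta>)) = W - {x, y}" unfolding e .
      moreover have "distinct (x # map snd (\<alpha> @ (rev l, final v' \<beta>) # revs v' \<beta>))"
      proof -
        have "x # map snd (\<alpha> @ (rev l, final v' \<beta>) # revs v' \<beta>) = (x # map snd \<alpha>) @ rev (v' # map snd \<beta>)"
          using v by simp
        moreover have "distinct ((x # map snd \<alpha>) @ (v' # map snd \<beta>))" using a(1) unfolding PP_def by auto
        ultimately show ?thesis by (metis distinct_append distinct_rev set_rev)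
      qed
      moreover have "walk E x (\<alpha> @ (rev l, final v' \<beta>) # revs v' \<beta>)"
        using a sym[OF a(2)] walk_revs[OF sym, of v' \<beta>] unfolding PP_def by (simp add: walk_append)
      ultimately show "\<alpha> @ (rev l, final v' \<beta>) # revs v' \<beta> \<in> PP" unfolding PP_def by blast
    qed
  qed
  have fdart: "finite {(l, z). (v, l, z) \<in> E}" for v
    by (rule finite_subset[of _ "snd ` E"]) (use fE in force)+
  have fex: "finite (ex s)" for s
    by (rule finite_subset[of _ "fst ` {(l, z). (final x s, l, z) \<in> E}"]) (use fdart in \<open>force simp: ex_def\<close>)+
  have ev: "even (?d s - 1 + card (ex s))" if s: "s \<in> PP" for s
  proof -
    have "insert x (set (map snd s)) = W - {y}" using s xy unfolding PP_def by auto
    then have 1: "{(l, z). (final x s, l, z) \<in> E} = {(l, z). (final x s, l, z) \<in> E \<and> z \<in> insert x (set (map snd s))} \<union> (\<lambda>l. (l, y)) ` ex s"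
      using EW unfolding ex_def by auto
    have 2: "{(l, z). (final x s, l, z) \<in> E \<and> z \<in> insert x (set (map snd s))} \<inter> (\<lambda>l. (l, y)) ` ex s = {}"
      using \<open>insert x (set (map snd s)) = W - {y}\<close> by auto
    have 3: "finite {(l, z). (final x s, l, z) \<in> E \<and> z \<in> insert x (set (map snd s))}"
      by (rule finite_subset[OF _ fdart[of "final x s"]]) auto
    have "card {(l, z). (final x s, l, z) \<in> E} = ?d s + card ((\<lambda>l. (l, y)) ` ex s)"
      by (subst 1, rule card_Un_disjoint[OF 3 finite_imageI[OF fex] 2])
    also have "card ((\<lambda>l. (l, y)) ` ex s) = card (ex s)" by (rule card_image) (simp add: inj_on_def)
    finally have 4: "card {(l, z). (final x s, l, z) \<in> E} = ?d s + card (ex s)" .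
    have "odd (card {(l, z). (final x s, l, z) \<in> E})" using odd[of "final x s"] fin_s[OF s] by blast
    then have "odd (?d s + card (ex s))" unfolding 4 .
    \<comment> \<open>The reverse of the last step is counted in \<open>?d s\<close>, so the
      truncated subtraction of 1 is a true one.\<close>
    moreover have "?d s \<noteq> 0"
    proof -
      have "s \<noteq> []" using s ne unfolding PP_def by auto
      then obtain s' l v where s': "s = s' @ [(l, v)]" by (metis rev_exhaust surj_pair)
      then have "(final x s', l, v) \<in> E" using s unfolding PP_def by (simp add: walk_append)
      then have "(final x s, rev l, final x s') \<in> E" using s' sym by (simp add: final_append)
      moreover have "final x s' \<in> insert x (set (map snd s))" using final_in[of x s'] s' by auto
      ultimately have "(rev l, final x s') \<in> {(l, z). (final x s, l, z) \<in> E \<and> z \<in> insert x (set (map snd s))}" by simp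
      moreover have "finite {(l, z). (final x s, l, z) \<in> E \<and> z \<in> insert x (set (map snd s))}"
        by (rule finite_subset[OF _ fdart[of "final x s"]]) auto
      ultimately show ?thesis by (metis (no_types, lifting) card_0_eq empty_iff)
    qed
    ultimately show ?thesis by (rule odd_pred)
  qed
  have "even (\<Sum>s\<in>PP. (?d s - 1) + card (ex s))" by (rule dvd_sum) (use ev in auto)
  then have "even (\<Sum>s\<in>PP. card (ex s))" using even1 by (simp add: sum.distrib)
  moreover have "ham_walks E W x y = (\<lambda>(s, l). s @ [(l, y)]) ` (SIGMA s : PP. ex s)"
  proof (intro equalityI subsetI)
    fix t assume t: "t \<in> ham_walks E W x y"
    then have "t \<noteq> []" using xy unfolding ham_walks_def by auto
    then obtain s l v where s: "t = s @ [(l, v)]" by (metis rev_exhaust surj_pair)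
    then have "v = y" using t unfolding ham_walks_def by (simp add: final_append)
    then have "s \<in> PP" "l \<in> ex s" using t s unfolding ham_walks_def PP_def ex_def by (auto simp: walk_append)
    then show "t \<in> (\<lambda>(s, l). s @ [(l, y)]) ` (SIGMA s : PP. ex s)" using s \<open>v = y\<close> by force
  next
    fix t assume "t \<in> (\<lambda>(s, l). s @ [(l, y)]) ` (SIGMA s : PP. ex s)"
    then obtain s l where s: "t = s @ [(l, y)]" "s \<in> PP" "l \<in> ex s" by auto
    then show "t \<in> ham_walks E W x y" using xy unfolding ham_walks_def PP_def ex_def by (auto simp: walk_append final_append)
  qed
  moreover have "inj_on (\<lambda>(s, l). s @ [(l, y)]) (SIGMA s : PP. ex s)" by (auto simp: inj_on_def)
  ultimately show ?thesis using fPP fex by (simp add: card_image)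
qed

section \<open>Expansion of labelled walks to vertex lists\<close>

definition lift :: "'a \<Rightarrow> ('a list \<times> 'a) list \<Rightarrow> 'a list" where
  "lift u s = u # concat (map (\<lambda>(l, v). l @ [v]) s)"

lemma lift_Nil: "lift u [] = [u]" and lift_Cons: "lift u ((l, v) # s) = u # l @ lift v s"
  unfolding lift_def by auto

lemma hd_lift: "hd (lift u s) = u" "lift u s \<noteq> []"
  unfolding lift_def by auto

lemma last_lift: "last (lift u s) = final u s"
  by (induction u s rule: final.induct) (auto simp: lift_Nil lift_Cons hd_lift)

lemma set_lift: "set (lift u s) = insert u (\<Union>(l, v)\<in>set s. insert v (set l))"
  unfolding lift_def by auto

text \<open>Labels avoid \<open>W\<close> and the targets of steps lie in it, so the list can be cut
  again at its vertices in \<open>W\<close>.\<close>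

lemma lift_inj:
  assumes "\<And>l v. (l, v) \<in> set s \<union> set t \<Longrightarrow> v \<in> W \<and> set l \<inter> W = {}" and "lift u s = lift u t"
  shows "s = t"
  using assms
proof (induction s arbitrary: u t)
  case Nil
  then show ?case by (cases t) (auto simp: lift_Nil lift_Cons hd_lift)
next
  case (Cons p s)
  obtain l v where p: "p = (l, v)" by force
  obtain l' v' t' where t: "t = (l', v') # t'"
    using Cons.prems(2) p by (cases t) (auto simp: lift_Nil lift_Cons hd_lift)
  have e: "l @ lift v s = l' @ lift v' t'" using Cons.prems(2) p t by (simp add: lift_Cons)
  have lv: "v \<in> W" "set l \<inter> W = {}" "v' \<in> W" "set l' \<inter> W = {}" using Cons.prems(1) p t by auto
  obtain a b where ab: "lift v s = v # a" "lift v' t' = v' # b" unfolding lift_def by auto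
  have "takeWhile (\<lambda>w. w \<notin> W) (l @ v # a) = l" "takeWhile (\<lambda>w. w \<notin> W) (l' @ v' # b) = l'"
    using lv by (auto simp: takeWhile_append)
  then have "l = l'" using e ab by metis
  then have vv: "lift v s = lift v' t'" using e by simp
  then have "v = v'" using ab by simp
  moreover have "s = t'" by (rule Cons.IH[of t' v]) (use Cons.prems(1) vv \<open>v = v'\<close> p t in auto)
  ultimately show ?case using p t \<open>l = l'\<close> by simp
qed

lemma lift_exists:
  assumes "last (u # r) \<in> W"
  shows "\<exists>s. lift u s = u # r \<and> (\<forall>(l, v)\<in>set s. v \<in> W \<and> set l \<inter> W = {})"
  using assms
proof (induction "length r" arbitrary: u r rule: less_induct)
  case less
  show ?case
  proof (cases "r = []")
    case True
    then show ?thesis by (intro exI[of _ "[]"]) (simp add: lift_Nil)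
  next
    case False
    then have "\<exists>w\<in>set r. w \<in> W" using less.prems by auto
    from split_list_first_prop[OF this] obtain l v r' where r: "r = l @ v # r'" "v \<in> W" "\<forall>w\<in>set l. w \<notin> W" by blast
    have "last (u # r) = last (v # r')" by (simp add: r(1))
    then have "last (v # r') \<in> W" using less.prems by simp
    moreover have "length r' < length r" unfolding r(1) by simp
    ultimately obtain s where s: "lift v s = v # r'" "\<forall>(l, v)\<in>set s. v \<in> W \<and> set l \<inter> W = {}" using less.hyps[of r' v] by blast
    have "lift u ((l, v) # s) = u # r" unfolding r(1) by (simp add: lift_Cons s(1))
    moreover have "set l \<inter> W = {}" using r(3) by blast
    then have "\<forall>(l, v)\<in>set ((l, v) # s). v \<in> W \<and> set l \<inter> W = {}" using s(2) r(2) by simp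
    ultimately show ?thesis by blast
  qed
qed

text \<open>A label vertex that occurred again later would lie on an edge with the same two ends,
  one of which is the source of the present step and does not recur. The last two conjuncts trace
  each vertex of the list to the walk and carry the induction.\<close>

lemma lift_path:
  assumes E: "\<And>u l v. (u, l, v) \<in> E \<Longrightarrow> u \<in> W \<and> v \<in> W \<and> set l \<inter> W = {} \<and> distinct l \<and> successively adj (u # l @ [v])"
    and dis: "\<And>u l v u' l' v' w. (u, l, v) \<in> E \<Longrightarrow> (u', l', v') \<in> E \<Longrightarrow> w \<in> set l \<Longrightarrow> w \<in> set l' \<Longrightarrow> {u, v} = {u', v'}"
    and s: "walk E u s" "distinct (u # map snd s)" "u \<in> W"
  shows "distinct (lift u s) \<and> successively adj (lift u s) \<and>
     (\<forall>w\<in>set (lift u s). w \<in> W \<longrightarrow> w \<in> set (u # map snd s)) \<and>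
     (\<forall>w\<in>set (lift u s). w \<notin> W \<longrightarrow> (\<exists>a l b. (a, l, b) \<in> E \<and> w \<in> set l \<and> a \<in> set (u # map snd s) \<and> b \<in> set (u # map snd s)))"
  using s
proof (induction s arbitrary: u)
  case Nil
  then show ?case by (simp add: lift_Nil)
next
  case (Cons p s)
  obtain l v where p: "p = (l, v)" by force
  have e: "(u, l, v) \<in> E" and w: "walk E v s" and d: "distinct (v # map snd s)" using Cons.prems p by auto
  have un: "u \<notin> set (v # map snd s)" using Cons.prems p by auto
  note El = E[OF e]
  have IH: "distinct (lift v s)" "successively adj (lift v s)"
    "\<And>w. w \<in> set (lift v s) \<Longrightarrow> w \<in> W \<Longrightarrow> w \<in> set (v # map snd s)"
    "\<And>w. w \<in> set (lift v s) \<Longrightarrow> w \<notin> W \<Longrightarrow> \<exists>a l b. (a, l, b) \<in> E \<and> w \<in> set l \<and> a \<in> set (v # map snd s) \<and> b \<in> set (v # map snd s)"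
    using Cons.IH[OF w d] El by blast+
  have 1: "u \<notin> set (lift v s)" using IH(3) un Cons.prems(3) by blast
  have 2: "set l \<inter> set (lift v s) = {}"
  proof (rule ccontr)
    assume "set l \<inter> set (lift v s) \<noteq> {}"
    then obtain w where w: "w \<in> set l" "w \<in> set (lift v s)" by blast
    then have "w \<notin> W" using El by blast
    then obtain a l' b where ab: "(a, l', b) \<in> E" "w \<in> set l'" "a \<in> set (v # map snd s)" "b \<in> set (v # map snd s)" using IH(4)[OF w(2)] by blast
    have "{u, v} = {a, b}" using dis[OF e ab(1) w(1) ab(2)] .
    then have "u = a \<or> u = b" by blast
    then show False using ab un by blast
  qed
  have "distinct (lift u (p # s))" using El IH(1) 1 2 Cons.prems(3) unfolding p lift_Cons by auto
  moreover have "successively adj (lift u (p # s))"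
  proof -
    obtain a where a: "lift v s = v # a" unfolding lift_def by auto
    have "successively adj ((u # l @ [v]) @ a)"
      using El IH(2) unfolding a by (subst successively_append_iff) (auto simp: successively_Cons)
    then show ?thesis unfolding p lift_Cons a by simp
  qed
  moreover have "\<forall>w\<in>set (lift u (p # s)). w \<in> W \<longrightarrow> w \<in> set (u # map snd (p # s))"
    using El IH(3) unfolding p lift_Cons by auto
  moreover have "\<forall>w\<in>set (lift u (p # s)). w \<notin> W \<longrightarrow> (\<exists>a l b. (a, l, b) \<in> E \<and> w \<in> set l \<and> a \<in> set (u # map snd (p # s)) \<and> b \<in> set (u # map snd (p # s)))"
  proof (intro ballI impI)
    fix w assume w: "w \<in> set (lift u (p # s))" "w \<notin> W"
    then have "w \<in> set l \<or> w \<in> set (lift v s)" using Cons.prems(3) unfolding p lift_Cons by auto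
    then show "\<exists>a l b. (a, l, b) \<in> E \<and> w \<in> set l \<and> a \<in> set (u # map snd (p # s)) \<and> b \<in> set (u # map snd (p # s))"
    proof
      assume "w \<in> set l"
      then show ?thesis using e p by (intro exI[of _ u] exI[of _ l] exI[of _ v]) simp
    next
      assume "w \<in> set (lift v s)"
      from IH(4)[OF this w(2)] show ?thesis using p by (metis list.set_intros(2) list.simps(9) snd_conv)
    qed
  qed
  ultimately show ?case by blast
qed

lemma walk_lift_infix:
  assumes "lift u s = r" "\<And>a l b \<alpha> \<beta>. r = \<alpha> @ a # l @ b # \<beta> \<Longrightarrow> a \<in> W \<Longrightarrow> b \<in> W \<Longrightarrow> set l \<inter> W = {} \<Longrightarrow> (a, l, b) \<in> E"
    "u \<in> W" "\<forall>(l, v)\<in>set s. v \<in> W \<and> set l \<inter> W = {}"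
  shows "walk E u s"
  using assms
proof (induction s arbitrary: u r)
  case (Cons p s)
  obtain l v where p: "p = (l, v)" by force
  obtain a where a: "lift v s = v # a" unfolding lift_def by auto
  have r: "r = u # l @ v # a" using Cons.prems(1) p a by (simp add: lift_Cons)
  have lv: "v \<in> W" "set l \<inter> W = {}" using Cons.prems(4) p by auto
  have "(u, l, v) \<in> E" by (rule Cons.prems(2)[of "[]" u l v a]) (use r lv Cons.prems(3) in auto)
  moreover have "walk E v s"
  proof (rule Cons.IH[OF a])
    fix a' l' b \<alpha> \<beta> assume h: "v # a = \<alpha> @ a' # l' @ b # \<beta>" "a' \<in> W" "b \<in> W" "set l' \<inter> W = {}"
    have "r = (u # l @ \<alpha>) @ a' # l' @ b # \<beta>" using r h(1) by simp
    then show "(a', l', b) \<in> E" using Cons.prems(2) h by blast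
  qed (use lv Cons.prems(4) in auto)
  ultimately show ?case using p by simp
qed simp

section \<open>The multigraph of a retained set\<close>

locale chosen = reps +
  assumes A_comp: "\<And>D. D \<in> comps \<Longrightarrow> if big D then card (A \<inter> cl D) = 1 else A \<inter> cl D = {}"
begin

definition ends0 :: "'a \<Rightarrow> 'a set" where "ends0 d = {v \<in> V0. th v = d}"

text \<open>
  The vertices off \<open>P\<close> through which a covering path may pass, by \<open>equality_case\<close>.
\<close>

definition cherries :: "'a set" where "cherries = {d \<in> off. card (ends0 d) = 2}"

lemma V0_I: "V0 \<subseteq> I" unfolding V0_def by auto

lemma xy_P: "x \<in> set P" "y \<in> set P" using xypath_xy[OF xypath_P] by auto

lemma A_P: "a \<in> A \<Longrightarrow> a \<in> I \<and> a \<in> set P \<and> a \<notin> off \<and> a \<notin> V0"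
  using A_I unfolding I_def off_def V0_def by blast

lemma V0_P: "v \<in> V0 \<Longrightarrow> v \<in> I \<and> v \<in> set P \<and> v \<notin> off \<and> v \<notin> A"
  unfolding V0_def I_def off_def by blast

lemma ends0_nbrs: "ends0 d \<subseteq> {w. adj d w}"
proof
  fix v assume "v \<in> ends0 d"
  then have "v \<in> I" "th v = d" unfolding ends0_def V0_def by auto
  then show "v \<in> {w. adj d w}" using th[of v] adj_sym[of v d] by simp
qed

lemma fin_ends0: "finite (ends0 d)"
  by (rule finite_subset[OF ends0_nbrs fin_nbrs])

lemma comp_comps: "d \<in> off \<Longrightarrow> comp d \<in> comps" unfolding comps_def by simp

lemma off_P: "d \<in> off \<Longrightarrow> d \<notin> set P" unfolding off_def by simp

lemma comp_closed:
  assumes "d \<in> off" "S \<subseteq> comp d" "S \<noteq> {}" "\<And>u v. u \<in> S \<Longrightarrow> adj u v \<Longrightarrow> v \<in> off \<Longrightarrow> v \<in> S"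
  shows "S = comp d"
proof (rule comps_conn[OF comp_comps[OF assms(1)] assms(2,3)])
  fix u v assume "u \<in> S" "v \<in> comp d" "adj u v"
  then show "v \<in> S" using assms(4)[of u v] comp_off[OF assms(1)] by blast
qed

text \<open>A big component has its representative in \<open>A\<close>, so not all of its
  attachments can lie in \<open>V0\<close>.\<close>

lemma comp_attach:
  assumes D: "D \<in> comps" "\<not> xyD D" "cl D \<subseteq> V0"
  shows "card (cl D) \<le> 2"
proof (rule ccontr)
  assume "\<not> card (cl D) \<le> 2"
  then have "big D" using D(2) unfolding big_def by simp
  then have "card (A \<inter> cl D) = 1" using A_comp[OF D(1)] by simp
  then have "A \<inter> cl D \<noteq> {}" by auto
  then show False using D(3) unfolding V0_def by blast
qed

text \<open>Three neighbours in \<open>V0\<close> would make \<open>{d}\<close> a component with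
  three attachments, none of them in \<open>A\<close>.\<close>

lemma ends0_le2:
  assumes d: "d \<in> off"
  shows "card (ends0 d) \<le> 2"
proof (rule ccontr)
  assume n: "\<not> card (ends0 d) \<le> 2"
  have all: "ends0 d = {w. adj d w}"
    by (rule card_seteq[OF fin_nbrs ends0_nbrs]) (use n deg3[of d] in linarith)
  have "{d} = comp d"
  proof (rule comp_closed[OF d])
    fix u v assume "u \<in> {d}" "adj u v" "v \<in> off"
    then have "v \<in> ends0 d" using all by blast
    then show "v \<in> {d}" using \<open>v \<in> off\<close> V0_I unfolding ends0_def off_def I_def by blast
  qed (use comp_self in auto)
  then have D: "{d} \<in> comps" using comp_comps[OF d] by simp
  have "\<not> xyD {d}"
  proof
    assume "xyD {d}"
    then have "adj d x \<or> adj d y" using adj_sym[of x d] adj_sym[of y d] unfolding xyD_def by auto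
    then have "x \<in> ends0 d \<or> y \<in> ends0 d" using all by blast
    then show False using V0_I unfolding ends0_def I_def by blast
  qed
  moreover have c: "cl {d} = ends0 d"
  proof
    show "cl {d} \<subseteq> ends0 d"
    proof
      fix v assume "v \<in> cl {d}"
      then have "v \<in> I" "th v = d" unfolding cl_def by auto
      then show "v \<in> ends0 d" using all th[of v] adj_sym[of v d] by auto
    qed
    show "ends0 d \<subseteq> cl {d}" using V0_I unfolding ends0_def cl_def by auto
  qed
  ultimately have "card (cl {d}) \<le> 2" using comp_attach[OF D] unfolding c ends0_def by auto
  then show False using n c by simp
qed

text \<open>By \<open>equality_case\<close> both neighbours of \<open>d\<close> on \<open>r\<close>
  lie in \<open>V0\<close>, and \<open>ends0 d\<close> has no room for a third.\<close>

lemma off_cherries: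
  assumes r: "r \<in> covering" and d: "d \<in> set r - set P"
  shows "d \<in> cherries" "nb r d = ends0 d"
proof -
  have rx: "xypath r" using r unfolding covering_def by simp
  have dV: "d \<in> off" using d xypath_V[OF rx] unfolding off_def by auto
  have 2: "card (nb r d) = 2" using card_nb_xypath[OF rx, of d] d xy_P by auto
  have s: "nb r d \<subseteq> ends0 d" using off_nb[OF r d] unfolding ends0_def by blast
  have "nb r d = ends0 d" by (rule card_seteq[OF fin_ends0 s]) (use 2 ends0_le2[OF dV] in linarith)
  then show "nb r d = ends0 d" "d \<in> cherries" using 2 dV unfolding cherries_def by auto
qed

definition third :: "'a \<Rightarrow> 'a" where "third d = (THE w. adj d w \<and> w \<notin> ends0 d)"

lemma third:
  assumes "d \<in> cherries"
  shows "{w. adj d w} = insert (third d) (ends0 d)" "third d \<notin> ends0 d" "adj d (third d)"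
proof -
  have d: "d \<in> off" "card (ends0 d) = 2" "d \<in> V" using assms unfolding cherries_def off_def by auto
  have "card ({w. adj d w} - ends0 d) = 1" using card_Diff_subset[OF fin_ends0 ends0_nbrs] cubic[OF d(3)] d(2) by simp
  then obtain w where w: "{w. adj d w} - ends0 d = {w}" using card_1_singletonE by blast
  have "third d = w" unfolding third_def by (rule the_equality) (use w in blast)+
  then show "{w. adj d w} = insert (third d) (ends0 d)" "third d \<notin> ends0 d" "adj d (third d)"
    using w ends0_nbrs[of d] by blast+
qed

lemma third_cases:
  assumes "d \<in> cherries"
  shows "third d \<in> comp d \<or> (third d \<in> A \<and> th (third d) = d) \<or> third d \<in> {x, y}"
proof -
  have d: "d \<in> off" using assms unfolding cherries_def by simp
  have "third d \<in> comp d \<or> (third d \<in> I \<and> th (third d) = d) \<or> third d \<in> {x, y}"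
    using comps_nbr[OF comp_comps[OF d] comp_self third(3)[OF assms]] by blast
  then show ?thesis using third(2)[OF assms] unfolding ends0_def V0_def by blast
qed

lemma third_nbr:
  assumes "d \<in> cherries" "adj d w" "w \<in> off"
  shows "w = third d"
proof -
  have "w \<notin> ends0 d" using assms(3) V0_I unfolding ends0_def off_def I_def by blast
  then show ?thesis using third(1)[OF assms(1)] assms(2) by blast
qed

lemma single_comp:
  assumes "d \<in> cherries" "third d \<notin> comp d"
  shows "comp d = {d}"
proof -
  have d: "d \<in> off" using assms unfolding cherries_def by simp
  have "{d} = comp d"
  proof (rule comp_closed[OF d])
    fix u v assume "u \<in> {d}" "adj u v" "v \<in> off"
    then have "v = third d" "v \<in> comp d" using third_nbr[OF assms(1)] comp_step[OF comp_self d, of v] by auto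
    then show "v \<in> {d}" using assms(2) by simp
  qed (use comp_self in auto)
  then show ?thesis by simp
qed

text \<open>Both vertices have spent their other two edges on \<open>V0\<close>, so inside the
  component only the edge between them is left.\<close>

lemma double_comp:
  assumes "d \<in> cherries" "e \<in> cherries" "e = third d"
  shows "comp d = {d, e}"
proof -
  have d: "d \<in> off" "e \<in> off" using assms unfolding cherries_def by auto
  have ade: "adj d e" using third(3)[OF assms(1)] assms(3) by simp
  have ed: "third e = d" using third_nbr[OF assms(2) adj_sym[OF ade] d(1)] by simp
  have "{d, e} = comp d"
  proof (rule comp_closed[OF d(1)])
    show "{d, e} \<subseteq> comp d" using comp_self comp_step[OF comp_self d(1) d(2) ade] by blast
    fix u v assume "u \<in> {d, e}" "adj u v" "v \<in> off"
    then have "v = third d \<or> v = third e" using third_nbr[OF assms(1), of v] third_nbr[OF assms(2), of v] by auto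
    then show "v \<in> {d, e}" using ed assms(3) by auto
  qed auto
  then show ?thesis by simp
qed

text \<open>
  The parity condition says that the attachments of each component that remain once \<open>X\<close> is kept and
  \<open>A - X\<close> is suppressed can be joined in pairs.
\<close>

definition parity_valid :: "'a set \<Rightarrow> bool" where
  "parity_valid X \<longleftrightarrow> X \<subseteq> A \<union> cherries \<and> (\<forall>D\<in>comps. \<not> xyD D \<longrightarrow> even (card (cl D - A) + card (X \<inter> (D \<union> cl D))))"

text \<open>Two adjacent cherries would form a component with four attachments, all in
  \<open>V0\<close>, which the choice of \<open>A\<close> rules out.\<close>

lemma full_comp:
  assumes D: "D \<in> comps" "D \<subseteq> cherries"
  shows "\<exists>d. D = {d} \<and> third d \<notin> D"
proof -
  obtain d where d: "d \<in> D" using comps_ne[OF D(1)] by blast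
  have Dd: "D = comp d" using compsE[OF D(1) d] by simp
  have dC: "d \<in> cherries" using d D(2) by blast
  show ?thesis
  proof (cases "third d \<in> D")
    case False
    then show ?thesis using single_comp[OF dC] Dd by auto
  next
    case True
    define e where "e = third d"
    have eC: "e \<in> cherries" "e \<in> D" using True D(2) unfolding e_def by auto
    have De: "D = {d, e}" using double_comp[OF dC eC(1) e_def] Dd by simp
    have ne: "d \<noteq> e" using third(3)[OF dC] adj_irrefl unfolding e_def by metis
    have off: "d \<in> off" "e \<in> off" using dC eC unfolding cherries_def by auto
    have "third e = d" using third_nbr[OF eC(1) adj_sym[OF third(3)[OF dC, folded e_def]] off(1)] by simp
    then have nb: "{w. adj d w} = insert e (ends0 d)" "{w. adj e w} = insert d (ends0 e)"
      using third(1)[OF dC] third(1)[OF eC(1)] e_def by auto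
    have P: "w \<in> V0" if "w \<in> set P" "adj d w \<or> adj e w" for w
    proof -
      have "w \<noteq> d" "w \<noteq> e" using that(1) off off_P by auto
      then have "w \<in> ends0 d \<or> w \<in> ends0 e" using nb that(2) by blast
      then show ?thesis unfolding ends0_def by blast
    qed
    have "\<not> xyD D"
    proof
      assume "xyD D"
      then have "adj d x \<or> adj e x \<or> adj d y \<or> adj e y" unfolding xyD_def De
        using adj_sym[of x] adj_sym[of y] by blast
      then show False using P[of x] P[of y] xy_P V0_I unfolding I_def by blast
    qed
    moreover have "cl D = ends0 d \<union> ends0 e"
    proof (intro equalityI subsetI)
      fix v assume "v \<in> cl D"
      then have v: "v \<in> I" "th v = d \<or> th v = e" unfolding cl_def De by auto
      then have "v \<in> V0" using P[of v] th[OF v(1)] adj_sym[of v] unfolding I_def by auto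
      then show "v \<in> ends0 d \<union> ends0 e" using v(2) unfolding ends0_def by auto
    qed (use V0_I in \<open>auto simp: ends0_def cl_def De\<close>)
    moreover have "card (ends0 d \<union> ends0 e) = card (ends0 d) + card (ends0 e)"
      by (rule card_Un_disjoint[OF fin_ends0 fin_ends0]) (use ne in \<open>auto simp: ends0_def\<close>)
    then have "card (ends0 d \<union> ends0 e) = 4" using dC eC(1) unfolding cherries_def by simp
    ultimately have "\<not> cl D \<subseteq> V0" using comp_attach[OF D(1)] by auto
    then show ?thesis using \<open>cl D = ends0 d \<union> ends0 e\<close> unfolding ends0_def by auto
  qed
qed

end

section \<open>Pairing the attachments of a component around a retained set\<close>

locale retained = chosen +
  fixes X :: "'a set"
  assumes parity_valid: "parity_valid X"
begin

lemma X_sub: "X \<subseteq> A \<union> cherries" using parity_valid unfolding parity_valid_def by simp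

lemma finX: "finite X"
proof (rule finite_subset[OF X_sub])
  have "finite cherries" by (rule finite_subset[OF _ finite_off]) (simp add: cherries_def)
  then show "finite (A \<union> cherries)" using finite_subset[OF A_I finite_I] by simp
qed

lemma X_off: "d \<in> X \<Longrightarrow> d \<in> off \<Longrightarrow> d \<in> cherries"
  using X_sub A_I unfolding off_def I_def by blast

lemma X_in_D: "D \<in> comps \<Longrightarrow> d \<in> X \<inter> D \<Longrightarrow> d \<in> cherries"
  using X_off comps_off by blast

lemma X_P: "d \<in> X \<Longrightarrow> d \<in> set P \<Longrightarrow> d \<in> A"
  using X_sub unfolding cherries_def off_def by blast

text \<open>What remains to be joined through \<open>D - X\<close>. A retained cherry has its two
  edges to \<open>V0\<close> drawn directly, so it enters in place of the two attachments that it
  serves.\<close>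

definition base :: "'a set \<Rightarrow> 'a set" where
  "base D = {v \<in> cl D. v \<notin> A - X \<and> th v \<notin> X} \<union> (X \<inter> D)"

text \<open>
  Components adjacent to \<open>x\<close> or \<open>y\<close> need no parity condition: an odd set of terminals is
  completed by \<open>x\<close> or \<open>y\<close>, whose degree does not matter.
\<close>

definition root :: "'a set \<Rightarrow> 'a \<times> 'a" where
  "root D = (SOME pe. fst pe \<in> {x, y} \<and> snd pe \<in> D \<and> adj (fst pe) (snd pe))"

definition terminals :: "'a set \<Rightarrow> 'a set" where
  "terminals D = base D \<union> (if xyD D \<and> odd (card (base D)) then {fst (root D)} else {})"

definition attachment :: "'a set \<Rightarrow> 'a \<Rightarrow> 'a" where
  "attachment D u = (if u \<in> I then th u else if u \<in> off then third u else snd (root D))"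

lemma root:
  assumes "xyD D"
  shows "fst (root D) \<in> {x, y} \<and> snd (root D) \<in> D \<and> adj (fst (root D)) (snd (root D))"
proof -
  obtain d where "d \<in> D" "adj x d \<or> adj y d" using assms unfolding xyD_def by blast
  then have "\<exists>pe. fst pe \<in> {x, y} \<and> snd pe \<in> D \<and> adj (fst pe) (snd pe)" by force
  then show ?thesis unfolding root_def by (rule someI_ex)
qed

lemma base_sub: "D \<in> comps \<Longrightarrow> base D \<subseteq> I \<union> off"
  using comps_off unfolding base_def cl_def by blast

lemma fin_base: "finite (base D)"
  unfolding base_def cl_def I_def using finX by simp

lemma card_terminals_xy: "D \<in> comps \<Longrightarrow> xyD D \<Longrightarrow> even (card (terminals D))"
proof -
  assume D: "D \<in> comps" "xyD D"
  have "x \<notin> I \<union> off" "y \<notin> I \<union> off" using xy_P unfolding I_def off_def by simp_all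
  moreover have "fst (root D) = x \<or> fst (root D) = y" using root[OF D(2)] by simp
  ultimately have "fst (root D) \<notin> base D" using base_sub[OF D(1)] by auto
  then show ?thesis using fin_base D(2) unfolding terminals_def by (cases "odd (card (base D))") auto
qed

text \<open>Otherwise the component would be \<open>{d}\<close> or \<open>{d, third d}\<close> and
  thus be retained entirely.\<close>

lemma third_in:
  assumes D: "D \<in> comps" "\<not> D \<subseteq> X" and d: "d \<in> X \<inter> D"
  shows "third d \<in> D - X"
proof -
  have dC: "d \<in> cherries" using X_in_D D d by blast
  have Dd: "D = comp d" using compsE[OF D(1)] d by blast
  have 1: "third d \<in> D"
  proof (rule ccontr)
    assume "third d \<notin> D"
    then have "comp d = {d}" using single_comp[OF dC] Dd by simp
    then show False using Dd D(2) d by simp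
  qed
  moreover have "third d \<notin> X"
  proof
    assume "third d \<in> X"
    then have "third d \<in> cherries" using X_in_D[OF D(1)] 1 by blast
    then have "D = {d, third d}" using double_comp[OF dC] Dd by simp
    then show False using D(2) d \<open>third d \<in> X\<close> by blast
  qed
  ultimately show ?thesis by blast
qed

text \<open>Inside its component a retained cherry has \<open>third\<close> as its only neighbour,
  so it is a leaf, and deleting leaves preserves connectedness.\<close>

lemma grown_D:
  assumes D: "D \<in> comps" "\<not> D \<subseteq> X"
  shows "grown (D - X)"
proof (rule grownI)
  show "finite (D - X)" using comps_off[OF D(1)] finite_off finite_subset by blast
  show "D - X \<noteq> {}" using D(2) by blast
  fix S assume S: "S \<subseteq> D - X" "S \<noteq> {}" and cl: "\<And>u v. u \<in> S \<Longrightarrow> v \<in> D - X \<Longrightarrow> adj u v \<Longrightarrow> v \<in> S"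
  \<comment> \<open>A closed set in \<open>D - X\<close> is completed by the leaves that hang on
    it.\<close>
  let ?S = "S \<union> {d \<in> X \<inter> D. third d \<in> S}"
  have "?S = D"
  proof (rule comps_conn[OF D(1)])
    show "?S \<subseteq> D" "?S \<noteq> {}" using S by auto
    fix u v assume uv: "u \<in> ?S" "v \<in> D" "adj u v"
    have off: "u \<in> off" "v \<in> off" using comps_off[OF D(1)] uv S by blast+
    show "v \<in> ?S"
    proof (cases "u \<in> S")
      case True
      show ?thesis
      proof (cases "v \<in> X")
        case False
        then show ?thesis using cl[OF True] uv by blast
      next
        case vX: True
        then have "v \<in> cherries" using X_in_D[OF D(1)] uv by blast
        then have "u = third v" using third_nbr[OF _ adj_sym[OF uv(3)] off(1)] by blast
        then show ?thesis using True vX uv(2) by blast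
      qed
    next
      case False
      then have u: "u \<in> X \<inter> D" "third u \<in> S" using uv(1) by auto
      then have "u \<in> cherries" using X_in_D[OF D(1)] by blast
      then have "v = third u" using third_nbr[OF _ uv(3) off(2)] by blast
      then show ?thesis using u by blast
    qed
  qed
  then show "S = D - X" using S(1) by blast
qed

text \<open>A retained cherry sends its third edge into \<open>D\<close>, so all its neighbours on
  \<open>P\<close> lie in \<open>V0\<close>.\<close>

lemma third_unX:
  assumes D: "D \<in> comps" "\<not> D \<subseteq> X" and e: "e \<in> D" "adj e p" "p \<in> set P" "p \<notin> V0"
  shows "e \<notin> X"
proof
  assume eX: "e \<in> X"
  have "third e \<in> D" using third_in[OF D] e eX by blast
  have eC: "e \<in> cherries" using X_in_D[OF D(1)] e eX by blast
  have "p \<notin> ends0 e" using e(4) unfolding ends0_def by blast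
  then have "p = third e" using third(1)[OF eC] e(2) by blast
  then show False using \<open>third e \<in> D\<close> D_sub[OF D(1)] e(3) by blast
qed

lemma attachment_in:
  assumes D: "D \<in> comps" "\<not> D \<subseteq> X" and u: "u \<in> terminals D"
  shows "attachment D u \<in> D - X \<and> adj u (attachment D u)"
proof (cases "u \<in> base D")
  case True
  then consider "u \<in> cl D" "th u \<notin> X" | "u \<in> X \<inter> D" unfolding base_def by blast
  then show ?thesis
  proof cases
    case 1
    then have "u \<in> I" "th u \<in> D" unfolding cl_def by auto
    then show ?thesis using 1 th[of u] unfolding attachment_def by simp
  next
    case 2
    then have "u \<in> cherries" "u \<in> off" using X_in_D[OF D(1)] comps_off[OF D(1)] by auto
    moreover have "u \<notin> I" using \<open>u \<in> off\<close> unfolding off_def I_def by simp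
    ultimately show ?thesis using third_in[OF D 2] third(3) unfolding attachment_def by simp
  qed
next
  case False
  then have u': "xyD D" "u = fst (root D)" using u unfolding terminals_def by (auto split: if_splits)
  then have r: "u \<in> {x, y}" "snd (root D) \<in> D" "adj u (snd (root D))" using root by auto
  then have "attachment D u = snd (root D)" using xy_P unfolding attachment_def I_def off_def by auto
  moreover have "snd (root D) \<notin> X"
  proof (rule third_unX[OF D r(2) adj_sym[OF r(3)]])
    show "u \<in> set P" "u \<notin> V0" using r(1) xy_P V0_I unfolding I_def by auto
  qed
  ultimately show ?thesis using r by simp
qed

lemma terminals_disj:
  assumes "D \<in> comps"
  shows "terminals D \<inter> (D - X) = {}"
proof -
  have "base D \<subseteq> set P \<union> X" unfolding base_def cl_def I_def by blast
  moreover have "xyD D \<Longrightarrow> fst (root D) \<in> set P" using root[of D] xy_P by auto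
  ultimately have "terminals D \<subseteq> set P \<union> X" unfolding terminals_def by auto
  then show ?thesis using D_sub[OF assms] by blast
qed

lemma parity_arith: "2 * k \<le> c \<Longrightarrow> even (c + (m + k)) \<Longrightarrow> even (c - 2 * k + m + (k :: nat))"
  by presburger

text \<open>A retained cherry removes its two attachments and adds itself, so modulo 2 it
  contributes 1, just as a retained vertex of \<open>A\<close> does. This is the origin of the sum
  in \<open>parity_valid\<close>.\<close>

lemma even_terminals:
  assumes D: "D \<in> comps" "\<not> D \<subseteq> X"
  shows "even (card (terminals D))"
proof (cases "xyD D")
  case True
  then show ?thesis using card_terminals_xy D by blast
next
  case False
  have T: "terminals D = base D" unfolding terminals_def using False by simp
  have ev: "even (card (cl D - A) + card (X \<inter> (D \<union> cl D)))" using parity_valid D False unfolding parity_valid_def by blast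
  let ?E = "\<Union>d\<in>X \<inter> D. ends0 d"
  have aX: "th a \<notin> X" if a: "a \<in> A \<inter> cl D" for a
  proof -
    have "a \<in> I" "th a \<in> D" using a unfolding cl_def by auto
    then show ?thesis using third_unX[OF D, of "th a" a] th[of a] adj_sym[of a "th a"] a unfolding V0_def I_def by auto
  qed
  have ED: "?E \<subseteq> cl D - A" unfolding ends0_def V0_def cl_def by auto
  have b: "base D = (cl D - A - ?E) \<union> (X \<inter> cl D) \<union> (X \<inter> D)"
  proof (intro equalityI subsetI)
    fix v assume v: "v \<in> base D"
    show "v \<in> (cl D - A - ?E) \<union> (X \<inter> cl D) \<union> (X \<inter> D)"
    proof (cases "v \<in> X \<inter> D")
      case False
      then have "v \<in> cl D" "v \<notin> A - X" "th v \<notin> X" using v unfolding base_def by auto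
      then show ?thesis unfolding ends0_def by blast
    qed simp
  next
    fix v assume v: "v \<in> (cl D - A - ?E) \<union> (X \<inter> cl D) \<union> (X \<inter> D)"
    consider "v \<in> cl D - A - ?E" | "v \<in> X \<inter> cl D" | "v \<in> X \<inter> D" using v by blast
    then show "v \<in> base D"
    proof cases
      case 1
      have "th v \<notin> X"
      proof
        assume "th v \<in> X"
        then have "th v \<in> X \<inter> D" using 1 unfolding cl_def by simp
        moreover have "v \<in> ends0 (th v)" using 1 unfolding ends0_def V0_def cl_def by simp
        ultimately show False using 1 by blast
      qed
      then show ?thesis using 1 unfolding base_def by blast
    next
      case 2
      then have "v \<in> A" using X_P[of v] unfolding cl_def I_def by blast
      then show ?thesis using 2 aX[of v] unfolding base_def by blast
    qed (simp add: base_def)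
  qed
  have fC: "finite (cl D - A)" "finite (X \<inter> cl D)" "finite (X \<inter> D)" "finite ?E" using finite_cl finX fin_ends0 by auto
  have "X \<inter> cl D \<subseteq> A" using X_P unfolding cl_def I_def by blast
  then have d1: "(cl D - A - ?E) \<inter> (X \<inter> cl D) = {}" by blast
  have path_darts: "cl D \<inter> D = {}" using D_sub[OF D(1)] unfolding cl_def I_def by blast
  then have d2: "((cl D - A - ?E) \<union> (X \<inter> cl D)) \<inter> (X \<inter> D) = {}" by blast
  have cE: "card ?E = 2 * card (X \<inter> D)"
  proof -
    have "card ?E = (\<Sum>d\<in>X \<inter> D. card (ends0 d))"
      by (rule card_UN_disjoint[OF fC(3)]) (use fin_ends0 in \<open>auto simp: ends0_def\<close>)
    also have "\<dots> = (\<Sum>d\<in>X \<inter> D. 2)"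
    proof (rule sum.cong)
      fix d assume "d \<in> X \<inter> D"
      then show "card (ends0 d) = 2" using X_in_D[OF D(1)] unfolding cherries_def by blast
    qed simp
    finally show ?thesis by simp
  qed
  have "card (base D) = card (cl D - A - ?E) + card (X \<inter> cl D) + card (X \<inter> D)"
    unfolding b using card_Un_disjoint[OF _ fC(3) d2] card_Un_disjoint[OF _ fC(2) d1] fC by simp
  also have "card (cl D - A - ?E) = card (cl D - A) - 2 * card (X \<inter> D)"
    using card_Diff_subset[OF fC(4) ED] cE by simp
  finally have c1: "card (base D) = card (cl D - A) - 2 * card (X \<inter> D) + card (X \<inter> cl D) + card (X \<inter> D)" .
  have c2: "2 * card (X \<inter> D) \<le> card (cl D - A)" using card_mono[OF fC(1) ED] cE by simp
  have "X \<inter> (D \<union> cl D) = (X \<inter> cl D) \<union> (X \<inter> D)" "(X \<inter> cl D) \<inter> (X \<inter> D) = {}" using path_darts by auto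
  then have "card (X \<inter> (D \<union> cl D)) = card (X \<inter> cl D) + card (X \<inter> D)" using card_Un_disjoint[OF fC(2,3)] by simp
  then have "even (card (cl D - A) + (card (X \<inter> cl D) + card (X \<inter> D)))" using ev by simp
  then show ?thesis unfolding T c1 by (rule parity_arith[OF c2])
qed

lemma linkage_D:
  assumes D: "D \<in> comps" "\<not> D \<subseteq> X"
  shows "\<exists>C. linkage (D - X) (terminals D) (attachment D) C"
proof (rule linkage_exists[OF grown_D[OF D] _ even_terminals[OF D] terminals_disj[OF D(1)]])
  show "finite (terminals D)" unfolding terminals_def using fin_base by simp
  fix u assume "u \<in> terminals D"
  then show "attachment D u \<in> D - X \<and> adj u (attachment D u)" using attachment_in[OF D] by blast
qed

end

section \<open>The darts of the multigraph and their degrees\<close>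

lemma first_in:
  assumes "distinct r" "r = \<alpha> @ v # s" "\<exists>w\<in>set s. w \<in> W"
  shows "\<exists>l z. z \<in> set s \<and> {p. \<exists>\<alpha>' \<beta>'. r = \<alpha>' @ v # fst p @ snd p # \<beta>' \<and> set (fst p) \<inter> W = {} \<and> snd p \<in> W} = {(l, z)}"
proof -
  from split_list_first_prop[OF assms(3)] obtain l z t where s: "s = l @ z # t" "z \<in> W" "\<forall>w\<in>set l. w \<notin> W" by blast
  have tw: "takeWhile (\<lambda>w. w \<notin> W) s = l" "dropWhile (\<lambda>w. w \<notin> W) s = z # t" using s by (simp_all add: takeWhile_append dropWhile_append)
  have "p = (l, z)" if p: "r = \<alpha>' @ v # fst p @ snd p # \<beta>'" "set (fst p) \<inter> W = {}" "snd p \<in> W" for p \<alpha>' \<beta>'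
  proof -
    have "v \<notin> set \<alpha>" "v \<notin> set s" using assms(1,2) by auto
    then have "s = fst p @ snd p # \<beta>'" using p(1) assms(2) append_Cons_eq_iff[of v \<alpha> s] by metis
    moreover have "\<forall>w\<in>set (fst p). w \<notin> W" using p(2) by blast
    ultimately have "takeWhile (\<lambda>w. w \<notin> W) s = fst p" "dropWhile (\<lambda>w. w \<notin> W) s = snd p # \<beta>'"
      using p(3) by (simp_all add: takeWhile_append dropWhile_append)
    then show ?thesis using tw by (simp add: prod_eq_iff)
  qed
  moreover have "r = \<alpha> @ v # fst (l, z) @ snd (l, z) # t" "set (fst (l, z)) \<inter> W = {}" using assms(2) s by auto
  ultimately have "{p. \<exists>\<alpha>' \<beta>'. r = \<alpha>' @ v # fst p @ snd p # \<beta>' \<and> set (fst p) \<inter> W = {} \<and> snd p \<in> W} = {(l, z)}"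
    using s(2) by (intro equalityI subsetI) (blast, auto)
  moreover have "z \<in> set s" using s(1) by simp
  ultimately show ?thesis by blast
qed

lemma nb_rev: "nb (rev r) v = nb r v"
proof -
  have *: "nb r v \<subseteq> nb (rev r) v" for r :: "'a list" and v
  proof
    fix u assume "u \<in> nb r v"
    then obtain \<alpha> \<beta> where "r = \<alpha> @ [u, v] @ \<beta> \<or> r = \<alpha> @ [v, u] @ \<beta>" unfolding nb_def by blast
    then have "rev r = rev \<beta> @ [v, u] @ rev \<alpha> \<or> rev r = rev \<beta> @ [u, v] @ rev \<alpha>" by auto
    then show "u \<in> nb (rev r) v" unfolding nb_def by blast
  qed
  show ?thesis using *[of r v] *[of "rev r" v] by auto
qed

lemma hd_last_single: "distinct l \<Longrightarrow> l \<noteq> [] \<Longrightarrow> hd l = last l \<Longrightarrow> l = [hd l]"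
  by (cases l) (auto split: if_splits)

lemma distinct_lift: "distinct (lift u s) \<Longrightarrow> distinct (u # map snd s)"
proof (induction s arbitrary: u)
  case (Cons p s)
  obtain l v where p: "p = (l, v)" by force
  have "distinct (v # map snd s)" by (rule Cons.IH) (use Cons.prems p in \<open>simp add: lift_Cons\<close>)
  moreover have "set (v # map snd s) \<subseteq> set (lift v s)" unfolding lift_def by auto
  moreover have "u \<notin> set (lift v s)" using Cons.prems p by (simp add: lift_Cons)
  ultimately show ?case using p by auto
qed simp

context retained
begin

definition hverts :: "'a set" where "hverts = V0 \<union> X \<union> {x, y}"

definition linkage_of :: "'a set \<Rightarrow> ('a \<times> 'a list \<times> 'a) set" where
  "linkage_of D = (SOME C. linkage (D - X) (terminals D) (attachment D) C)"

definition path_darts :: "('a \<times> 'a list \<times> 'a) set" where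
  "path_darts = {(u, l, v). u \<in> hverts \<and> v \<in> hverts \<and> set l \<inter> hverts = {} \<and> (\<exists>\<alpha> \<beta>. P = \<alpha> @ u # l @ v # \<beta> \<or> rev P = \<alpha> @ u # l @ v # \<beta>)}"

definition cherry_darts :: "('a \<times> 'a list \<times> 'a) set" where
  "cherry_darts = {(u, l, v). l = [] \<and> ((v \<in> X \<inter> off \<and> u \<in> ends0 v) \<or> (u \<in> X \<inter> off \<and> v \<in> ends0 u))}"

definition linkage_darts :: "('a \<times> 'a list \<times> 'a) set" where
  "linkage_darts = \<Union> (linkage_of ` {D \<in> comps. \<not> D \<subseteq> X})"

definition single_darts :: "('a \<times> 'a list \<times> 'a) set" where
  "single_darts = {(u, l, v). l = [] \<and> ((u \<in> X \<and> {u} \<in> comps \<and> v = third u) \<or> (v \<in> X \<and> {v} \<in> comps \<and> u = third v))}"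

text \<open>
  The four kinds of edges: pieces of \<open>P\<close>; edges between \<open>V0\<close> and retained vertices off \<open>P\<close>; chords through
  the components; and, for a retained vertex that is a whole component, its third edge.
\<close>

definition E :: "('a \<times> 'a list \<times> 'a) set" where "E = path_darts \<union> cherry_darts \<union> linkage_darts \<union> single_darts"

lemma linkage_of: "D \<in> comps \<Longrightarrow> \<not> D \<subseteq> X \<Longrightarrow> linkage (D - X) (terminals D) (attachment D) (linkage_of D)"
  unfolding linkage_of_def by (rule someI_ex) (rule linkage_D)

lemma linkage_darts_E:
  assumes "(u, l, v) \<in> linkage_darts"
  obtains D where "D \<in> comps" "\<not> D \<subseteq> X" "(u, l, v) \<in> linkage_of D" "chord (D - X) (terminals D) (attachment D) u l v" "(v, rev l, u) \<in> linkage_of D"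
proof -
  obtain D where D: "D \<in> comps" "\<not> D \<subseteq> X" "(u, l, v) \<in> linkage_of D" using assms unfolding linkage_darts_def by blast
  then show thesis using that linkageD[OF linkage_of[OF D(1,2)] D(3)] by blast
qed

lemma hverts_P: "v \<in> set P \<Longrightarrow> v \<notin> hverts \<Longrightarrow> v \<in> A - X"
  unfolding hverts_def V0_def I_def by blast

lemma X_off_or: "v \<in> X \<Longrightarrow> v \<in> A \<or> (v \<in> off \<and> v \<in> cherries)"
  using X_sub unfolding cherries_def by blast

lemma hverts_off: "v \<in> hverts \<Longrightarrow> v \<in> off \<Longrightarrow> v \<in> X"
  using V0_P xy_P unfolding hverts_def off_def by blast

lemma terminals_hverts: "D \<in> comps \<Longrightarrow> terminals D \<subseteq> hverts"
proof -
  assume "D \<in> comps"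
  have "base D \<subseteq> V0 \<union> X" unfolding base_def cl_def V0_def by blast
  moreover have "xyD D \<Longrightarrow> fst (root D) \<in> {x, y}" using root by blast
  ultimately show ?thesis unfolding terminals_def hverts_def by auto
qed

text \<open>If the third neighbour of \<open>d\<close> lies in \<open>A\<close>, the component has
  that attachment and the two in \<open>V0\<close>, and the parity condition forces it to be
  retained along with \<open>d\<close>. Hence the third edge of \<open>d\<close> always ends at a
  vertex of the multigraph.\<close>

lemma single:
  assumes "d \<in> X" "{d} \<in> comps"
  shows "d \<in> cherries" "d \<in> off" "(third d \<in> X \<and> third d \<in> A \<and> th (third d) = d) \<or> third d \<in> {x, y}" "third d \<in> set P"
proof -
  have d: "d \<in> off" using comps_off[OF assms(2)] by blast
  then show dC: "d \<in> cherries" "d \<in> off" using X_off assms(1) by auto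
  have cd: "comp d = {d}" using compsE[OF assms(2), of d] by simp
  have n: "third d \<noteq> d" using third(3)[OF dC(1)] adj_irrefl by metis
  then have c: "(third d \<in> A \<and> th (third d) = d) \<or> third d \<in> {x, y}" using third_cases[OF dC(1)] cd by blast
  then show "third d \<in> set P" using A_P[of "third d"] xy_P by auto
  show "(third d \<in> X \<and> third d \<in> A \<and> th (third d) = d) \<or> third d \<in> {x, y}"
  proof (cases "third d \<in> {x, y}")
    case False
    then have a: "third d \<in> A" "th (third d) = d" using c by blast+
    have e: "ends0 d \<subseteq> V0" unfolding ends0_def by blast
    have nx: "\<not> xyD {d}"
    proof
      assume "xyD {d}"
      then have "adj d x \<or> adj d y" using adj_sym[of x d] adj_sym[of y d] unfolding xyD_def by auto
      then have "x \<in> insert (third d) (ends0 d) \<or> y \<in> insert (third d) (ends0 d)" using third(1)[OF dC(1)] by blast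
      moreover have "x \<notin> V0" "y \<notin> V0" using V0_I unfolding I_def by auto
      ultimately show False using False e by auto
    qed
    have cl: "cl {d} = insert (third d) (ends0 d)"
    proof (intro equalityI subsetI)
      fix v assume "v \<in> cl {d}"
      then have "v \<in> I" "th v = d" unfolding cl_def by auto
      then have "adj d v" using th[of v] adj_sym[of v d] by simp
      then show "v \<in> insert (third d) (ends0 d)" using third(1)[OF dC(1)] by blast
    next
      fix v assume "v \<in> insert (third d) (ends0 d)"
      then have "v = third d \<or> (v \<in> V0 \<and> th v = d)" unfolding ends0_def by blast
      then have "v \<in> I \<and> th v = d" using a A_P V0_P by blast
      then show "v \<in> cl {d}" unfolding cl_def by simp
    qed
    have "cl {d} - A = ends0 d" unfolding cl using a(1) e V0_P by blast
    then have "even (card (ends0 d) + card (X \<inter> ({d} \<union> cl {d})))" using parity_valid assms(2) nx unfolding parity_valid_def by metis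
    then have ev: "even (card (X \<inter> ({d} \<union> cl {d})))" using dC(1) unfolding cherries_def by simp
    have "third d \<in> X"
    proof (rule ccontr)
      assume t: "third d \<notin> X"
      have "X \<inter> ends0 d = {}"
      proof -
        have "v \<notin> X" if "v \<in> V0" for v using X_off_or[of v] V0_P[OF that] by blast
        then show ?thesis using e by blast
      qed
      then have "X \<inter> ({d} \<union> cl {d}) = {d}" using t assms(1) unfolding cl by blast
      then show False using ev by simp
    qed
    then show ?thesis using a by blast
  qed simp
qed

lemma E_sym: "(u, l, v) \<in> E \<Longrightarrow> (v, rev l, u) \<in> E"
proof -
  assume "(u, l, v) \<in> E"
  then consider "(u, l, v) \<in> path_darts" | "(u, l, v) \<in> cherry_darts" | "(u, l, v) \<in> linkage_darts" | "(u, l, v) \<in> single_darts" unfolding E_def by blast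
  then show ?thesis
  proof cases
    case 1
    then obtain \<alpha> \<beta> where ab: "P = \<alpha> @ u # l @ v # \<beta> \<or> rev P = \<alpha> @ u # l @ v # \<beta>" and s: "u \<in> hverts" "v \<in> hverts" "set l \<inter> hverts = {}"
      unfolding path_darts_def by blast
    have "rev P = rev \<beta> @ v # rev l @ u # rev \<alpha> \<or> P = rev \<beta> @ v # rev l @ u # rev \<alpha>"
      using ab
    proof
      assume "rev P = \<alpha> @ u # l @ v # \<beta>"
      then have "rev (rev P) = rev (\<alpha> @ u # l @ v # \<beta>)" by (rule arg_cong)
      then show ?thesis by simp
    qed simp
    then have "(v, rev l, u) \<in> path_darts" using s unfolding path_darts_def by auto
    then show ?thesis unfolding E_def by blast
  next
    case 2
    then have "(v, rev l, u) \<in> cherry_darts" unfolding cherry_darts_def by auto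
    then show ?thesis unfolding E_def by blast
  next
    case 3
    then obtain D where "D \<in> comps" "\<not> D \<subseteq> X" "(v, rev l, u) \<in> linkage_of D" by (rule linkage_darts_E)
    then show ?thesis unfolding E_def linkage_darts_def by blast
  next
    case 4
    then have "(v, rev l, u) \<in> single_darts" unfolding single_darts_def by auto
    then show ?thesis unfolding E_def by blast
  qed
qed

lemma succ_P: "successively adj P" "successively adj (rev P)" "distinct (rev P)"
proof -
  show "successively adj P" using xypath_P unfolding xypath_def by blast
  then have "successively (\<lambda>a b. adj b a) P" using adj_sym by (rule successively_mono)
  then show "successively adj (rev P)" by (simp add: successively_rev)
  show "distinct (rev P)" using xypath_P unfolding xypath_def by simp
qed

text \<open>A vertex of \<open>P\<close> outside the multigraph belongs to \<open>A\<close>, and its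
  path neighbours belong to \<open>V0\<close>. So a label suppresses at most one vertex, whose path
  neighbours are the ends of the edge.\<close>

lemma path_darts_props:
  assumes "(u, l, v) \<in> path_darts"
  shows "u \<in> hverts \<and> v \<in> hverts \<and> set l \<inter> hverts = {} \<and> distinct l \<and> successively adj (u # l @ [v])"
    and "insert u (insert v (set l)) \<subseteq> set P" "u \<noteq> v"
    and "\<And>w. w \<in> set l \<Longrightarrow> {u, v} = nb P w"
proof -
  obtain R \<alpha> \<beta> where R: "R = P \<or> R = rev P" and r: "R = \<alpha> @ u # l @ v # \<beta>" and s: "u \<in> hverts" "v \<in> hverts" "set l \<inter> hverts = {}"
    using assms unfolding path_darts_def by blast
  have dR: "distinct R" "successively adj R" "set R = set P" "\<And>w. nb R w = nb P w"
    using R succ_P xypath_P nb_rev[of P] unfolding xypath_def by auto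
  have "R = \<alpha> @ (u # l @ [v]) @ \<beta>" using r by simp
  then have "successively adj (u # l @ [v])" using dR(2) by (metis successively_append_iff)
  moreover have "distinct l" using dR(1) r by simp
  ultimately show "u \<in> hverts \<and> v \<in> hverts \<and> set l \<inter> hverts = {} \<and> distinct l \<and> successively adj (u # l @ [v])" using s by blast
  show sub: "insert u (insert v (set l)) \<subseteq> set P" unfolding dR(3)[symmetric] r by auto
  show "u \<noteq> v" using dR(1) r by auto
  fix w assume w: "w \<in> set l"
  then obtain l1 l2 where l: "l = l1 @ w # l2" by (meson split_list)
  have "w \<in> A - X" using hverts_P[of w] sub w s(3) by blast
  then have nbw: "nb P w \<subseteq> hverts" using A_nb[of w] unfolding hverts_def V0_def by blast
  obtain a l1' where a: "u # l1 = l1' @ [a]" by (metis list.distinct(1) rev_exhaust)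
  obtain b l2' where b: "l2 @ [v] = b # l2'" by (metis append_is_Nil_conv list.exhaust not_Cons_self2)
  have "R = (\<alpha> @ l1') @ [a, w, b] @ (l2' @ \<beta>)"
  proof -
    have "R = \<alpha> @ (u # l1) @ w # (l2 @ [v]) @ \<beta>" using r l by simp
    then show ?thesis unfolding a b by simp
  qed
  then have n: "nb P w = {a, b}" using nb_eq[OF dR(1)] dR(4) by metis
  have "l1 = []"
  proof (rule ccontr)
    assume "l1 \<noteq> []"
    then have "a = last l1" using a by (metis last.simps last_snoc)
    then have "a \<in> set l" using \<open>l1 \<noteq> []\<close> l by simp
    then show False using n nbw s(3) by blast
  qed
  moreover have "l2 = []"
  proof (rule ccontr)
    assume "l2 \<noteq> []"
    then have "b = hd l2" using b by (metis hd_append2 list.sel(1))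
    then have "b \<in> set l" using \<open>l2 \<noteq> []\<close> l by simp
    then show False using n nbw s(3) by blast
  qed
  ultimately show "{u, v} = nb P w" using a b n by simp
qed

lemma cherry_darts_props:
  assumes "(u, l, v) \<in> cherry_darts"
  shows "l = []" "u \<in> hverts" "v \<in> hverts" "adj u v" "u \<in> set P \<longleftrightarrow> v \<in> off"
proof -
  show "l = []" using assms unfolding cherry_darts_def by simp
  obtain d b where d: "d \<in> X" "d \<in> off" "b \<in> ends0 d" "(u = b \<and> v = d) \<or> (u = d \<and> v = b)" using assms unfolding cherry_darts_def by blast
  have "adj d b" using ends0_nbrs[of d] d(3) by blast
  then show "adj u v" using adj_sym[of d b] d(4) by blast
  have b: "b \<in> V0" using d(3) unfolding ends0_def by simp
  then show "u \<in> hverts" "v \<in> hverts" using d unfolding hverts_def by auto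
  show "u \<in> set P \<longleftrightarrow> v \<in> off" using V0_P[OF b] d off_P[OF d(2)] by blast
qed

lemma single_darts_props:
  assumes "(u, l, v) \<in> single_darts"
  shows "l = []" "u \<in> hverts" "v \<in> hverts" "adj u v" "u \<in> set P \<longleftrightarrow> v \<in> off"
proof -
  show "l = []" using assms unfolding single_darts_def by simp
  obtain d where d: "d \<in> X" "{d} \<in> comps" "(u = third d \<and> v = d) \<or> (u = d \<and> v = third d)" using assms unfolding single_darts_def by blast
  note s = single[OF d(1,2)]
  have "adj d (third d)" using third(3)[OF s(1)] .
  then show "adj u v" using adj_sym[of d "third d"] d(3) by blast
  show "u \<in> hverts" "v \<in> hverts" using d s(3) unfolding hverts_def by auto
  show "u \<in> set P \<longleftrightarrow> v \<in> off" using d(3) s(2,4) off_P[OF s(2)] unfolding off_def by blast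
qed

lemma linkage_darts_props:
  assumes "(u, l, v) \<in> linkage_darts"
  shows "u \<in> hverts \<and> v \<in> hverts \<and> set l \<inter> hverts = {} \<and> distinct l \<and> successively adj (u # l @ [v])" "l \<noteq> []" "set l \<subseteq> off" "u \<noteq> v"
proof -
  obtain D where D: "D \<in> comps" "chord (D - X) (terminals D) (attachment D) u l v" using assms by (rule linkage_darts_E)
  have s: "set l \<subseteq> D - X" "u \<in> terminals D" "v \<in> terminals D" "distinct l" "successively adj (u # l @ [v])" using D(2) unfolding chord_def by blast+
  have "set l \<subseteq> off - X" using s(1) comps_off[OF D(1)] by blast
  then have "set l \<inter> hverts = {}" "set l \<subseteq> off" using hverts_off by blast+
  then show "u \<in> hverts \<and> v \<in> hverts \<and> set l \<inter> hverts = {} \<and> distinct l \<and> successively adj (u # l @ [v])" "set l \<subseteq> off"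
    using s terminals_hverts[OF D(1)] by blast+
  show "l \<noteq> []" "u \<noteq> v" using D(2) unfolding chord_def by blast+
qed

lemma E_cases:
  assumes "(u, l, v) \<in> E"
  shows "(u, l, v) \<in> path_darts \<or> (u, l, v) \<in> linkage_darts \<or> (l = [] \<and> u \<in> hverts \<and> v \<in> hverts \<and> adj u v)"
  using assms cherry_darts_props[of u l v] single_darts_props[of u l v] unfolding E_def by auto

lemma E_props:
  assumes "(u, l, v) \<in> E"
  shows "u \<in> hverts \<and> v \<in> hverts \<and> set l \<inter> hverts = {} \<and> distinct l \<and> successively adj (u # l @ [v])" "u \<noteq> v"
proof -
  consider "(u, l, v) \<in> path_darts" | "(u, l, v) \<in> linkage_darts" | "l = []" "u \<in> hverts" "v \<in> hverts" "adj u v" using E_cases[OF assms] by blast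
  then have "(u \<in> hverts \<and> v \<in> hverts \<and> set l \<inter> hverts = {} \<and> distinct l \<and> successively adj (u # l @ [v])) \<and> u \<noteq> v"
  proof cases
    case 1 then show ?thesis using path_darts_props(1,3)[OF 1] by blast
  next
    case 2 then show ?thesis using linkage_darts_props(1,4)[OF 2] by blast
  next
    case 3 then show ?thesis using adj_irrefl[of u] by auto
  qed
  then show "u \<in> hverts \<and> v \<in> hverts \<and> set l \<inter> hverts = {} \<and> distinct l \<and> successively adj (u # l @ [v])" "u \<noteq> v" by blast+
qed

lemma E_disj:
  assumes "(u, l, v) \<in> E" "(u', l', v') \<in> E" "w \<in> set l" "w \<in> set l'"
  shows "{u, v} = {u', v'}"
proof -
  have 1: "(u, l, v) \<in> path_darts \<or> (u, l, v) \<in> linkage_darts" "(u', l', v') \<in> path_darts \<or> (u', l', v') \<in> linkage_darts"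
    using E_cases[OF assms(1)] E_cases[OF assms(2)] assms(3,4) by auto
  have off: "w \<in> set P" if "(u, l, v) \<in> path_darts" "w \<in> set l" for u l v using path_darts_props(2)[OF that(1)] that(2) by blast
  have off': "w \<notin> set P" if "(u, l, v) \<in> linkage_darts" "w \<in> set l" for u l v using linkage_darts_props(3)[OF that(1)] that(2) off_P by blast
  show ?thesis
  proof (cases "w \<in> set P")
    case True
    then have "(u, l, v) \<in> path_darts" "(u', l', v') \<in> path_darts" using 1 off' assms(3,4) by blast+
    then show ?thesis using path_darts_props(4) assms(3,4) by metis
  next
    case False
    then have L: "(u, l, v) \<in> linkage_darts" "(u', l', v') \<in> linkage_darts" using 1 off assms(3,4) by blast+
    obtain D where D: "D \<in> comps" "\<not> D \<subseteq> X" "(u, l, v) \<in> linkage_of D" "chord (D - X) (terminals D) (attachment D) u l v" using L(1) by (rule linkage_darts_E)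
    obtain D' where D': "D' \<in> comps" "(u', l', v') \<in> linkage_of D'" "chord (D' - X) (terminals D') (attachment D') u' l' v'" "(v', rev l', u') \<in> linkage_of D'" using L(2) by (rule linkage_darts_E)
    have "w \<in> D" "w \<in> D'" using D(4) D'(3) assms(3,4) unfolding chord_def by blast+
    then have e: "D' = D" using comps_disj D(1) D'(1) by metis
    have "u' = u \<or> u' = v" using linkage_disj[OF linkage_of[OF D(1,2)] D(3) D'(2)[unfolded e] assms(3,4)] .
    moreover have "v' = u \<or> v' = v" using linkage_disj[OF linkage_of[OF D(1,2)] D(3) D'(4)[unfolded e] assms(3)] assms(4) by simp
    moreover have "u' \<noteq> v'" using linkage_darts_props(4)[OF L(2)] .
    ultimately show ?thesis by blast
  qed
qed

end

context retained
begin

lemma fin_darts: "finite {p. (v, p) \<in> E}"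
proof -
  have "{p. (v, p) \<in> E} \<subseteq> {l. set l \<subseteq> V \<and> distinct l} \<times> V"
  proof
    fix p assume p: "p \<in> {p. (v, p) \<in> E}"
    obtain l w where lw: "p = (l, w)" by force
    have s: "distinct l" "successively adj (v # l @ [w])" using E_props(1)[of v l w] p lw by blast+
    have "z \<in> V" if "z \<in> set (l @ [w])" for z
    proof -
      obtain a b where ab: "l @ [w] = a @ z # b" using \<open>z \<in> set (l @ [w])\<close> by (meson split_list)
      have "successively adj ((v # a) @ z # b)" using s(2) ab by (metis append_Cons)
      then have "adj (last (v # a)) (hd (z # b))" unfolding successively_append_iff by blast
      then have "adj (last (v # a)) z" by simp
      then show ?thesis using adjV[OF adj_sym] by blast
    qed
    then show "p \<in> {l. set l \<subseteq> V \<and> distinct l} \<times> V" using s(1) lw by auto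
  qed
  moreover have "finite {l. set l \<subseteq> V \<and> distinct l}" using finite_subset_distinct[OF finV] by simp
  ultimately show ?thesis by (rule finite_subset[OF _ finite_cartesian_product[OF _ finV]])
qed

lemma finite_hverts: "finite hverts"
  using finX finite_I finite_subset[OF V0_I] unfolding hverts_def by simp

lemma finite_E: "finite E"
proof -
  have "E \<subseteq> (\<Union>v\<in>hverts. Pair v ` {p. (v, p) \<in> E})"
  proof
    fix t assume t: "t \<in> E"
    obtain u l v where ulv: "t = (u, l, v)" by (cases t)
    then have "u \<in> hverts" using E_props(1)[of u l v] t by blast
    then show "t \<in> (\<Union>v\<in>hverts. Pair v ` {p. (v, p) \<in> E})" using t ulv by blast
  qed
  then show ?thesis using finite_subset finite_hverts fin_darts by (metis (no_types, lifting) finite_UN_I finite_imageI)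
qed

text \<open>One dart runs to the next vertex of the multigraph along \<open>P\<close>, the other
  along \<open>rev P\<close>; both exist because \<open>x\<close> and \<open>y\<close> are such
  vertices.\<close>

lemma path_darts_two:
  assumes v: "v \<in> hverts" "v \<in> I"
  shows "card {p. (v, p) \<in> path_darts} = 2"
proof -
  have dP: "distinct P" using xypath_P unfolding xypath_def by blast
  obtain \<alpha> s where P: "P = \<alpha> @ v # s" using v(2) split_list[of v P] unfolding I_def by auto
  have hl: "hd P = x" "last P = y" using xypath_P unfolding xypath_def by auto
  have "s \<noteq> []" using hl(2) P v(2) unfolding I_def by auto
  then have "y \<in> set s" using hl(2) P by (metis last_appendR last_ConsR last_in_set list.distinct(1))
  then have w1: "\<exists>w\<in>set s. w \<in> hverts" unfolding hverts_def by blast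
  have "\<alpha> \<noteq> []" using hl(1) P v(2) unfolding I_def by auto
  then have "x \<in> set \<alpha>" using hl(1) P by (metis hd_append2 hd_in_set)
  then have w2: "\<exists>w\<in>set (rev \<alpha>). w \<in> hverts" unfolding hverts_def by auto
  have rP: "rev P = rev s @ v # rev \<alpha>" using P by simp
  obtain l z where lz: "z \<in> set s" "{p. \<exists>\<alpha>' \<beta>'. P = \<alpha>' @ v # fst p @ snd p # \<beta>' \<and> set (fst p) \<inter> hverts = {} \<and> snd p \<in> hverts} = {(l, z)}"
    using first_in[OF dP P w1] by blast
  obtain l' z' where lz': "z' \<in> set (rev \<alpha>)" "{p. \<exists>\<alpha>' \<beta>'. rev P = \<alpha>' @ v # fst p @ snd p # \<beta>' \<and> set (fst p) \<inter> hverts = {} \<and> snd p \<in> hverts} = {(l', z')}"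
    using first_in[OF succ_P(3) rP w2] by blast
  have "z \<noteq> z'" using lz(1) lz'(1) dP P by auto
  have "{p. (v, p) \<in> path_darts} = {p. \<exists>\<alpha>' \<beta>'. P = \<alpha>' @ v # fst p @ snd p # \<beta>' \<and> set (fst p) \<inter> hverts = {} \<and> snd p \<in> hverts} \<union>
      {p. \<exists>\<alpha>' \<beta>'. rev P = \<alpha>' @ v # fst p @ snd p # \<beta>' \<and> set (fst p) \<inter> hverts = {} \<and> snd p \<in> hverts}"
  proof (intro set_eqI)
    fix p
    show "p \<in> {p. (v, p) \<in> path_darts} \<longleftrightarrow> p \<in> {p. \<exists>\<alpha>' \<beta>'. P = \<alpha>' @ v # fst p @ snd p # \<beta>' \<and> set (fst p) \<inter> hverts = {} \<and> snd p \<in> hverts} \<union>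
      {p. \<exists>\<alpha>' \<beta>'. rev P = \<alpha>' @ v # fst p @ snd p # \<beta>' \<and> set (fst p) \<inter> hverts = {} \<and> snd p \<in> hverts}"
      using v(1) unfolding path_darts_def by (cases p) (simp, blast)
  qed
  then have "{p. (v, p) \<in> path_darts} = {(l, z), (l', z')}" unfolding lz(2) lz'(2) by auto
  then show ?thesis using \<open>z \<noteq> z'\<close> by simp
qed

text \<open>The component responsible for the third edge of \<open>v\<close>.\<close>

definition own :: "'a \<Rightarrow> 'a set" where "own v = (if v \<in> I then comp (th v) else comp v)"

lemma own:
  assumes "v \<in> I \<union> off"
  shows "own v \<in> comps" "v \<in> I \<Longrightarrow> th v \<in> own v" "v \<in> off \<Longrightarrow> v \<in> own v"
proof -
  have d: "v \<in> off \<Longrightarrow> v \<notin> I" unfolding off_def I_def by simp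
  then show "own v \<in> comps" using th_comps comp_comps assms unfolding own_def by auto
  show "v \<in> I \<Longrightarrow> th v \<in> own v" "v \<in> off \<Longrightarrow> v \<in> own v" using d comp_self unfolding own_def by auto
qed

lemma hverts_split: "v \<in> hverts \<Longrightarrow> v \<noteq> x \<Longrightarrow> v \<noteq> y \<Longrightarrow> v \<in> I \<union> off"
  using X_off_or A_P V0_I unfolding hverts_def by blast

lemma terminals_own:
  assumes "D \<in> comps" "v \<in> terminals D" "v \<in> I \<union> off"
  shows "D = own v"
proof -
  have "v \<noteq> x" "v \<noteq> y" using assms(3) xy_P unfolding I_def off_def by auto
  then have "v \<in> base D" using assms(2) root[of D] unfolding terminals_def by (auto split: if_splits)
  then have "v \<in> cl D \<or> v \<in> D" unfolding base_def by blast
  then have "(v \<in> I \<and> th v \<in> D) \<or> (v \<in> off \<and> v \<in> D)" using comps_off[OF assms(1)] unfolding cl_def by blast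
  then show ?thesis using comps_disj[OF assms(1) own(1)[OF assms(3)]] own(2,3)[OF assms(3)] by blast
qed

lemma linkage_darts_at:
  assumes v: "v \<in> I \<union> off"
  shows "(v, p) \<in> linkage_darts \<longleftrightarrow> \<not> own v \<subseteq> X \<and> (v, p) \<in> linkage_of (own v)"
proof
  assume a: "(v, p) \<in> linkage_darts"
  obtain l w where p: "p = (l, w)" by force
  obtain D where D: "D \<in> comps" "\<not> D \<subseteq> X" "(v, l, w) \<in> linkage_of D" "chord (D - X) (terminals D) (attachment D) v l w" using a p by (metis linkage_darts_E)
  then have "D = own v" using terminals_own[OF D(1) _ v] unfolding chord_def by blast
  then show "\<not> own v \<subseteq> X \<and> (v, p) \<in> linkage_of (own v)" using D p by blast
next
  assume "\<not> own v \<subseteq> X \<and> (v, p) \<in> linkage_of (own v)"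
  then show "(v, p) \<in> linkage_darts" using own(1)[OF v] unfolding linkage_darts_def by blast
qed

lemma single_darts_at:
  assumes v: "v \<in> I \<union> off" and s: "(v, p) \<in> single_darts"
  shows "\<exists>d. own v = {d} \<and> d \<in> X \<and> {d} \<in> comps \<and> (p = ([], third d) \<and> v = d \<or> p = ([], d) \<and> v = third d \<and> v \<in> A)"
proof -
  obtain d where d: "d \<in> X" "{d} \<in> comps" "(v = d \<and> p = ([], third d)) \<or> (v = third d \<and> p = ([], d))" using s unfolding single_darts_def by auto
  note sd = single[OF d(1,2)]
  have vxy: "v \<noteq> x" "v \<noteq> y" using v xy_P unfolding I_def off_def by auto
  have "own v = {d}"
  proof (cases "v = d")
    case True
    then have "d \<in> own v" using own(3)[OF v] sd(2) by simp
    then show ?thesis using comps_disj[OF d(2) own(1)[OF v], of d] by simp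
  next
    case False
    then have "v = third d" using d(3) by blast
    then have "v \<in> A" "th v = d" using sd(3) vxy by auto
    then have "d \<in> own v" using own(2)[OF v] A_P by auto
    then show ?thesis using comps_disj[OF d(2) own(1)[OF v], of d] by simp
  qed
  moreover have "v = third d \<Longrightarrow> v \<in> A" using sd(3) vxy by auto
  ultimately show ?thesis using d by blast
qed

lemma full_own:
  assumes v: "v \<in> I \<union> off" and f: "own v \<subseteq> X"
  shows "\<exists>d. own v = {d} \<and> d \<in> X \<and> {d} \<in> comps \<and> d \<in> cherries"
proof -
  have "own v \<subseteq> cherries" using f X_in_D[OF own(1)[OF v]] by blast
  then obtain d where d: "own v = {d}" using full_comp[OF own(1)[OF v]] by blast
  then show ?thesis using f own(1)[OF v] X_in_D[OF own(1)[OF v], of d] by auto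
qed

text \<open>The one dart is a chord unless the component of \<open>v\<close> is retained entirely,
  in which case it is the third edge of that single vertex. A vertex of \<open>V0\<close> whose
  \<open>th\<close> is retained spends its third edge on that cherry instead.\<close>

lemma third_dart:
  assumes v: "v \<in> V0 \<union> X"
  shows "v \<in> V0 \<Longrightarrow> th v \<in> X \<Longrightarrow> (v, p) \<notin> linkage_darts \<union> single_darts"
    and "\<not> (v \<in> V0 \<and> th v \<in> X) \<Longrightarrow> \<exists>p. {p. (v, p) \<in> linkage_darts \<union> single_darts} = {p}"
proof -
  have vI: "v \<in> I \<union> off" using v V0_I X_off_or A_P by blast
  note o = own[OF vI]
  show "(v, p) \<notin> linkage_darts \<union> single_darts" if "v \<in> V0" "th v \<in> X"
  proof
    assume "(v, p) \<in> linkage_darts \<union> single_darts"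
    then show False
    proof
      assume "(v, p) \<in> linkage_darts"
      then have n: "\<not> own v \<subseteq> X" "(v, p) \<in> linkage_of (own v)" using linkage_darts_at[OF vI] by blast+
      obtain l w where lw: "p = (l, w)" by force
      have "chord (own v - X) (terminals (own v)) (attachment (own v)) v l w" using linkageD(1)[OF linkage_of[OF o(1) n(1)]] n(2) lw by blast
      then have t: "v \<in> terminals (own v)" unfolding chord_def by blast
      have "v \<noteq> x" "v \<noteq> y" using V0_I that(1) unfolding I_def by auto
      then have "v \<in> base (own v)" using t root[of "own v"] unfolding terminals_def by (auto split: if_splits)
      then have "v \<in> X" using that(2) unfolding base_def by blast
      then show False using X_off_or[of v] V0_P[OF that(1)] by blast
    next
      assume "(v, p) \<in> single_darts"
      then obtain d where "v = d \<and> d \<in> X \<or> v \<in> A" using single_darts_at[OF vI] by blast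
      then show False using V0_P[OF that(1)] X_off_or[of v] by blast
    qed
  qed
  show "\<exists>p. {p. (v, p) \<in> linkage_darts \<union> single_darts} = {p}" if n: "\<not> (v \<in> V0 \<and> th v \<in> X)"
  proof (cases "own v \<subseteq> X")
    case True
    obtain d where d: "own v = {d}" "d \<in> X" "{d} \<in> comps" "d \<in> cherries" using full_own[OF vI True] by blast
    have LDn: "(v, p) \<notin> linkage_darts" for p using linkage_darts_at[OF vI] True by blast
    show ?thesis
    proof (cases "v \<in> off")
      case voff: True
      then have "v = d" using o(3) d(1) by blast
      have "{p. (v, p) \<in> single_darts} = {([], third d)}"
      proof (intro equalityI subsetI)
        fix p assume "p \<in> {p. (v, p) \<in> single_darts}"
        then obtain e where "own v = {e}" "p = ([], third e) \<or> v \<in> A" using single_darts_at[OF vI] by blast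
        then show "p \<in> {([], third d)}" using d(1) A_P voff by auto
      qed (use d \<open>v = d\<close> in \<open>auto simp: single_darts_def\<close>)
      then show ?thesis using LDn by auto
    next
      case False
      then have vi: "v \<in> I" using vI by blast
      then have thd: "th v = d" using o(2) d(1) by blast
      have "v \<notin> V0" using n thd d(2) by blast
      have "adj d v" using th[OF vi] adj_sym[of v d] thd by simp
      moreover have "v \<notin> ends0 d" using \<open>v \<notin> V0\<close> unfolding ends0_def by blast
      ultimately have t: "v = third d" using third(1)[OF d(4)] by blast
      have nd: "v \<noteq> d" using False single(2)[OF d(2,3)] by blast
      have "{p. (v, p) \<in> single_darts} = {([], d)}"
      proof (intro equalityI subsetI)
        fix p assume "p \<in> {p. (v, p) \<in> single_darts}"
        then obtain e where "own v = {e}" "p = ([], third e) \<and> v = e \<or> p = ([], e)" using single_darts_at[OF vI] by blast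
        then show "p \<in> {([], d)}" using d(1) nd by auto
      qed (use d t in \<open>auto simp: single_darts_def\<close>)
      then show ?thesis using LDn by auto
    qed
  next
    case False
    have "v \<in> base (own v)"
    proof (cases "v \<in> off")
      case True
      then have "v \<in> X" using v V0_P by blast
      then show ?thesis using o(3)[OF True] unfolding base_def by blast
    next
      case no: False
      then have vi: "v \<in> I" using vI by blast
      then have c: "v \<in> cl (own v)" using o(2) unfolding cl_def by simp
      show ?thesis
      proof (cases "v \<in> V0")
        case True
        then show ?thesis using c n V0_P[OF True] unfolding base_def by blast
      next
        case nV: False
        then have vX: "v \<in> X" using v by blast
        have "th v \<notin> X"
          by (rule third_unX[OF o(1) False o(2)[OF vi], of v]) (use th[OF vi] adj_sym[of v "th v"] vi nV in \<open>auto simp: I_def\<close>)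
        then show ?thesis using c vX unfolding base_def by blast
      qed
    qed
    then have "v \<in> terminals (own v)" unfolding terminals_def by blast
    then obtain p where p: "(v, p) \<in> linkage_of (own v)" "\<And>q. (v, q) \<in> linkage_of (own v) \<Longrightarrow> q = p" using linkage_ex1[OF linkage_of[OF o(1) False]] by metis
    have "(v, q) \<notin> single_darts" for q
    proof
      assume "(v, q) \<in> single_darts"
      then obtain d where "own v = {d}" "d \<in> X" using single_darts_at[OF vI] by blast
      then show False using False by simp
    qed
    then have "{q. (v, q) \<in> linkage_darts \<union> single_darts} = {p}" using linkage_darts_at[OF vI] False p by blast
    then show ?thesis by blast
  qed
qed

text \<open>An inner vertex has two darts along \<open>P\<close> and one for its third edge; a
  retained cherry has two darts to \<open>V0\<close> and one for its third edge.\<close>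

lemma degree:
  assumes v: "v \<in> hverts" "v \<noteq> x" "v \<noteq> y"
  shows "card {p. (v, p) \<in> E} = 3"
proof -
  have vI: "v \<in> I \<union> off" by (rule hverts_split[OF v])
  have vX: "v \<in> V0 \<union> X" using v unfolding hverts_def by blast
  have sp: "{p. (v, p) \<in> E} = {p. (v, p) \<in> path_darts} \<union> {p. (v, p) \<in> cherry_darts} \<union> {p. (v, p) \<in> linkage_darts \<union> single_darts}" unfolding E_def by blast
  show ?thesis
  proof (cases "v \<in> I")
    case True
    have vP: "v \<in> set P" "v \<notin> off" using True unfolding I_def off_def by auto
    have fPD: "finite {p. (v, p) \<in> path_darts}" using path_darts_two[OF v(1) True] by (metis card.infinite zero_neq_numeral)
    have d: "(v, p) \<notin> cherry_darts \<union> linkage_darts \<union> single_darts" if pd: "(v, p) \<in> path_darts" for p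
    proof -
      obtain l w where p: "p = (l, w)" by force
      have s: "w \<in> set P" "set l \<subseteq> set P" using path_darts_props(2)[of v l w] pd p by blast+
      have "(v, p) \<notin> cherry_darts" using cherry_darts_props(5)[of v l w] vP s(1) off_P p by blast
      moreover have "(v, p) \<notin> single_darts" using single_darts_props(5)[of v l w] vP s(1) off_P p by blast
      moreover have "(v, p) \<notin> linkage_darts"
      proof
        assume "(v, p) \<in> linkage_darts"
        then have "l \<noteq> []" "set l \<subseteq> off" using linkage_darts_props[of v l w] p by blast+
        then show False using s(2) off_P hd_in_set[of l] by blast
      qed
      ultimately show ?thesis by blast
    qed
    have "\<exists>q. {p. (v, p) \<in> cherry_darts} \<union> {p. (v, p) \<in> linkage_darts \<union> single_darts} = {q}"
    proof (cases "v \<in> V0 \<and> th v \<in> X")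
      case t: True
      have "{p. (v, p) \<in> cherry_darts} = {([], th v)}"
      proof (intro equalityI subsetI)
        fix p assume "p \<in> {p. (v, p) \<in> cherry_darts}"
        then show "p \<in> {([], th v)}" using vP(2) unfolding cherry_darts_def ends0_def by auto
      qed (use t th_off[OF True] in \<open>auto simp: cherry_darts_def ends0_def\<close>)
      moreover have "{p. (v, p) \<in> linkage_darts \<union> single_darts} = {}" using third_dart(1)[OF vX] t by blast
      ultimately show ?thesis by auto
    next
      case f: False
      have h: "{p. (v, p) \<in> cherry_darts} = {}"
      proof -
        have "(v, p) \<notin> cherry_darts" for p using f vP(2) unfolding cherry_darts_def ends0_def by (cases p) auto
        then show ?thesis by blast
      qed
      show ?thesis unfolding h Un_empty_left by (rule third_dart(2)[OF vX f])
    qed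
    then obtain q where q: "{p. (v, p) \<in> cherry_darts} \<union> {p. (v, p) \<in> linkage_darts \<union> single_darts} = {q}" by blast
    then have e: "{p. (v, p) \<in> E} = insert q {p. (v, p) \<in> path_darts}" using sp by blast
    have "q \<notin> {p. (v, p) \<in> path_darts}" using q d by blast
    then show ?thesis unfolding e using path_darts_two[OF v(1) True] fPD by simp
  next
    case False
    then have vo: "v \<in> off" using vI by blast
    then have vXo: "v \<in> X" "v \<in> cherries" using hverts_off[OF v(1)] X_off by auto
    have nV: "v \<notin> V0" "v \<notin> set P" using vo V0_P off_P by blast+
    have "{p. (v, p) \<in> path_darts} = {}"
    proof -
      have "(v, p) \<notin> path_darts" for p using path_darts_props(2)[of v "fst p" "snd p"] nV(2) by auto
      then show ?thesis by blast
    qed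
    moreover have h: "{p. (v, p) \<in> cherry_darts} = Pair [] ` ends0 v"
    proof -
      have "v \<notin> ends0 d" for d using nV unfolding ends0_def by blast
      then show ?thesis using vXo(1) vo unfolding cherry_darts_def by auto
    qed
    moreover obtain q where q: "{p. (v, p) \<in> linkage_darts \<union> single_darts} = {q}" using third_dart(2)[OF vX] nV(1) by blast
    ultimately have e: "{p. (v, p) \<in> E} = insert q (Pair [] ` ends0 v)" using sp by auto
    have "q \<notin> Pair [] ` ends0 v"
    proof
      assume "q \<in> Pair [] ` ends0 v"
      then obtain b where b: "q = ([], b)" "b \<in> ends0 v" by blast
      have "(v, [], b) \<in> linkage_darts \<union> single_darts" using q b(1) by blast
      then have "(v, [], b) \<in> single_darts" using linkage_darts_props(2) by blast
      have "v \<notin> A" using A_P[of v] vo by blast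
      with single_darts_at[OF vI \<open>(v, [], b) \<in> single_darts\<close>] have "b = third v" by auto
      then show False using third(2)[OF vXo(2)] b(2) by blast
    qed
    moreover have "card (Pair ([] :: 'a list) ` ends0 v) = 2" using vXo(2) unfolding cherries_def by (simp add: card_image inj_on_def)
    ultimately show ?thesis unfolding e using fin_ends0[of v] by simp
  qed
qed

end

section \<open>Covering paths as Hamiltonian walks\<close>

lemma nb_infix:
  assumes "r = \<alpha> @ a # w # \<beta>"
  shows "a \<in> nb r w" "w \<in> nb r a"
proof -
  have "r = \<alpha> @ [a, w] @ \<beta>" using assms by simp
  then show "a \<in> nb r w" "w \<in> nb r a" unfolding nb_def by blast+
qed

context retained
begin

lemma path_darts_nb:
  assumes "a \<in> hverts" "b \<in> hverts" "b \<in> nb P a"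
  shows "(a, [], b) \<in> E"
proof -
  obtain \<alpha> \<beta> where "P = \<alpha> @ [b, a] @ \<beta> \<or> P = \<alpha> @ [a, b] @ \<beta>" using assms(3) unfolding nb_def by blast
  then have "rev P = rev \<beta> @ a # [] @ b # rev \<alpha> \<or> P = \<alpha> @ a # [] @ b # \<beta>" by auto
  then have "\<exists>\<alpha> \<beta>. P = \<alpha> @ a # [] @ b # \<beta> \<or> rev P = \<alpha> @ a # [] @ b # \<beta>" by blast
  then have "(a, [], b) \<in> path_darts" using assms(1,2) unfolding path_darts_def by simp
  then show ?thesis unfolding E_def by blast
qed

lemma path_darts_A:
  assumes w: "w \<in> A - X" and ab: "a \<in> nb P w" "b \<in> nb P w" "a \<noteq> b"
  shows "(a, [w], b) \<in> E"
proof -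
  have wP: "w \<in> set P" "w \<noteq> hd P" "w \<noteq> last P" using w A_I xypath_P unfolding I_def xypath_def by auto
  obtain \<alpha> p q \<beta> where P: "P = \<alpha> @ [p, w, q] @ \<beta>" using inner_split[OF wP] by blast
  have n: "nb P w = {p, q}" using nb_eq[OF _ P] xypath_P unfolding xypath_def by blast
  have V: "a \<in> hverts" "b \<in> hverts" using A_nb[of w] w ab unfolding hverts_def V0_def by blast+
  have wV: "w \<notin> hverts" using w A_P[of w] xy_P A_I unfolding hverts_def I_def by blast
  have "(p = a \<and> q = b) \<or> (p = b \<and> q = a)" using n ab by auto
  then have "P = \<alpha> @ a # [w] @ b # \<beta> \<or> rev P = rev \<beta> @ a # [w] @ b # rev \<alpha>" using P by auto
  then have "\<exists>\<alpha> \<beta>. P = \<alpha> @ a # [w] @ b # \<beta> \<or> rev P = \<alpha> @ a # [w] @ b # \<beta>" by blast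
  then have "(a, [w], b) \<in> path_darts" using V wV unfolding path_darts_def by simp
  then show ?thesis unfolding E_def by blast
qed

text \<open>The chords from \<open>a\<close> and from \<open>b\<close> both start at
  \<open>w\<close>, so disjointness makes them one chord; a path without repetition that begins and
  ends at \<open>w\<close> is \<open>[w]\<close>.\<close>

lemma cherry_dart:
  assumes w: "w \<in> cherries" "w \<notin> X" and ab: "a \<in> ends0 w" "b \<in> ends0 w" "a \<noteq> b"
  shows "(a, [w], b) \<in> E"
proof -
  define D where "D = comp w"
  have woff: "w \<in> off" using w unfolding cherries_def by simp
  have D: "D \<in> comps" "w \<in> D" unfolding D_def using comp_comps[OF woff] comp_self by auto
  then have nX: "\<not> D \<subseteq> X" using w(2) by blast
  have b: "u \<in> terminals D" "attachment D u = w" if "u \<in> ends0 w" for u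
  proof -
    have u: "u \<in> V0" "th u = w" "u \<in> I" using that V0_I unfolding ends0_def by auto
    have "u \<in> base D" using u D(2) V0_P[OF u(1)] w(2) unfolding base_def cl_def by blast
    then show "u \<in> terminals D" unfolding terminals_def by blast
    show "attachment D u = w" using u unfolding attachment_def by simp
  qed
  note L = linkage_of[OF D(1) nX]
  obtain la va where la: "(a, la, va) \<in> linkage_of D" using linkage_ex1[OF L b(1)[OF ab(1)]] by force
  obtain lb vb where lb: "(b, lb, vb) \<in> linkage_of D" using linkage_ex1[OF L b(1)[OF ab(2)]] by force
  have ca: "la \<noteq> []" "hd la = w" "distinct la" using linkageD(1)[OF L la] b(2)[OF ab(1)] unfolding chord_def by auto
  have cb: "lb \<noteq> []" "hd lb = w" using linkageD(1)[OF L lb] b(2)[OF ab(2)] unfolding chord_def by auto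
  have "b = a \<or> b = va" by (rule linkage_disj[OF L la lb, of w]) (use ca cb hd_in_set[of la] hd_in_set[of lb] in auto)
  then have "va = b" using ab(3) by simp
  then have "(b, rev la, a) \<in> linkage_of D" using linkageD(2)[OF L la] by simp
  then have "hd (rev la) = w" using linkageD(1)[OF L] b(2)[OF ab(2)] unfolding chord_def by blast
  then have "last la = w" by (simp add: hd_rev)
  then have "la = [w]" using hd_last_single[OF ca(3,1)] ca(2) by simp
  then have "(a, [w], b) \<in> linkage_darts" using la \<open>va = b\<close> D(1) nX unfolding linkage_darts_def by blast
  then show ?thesis unfolding E_def by blast
qed

text \<open>A suppressed vertex of a covering path is flanked by vertices of \<open>V0\<close>: off
  \<open>P\<close> by \<open>off_cherries\<close>, and in \<open>A\<close> because its neighbours on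
  \<open>r\<close> are its path neighbours. So a label has at most one vertex, and the dart is in
  \<open>E\<close> however the attachments were paired.\<close>

lemma covering_infix:
  assumes r: "r \<in> covering" and ne: "V0 \<noteq> {}"
    and inf: "r = \<alpha> @ a # l @ b # \<beta>" and ab: "a \<in> hverts" "b \<in> hverts" and l: "set l \<inter> hverts = {}"
  shows "(a, l, b) \<in> E"
proof -
  have rx: "xypath r" and dr: "distinct r" using r unfolding covering_def xypath_def by auto
  have rV: "set r \<subseteq> V" by (rule xypath_V[OF rx])
  have offU: "w \<in> set r - set P" if "w \<in> set r" "w \<in> off" for w using that off_P by blast
  have Poff: "w \<in> set P \<or> w \<in> off" if "w \<in> set r" for w using that rV unfolding off_def by blast
  show ?thesis
  proof (cases l)
    case Nil
    have ri: "r = \<alpha> @ a # b # \<beta>" using inf Nil by simp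
    have abr: "a \<in> set r" "b \<in> set r" using ri by auto
    have adjn: "a \<in> nb r b" "b \<in> nb r a" using nb_infix[OF ri] by blast+
    have aab: "adj a b" using nb_adj_xypath[OF rx adjn(2)] .
    consider "a \<in> off" | "b \<in> off" | "a \<in> set P" "b \<in> set P" using Poff abr by blast
    then show ?thesis
    proof cases
      case 1
      then have "b \<in> ends0 a" "a \<in> X" using off_cherries(2)[OF r offU[OF abr(1) 1]] adjn(2) hverts_off[OF ab(1)] by auto
      then show ?thesis using 1 Nil unfolding E_def cherry_darts_def by blast
    next
      case 2
      then have "a \<in> ends0 b" "b \<in> X" using off_cherries(2)[OF r offU[OF abr(2) 2]] adjn(1) hverts_off[OF ab(2)] by auto
      then show ?thesis using 2 Nil unfolding E_def cherry_darts_def by blast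
    next
      case 3
      have "b \<in> nb P a"
      proof (cases "a \<in> I \<or> b \<in> I")
        case True
        then show ?thesis using adj_P_I[of a b] adj_P_I[of b a] aab adj_sym[OF aab] 3 nb_sym[of a P b] by blast
      next
        case False
        then have s: "a \<in> {x, y}" "b \<in> {x, y}" using 3 unfolding I_def by auto
        have hl: "hd r = x" "last r = y" using rx unfolding xypath_def by auto
        \<comment> \<open>An edge between \<open>x\<close> and \<open>y\<close> would be the whole
          of \<open>r\<close>, which then could not cover \<open>V0\<close>.\<close>
        have False
        proof (cases "a = x")
          case True
          then have "\<alpha> = []" using hl(1) dr ri by (cases \<alpha>) auto
          moreover have "b = y" using s(2) True dr ri by auto
          then have "\<beta> = []" using hl(2) dr ri by (cases \<beta> rule: rev_cases) auto
          ultimately have "set r = {x, y}" using ri True \<open>b = y\<close> by simp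
          moreover have "V0 \<subseteq> set r" using r unfolding covering_def by simp
          moreover have "x \<notin> V0" "y \<notin> V0" using V0_I unfolding I_def by auto
          ultimately show False using ne by auto
        next
          case False
          then have "a = y" using s(1) by simp
          moreover have "last r \<in> set (b # \<beta>)" using ri by simp
          ultimately show False using hl(2) dr ri by auto
        qed
        then show ?thesis ..
      qed
      then show ?thesis using path_darts_nb[OF ab] Nil by simp
    qed
  next
    case (Cons w l2)
    obtain n t where n: "l2 @ b # \<beta> = n # t" by (cases l2) auto
    have ri: "r = \<alpha> @ [a, w, n] @ t" using inf Cons n by simp
    have nbw: "nb r w = {a, n}" by (rule nb_eq[OF dr ri])
    have wr: "w \<in> set r" "a \<in> set r" "n \<in> set r" using ri by auto
    have wV: "w \<notin> hverts" using l Cons by auto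
    have an: "a \<noteq> n" using dr ri by auto
    have fin: "l2 = [] \<and> n = b" if "n \<in> hverts"
    proof (cases l2)
      case Nil then show ?thesis using n by simp
    next
      case (Cons c l3)
      then have "n \<in> set l" using n \<open>l = w # l2\<close> by simp
      then show ?thesis using that l by blast
    qed
    show ?thesis
    proof (cases "w \<in> off")
      case True
      note oc = off_cherries[OF r offU[OF wr(1) True]]
      have e: "a \<in> ends0 w" "n \<in> ends0 w" using oc(2) nbw by auto
      then have "n \<in> hverts" unfolding ends0_def hverts_def by simp
      then have nb: "l = [w]" "n = b" using fin Cons by auto
      have "w \<notin> X" using wV unfolding hverts_def by simp
      then show ?thesis using cherry_dart[OF oc(1) _ e an] nb by simp
    next
      case False
      then have wP: "w \<in> set P" using Poff wr(1) by blast
      have wA: "w \<in> A - X" using hverts_P[OF wP wV] .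
      have k: "u \<in> nb P w" if "u \<in> {a, n}" for u
      proof -
        have un: "u \<in> nb r w" using that nbw by simp
        have "u \<in> set P"
        proof (rule ccontr)
          assume "u \<notin> set P"
          then have "u \<in> set r - set P" using that wr by blast
          moreover have "w \<in> nb r u" using un nb_sym[of u r w] by simp
          ultimately have "w \<in> V0" using off_nb(1)[OF r] by blast
          then show False using wA V0_P by blast
        qed
        then show ?thesis using adj_P_I[of w u] nb_adj_xypath[OF rx un] wA A_P by blast
      qed
      then have "n \<in> V0" using A_nb[of w] wA unfolding V0_def by blast
      then have "n \<in> hverts" unfolding hverts_def by simp
      then have nb: "l = [w]" "n = b" using fin Cons by auto
      then show ?thesis using path_darts_A[OF wA k k an] by simp
    qed
  qed
qed

text \<open>Cutting at the vertices of the multigraph inverts lifting, so Hamiltonian walks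
  correspond one-to-one to the covering paths through \<open>X\<close>, and \<open>smith\<close>
  applies to the former.\<close>

theorem even_covering:
  assumes ne: "V0 \<noteq> {}"
  shows "even (card {r \<in> covering. X \<subseteq> set r})"
proof -
  have xyV: "x \<in> hverts" "y \<in> hverts" unfolding hverts_def by auto
  have ev: "even (card (ham_walks E hverts x y))"
  proof (rule smith[OF E_sym _ _ finite_E xy xyV])
    show "u \<noteq> v" if "(u, l, v) \<in> E" for u l v using E_props(2)[OF that] .
    show "v \<in> hverts" if "(u, l, v) \<in> E" for u l v using E_props(1)[OF that] by blast
    show "odd (card {(l, z). (v, l, z) \<in> E})" if "v \<in> hverts" "v \<noteq> x" "v \<noteq> y" for v
    proof -
      have "{(l, z). (v, l, z) \<in> E} = {p. (v, p) \<in> E}" by auto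
      then show ?thesis using degree[OF that] by simp
    qed
    have "x \<notin> V0" "y \<notin> V0" using V0_I unfolding I_def by auto
    then show "hverts - {x, y} \<noteq> {}" using ne unfolding hverts_def by blast
  qed
  have lab: "v \<in> hverts \<and> set l \<inter> hverts = {}" if s: "s \<in> ham_walks E hverts x y" "(l, v) \<in> set s" for s l v
  proof -
    have "\<And>u. walk E u s \<Longrightarrow> (l, v) \<in> set s \<Longrightarrow> \<exists>u. (u, l, v) \<in> E"
      by (induction s) auto
    then obtain u where "(u, l, v) \<in> E" using s unfolding ham_walks_def by blast
    then show ?thesis using E_props(1) by blast
  qed
  have "bij_betw (lift x) (ham_walks E hverts x y) {r \<in> covering. X \<subseteq> set r}"
  proof (rule bij_betw_imageI)
    show "inj_on (lift x) (ham_walks E hverts x y)"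
    proof (rule inj_onI)
      fix s t assume st: "s \<in> ham_walks E hverts x y" "t \<in> ham_walks E hverts x y" "lift x s = lift x t"
      show "s = t" by (rule lift_inj[OF _ st(3), of hverts]) (use lab st in blast)
    qed
    show "lift x ` ham_walks E hverts x y = {r \<in> covering. X \<subseteq> set r}"
    proof (intro equalityI subsetI)
      fix r assume "r \<in> lift x ` ham_walks E hverts x y"
      then obtain s where s: "s \<in> ham_walks E hverts x y" "r = lift x s" by blast
      have h: "walk E x s" "distinct (x # map snd s)" "set (map snd s) = hverts - {x}" "final x s = y" using s(1) unfolding ham_walks_def by auto
      note LP = lift_path[of E hverts adj x s, OF _ _ h(1,2) xyV(1)]
      have "distinct r" unfolding s(2) by (rule LP[THEN conjunct1], erule E_props(1), erule (3) E_disj)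
      moreover have "successively adj r" unfolding s(2) by (rule LP[THEN conjunct2, THEN conjunct1], erule E_props(1), erule (3) E_disj)
      ultimately have dr: "distinct r" "successively adj r" by blast+
      have "xypath r" unfolding xypath_def using dr s(2) hd_lift[of x s] last_lift[of x s] h(4) by simp
      moreover have "hverts \<subseteq> set r"
      proof -
        have "set (map snd s) \<subseteq> set (lift x s)" unfolding set_lift by force
        moreover have "x \<in> set (lift x s)" unfolding set_lift by simp
        ultimately show ?thesis using h(3) s(2) by blast
      qed
      ultimately show "r \<in> {r \<in> covering. X \<subseteq> set r}" unfolding covering_def hverts_def by blast
    next
      fix r assume "r \<in> {r \<in> covering. X \<subseteq> set r}"
      then have r: "r \<in> covering" "X \<subseteq> set r" by auto
      then have rx: "xypath r" "V0 \<subseteq> set r" unfolding covering_def by auto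
      then obtain r' where r': "r = x # r'" unfolding xypath_def by (cases r) auto
      have "last (x # r') \<in> hverts" using rx(1) r' xyV(2) unfolding xypath_def by simp
      then obtain s where s: "lift x s = r" "\<forall>(l, v)\<in>set s. v \<in> hverts \<and> set l \<inter> hverts = {}" using lift_exists r' by metis
      have w: "walk E x s" by (rule walk_lift_infix[OF s(1) _ xyV(1) s(2)]) (rule covering_infix[OF r(1) ne])
      have d: "distinct (x # map snd s)" by (rule distinct_lift) (use s(1) rx(1) in \<open>simp add: xypath_def\<close>)
      have f: "final x s = y" using last_lift[of x s] s(1) rx(1) unfolding xypath_def by simp
      have "hverts \<subseteq> set r" using rx r(2) xypath_xy[OF rx(1)] unfolding hverts_def by blast
      then have "hverts - {x} \<subseteq> set (map snd s)"
      proof -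
        have "v \<in> set (map snd s)" if v: "v \<in> hverts - {x}" for v
        proof -
          have "v \<in> set (lift x s)" using v \<open>hverts \<subseteq> set r\<close> s(1) by blast
          then obtain l w where lw: "(l, w) \<in> set s" "v = w \<or> v \<in> set l" using v unfolding set_lift by auto
          then have "v = w" using s(2) v by fastforce
          then show ?thesis using lw(1) by force
        qed
        then show ?thesis by blast
      qed
      moreover have "set (map snd s) \<subseteq> hverts - {x}" using s(2) d by fastforce
      ultimately have "s \<in> ham_walks E hverts x y" using w d f unfolding ham_walks_def by blast
      then show "r \<in> lift x ` ham_walks E hverts x y" by (rule rev_image_eqI) (use s(1) in simp)
    qed
  qed
  from bij_betw_same_card[OF this] show ?thesis using ev by simp
qed

end

section \<open>Double counting over all valid retained sets\<close>

lemma even_card_symdiff: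
  assumes "finite S" "finite T"
  shows "even (card ((S - T) \<union> (T - S))) \<longleftrightarrow> even (card S + card T)"
proof -
  have "card ((S - T) \<union> (T - S)) = card (S - T) + card (T - S)"
    by (rule card_Un_disjoint) (use assms in auto)
  moreover have "card S = card (S - T) + card (S \<inter> T)"
    using card_Int_Diff[OF assms(1), of T] by simp
  moreover have "card T = card (T - S) + card (S \<inter> T)"
    using card_Int_Diff[OF assms(2), of S] by (simp add: Int_commute)
  ultimately show ?thesis by presburger
qed

context chosen
begin

definition good :: "'a list \<Rightarrow> bool" where
  "good r \<longleftrightarrow> (\<forall>a\<in>A. (a \<in> set r \<and> comp (th a) \<inter> set r = {}) \<or> (a \<notin> set r \<and> (\<exists>d. comp (th a) \<inter> set r = {d}))) \<and>
     (\<forall>d\<in>set r - set P. \<exists>a\<in>A - set r. d \<in> comp (th a))"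

lemma even_parity_valid:
  assumes "parity_valid X" "V0 \<noteq> {}"
  shows "even (card {r \<in> covering. X \<subseteq> set r})"
proof -
  interpret retained adj V P x y A X by unfold_locales (rule assms(1))
  show ?thesis by (rule even_covering[OF assms(2)])
qed

lemma finite_A: "finite A" using finite_subset[OF A_I finite_I] .

lemma finite_ACh: "finite (A \<union> cherries)"
proof -
  have "finite cherries" by (rule finite_subset[OF _ finite_off]) (simp add: cherries_def)
  then show ?thesis using finite_A by simp
qed

lemma finite_covering: "finite covering"
proof (rule finite_subset)
  show "covering \<subseteq> {xs. set xs \<subseteq> V \<and> distinct xs}" using xypath_V unfolding covering_def xypath_def by blast
  show "finite {xs. set xs \<subseteq> V \<and> distinct xs}" by (rule finite_subset_distinct[OF finV])
qed

lemma A_cl: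
  assumes "a \<in> A"
  shows "comp (th a) \<in> comps" "a \<in> cl (comp (th a))" "big (comp (th a))" "A \<inter> cl (comp (th a)) = {a}"
proof -
  have aI: "a \<in> I" using A_I assms by blast
  show c: "comp (th a) \<in> comps" and m: "a \<in> cl (comp (th a))" using th_comps[OF aI] aI unfolding cl_def by auto
  show b: "big (comp (th a))"
  proof (rule ccontr)
    assume "\<not> big (comp (th a))"
    then have "A \<inter> cl (comp (th a)) = {}" using A_comp[OF c] by simp
    then show False using m assms by blast
  qed
  then have "card (A \<inter> cl (comp (th a))) = 1" using A_comp[OF c] by simp
  then show "A \<inter> cl (comp (th a)) = {a}" using m assms by (metis IntI card_1_singletonE singletonD)
qed

lemma cl_comp: "D \<in> comps \<Longrightarrow> v \<in> cl D \<Longrightarrow> comp (th v) = D"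
  using compsE[of D "th v"] unfolding cl_def by simp

definition block :: "'a set \<Rightarrow> 'a set" where "block D = D \<union> cl D"

definition Z :: "'a list \<Rightarrow> 'a set \<Rightarrow> 'a set" where "Z r D = set r \<inter> (A \<union> cherries) \<inter> block D"

text \<open>
  For a bad path, a nonempty subset of some \<open>Z r D\<close>, of even size unless \<open>D\<close> is adjacent to \<open>x\<close> or \<open>y\<close>, can be
  toggled in \<open>X\<close>; so bad paths contribute an even number of pairs \<open>(X, r)\<close>.
\<close>

definition bad :: "'a list \<Rightarrow> bool" where
  "bad r \<longleftrightarrow> (\<exists>D\<in>comps. if xyD D then Z r D \<noteq> {} else 2 \<le> card (Z r D))"

lemma block_disj:
  assumes "D \<in> comps" "D' \<in> comps" "D \<noteq> D'"
  shows "block D \<inter> block D' = {}"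
proof -
  have "D \<inter> D' = {}" using comps_disj[OF assms(1,2)] assms(3) by blast
  moreover have "cl D \<inter> cl D' = {}" by (rule cl_disj[OF assms])
  moreover have "cl D \<subseteq> set P" "cl D' \<subseteq> set P" unfolding cl_def I_def by auto
  moreover have "D \<inter> set P = {}" "D' \<inter> set P = {}" using D_sub assms by blast+
  ultimately show ?thesis unfolding block_def by blast
qed

text \<open>Blocks are disjoint and \<open>t\<close> lies in one of them, so only one parity
  condition is affected; its sum changes by an even amount, or it is not imposed.\<close>

lemma parity_valid_toggle:
  assumes X: "parity_valid X" and D: "D \<in> comps" and t: "t \<subseteq> (A \<union> cherries) \<inter> block D" "xyD D \<or> even (card t)"
  shows "parity_valid ((X - t) \<union> (t - X))"
  unfolding parity_valid_def
proof (intro conjI ballI impI)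
  have XA: "X \<subseteq> A \<union> cherries" using X unfolding parity_valid_def by simp
  then show "(X - t) \<union> (t - X) \<subseteq> A \<union> cherries" using t by blast
  have ft: "finite t" "finite X" using finite_subset[OF _ finite_ACh] t XA by auto
  fix D' assume D': "D' \<in> comps" "\<not> xyD D'"
  have v: "even (card (cl D' - A) + card (X \<inter> block D'))" using X D' unfolding parity_valid_def block_def by blast
  have "even (card (((X - t) \<union> (t - X)) \<inter> block D')) \<longleftrightarrow> even (card (X \<inter> block D'))"
  proof (cases "D' = D")
    case True
    have e: "((X - t) \<union> (t - X)) \<inter> block D' = (X \<inter> block D' - t) \<union> (t - X \<inter> block D')" using t True by blast
    have "even (card t)" using t(2) D' True by simp
    then show ?thesis unfolding e using even_card_symdiff[of "X \<inter> block D'" t] ft by simp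
  next
    case False
    then have "t \<inter> block D' = {}" using block_disj[OF D D'(1)] t(1) by blast
    then have "((X - t) \<union> (t - X)) \<inter> block D' = X \<inter> block D'" by blast
    then show ?thesis by simp
  qed
  then show "even (card (cl D' - A) + card (((X - t) \<union> (t - X)) \<inter> (D' \<union> cl D')))" using v unfolding block_def by simp
qed

lemma Z_P:
  assumes "D \<in> comps"
  shows "Z P D = A \<inter> cl D"
proof -
  have "D \<inter> set P = {}" "cherries \<inter> set P = {}" "A \<subseteq> set P" "cl D \<subseteq> set P"
    using D_sub[OF assms] A_I unfolding cherries_def off_def cl_def I_def by auto
  moreover have "A \<inter> D = {}" using calculation by blast
  ultimately show ?thesis unfolding Z_def block_def by blast
qed

text \<open>\<open>P\<close> meets each block in at most one vertex that can be toggled, the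
  representative, and components adjacent to \<open>x\<close> or \<open>y\<close> have none.\<close>

lemma P_not_bad: "\<not> bad P"
proof
  assume "bad P"
  then obtain D where D: "D \<in> comps" "if xyD D then Z P D \<noteq> {} else 2 \<le> card (Z P D)" unfolding bad_def by blast
  then show False using A_comp[OF D(1)] unfolding Z_P[OF D(1)] by (cases "big D") (auto simp: big_def split: if_splits)
qed

text \<open>In a big component the representative is retained exactly when this repairs the parity.
  A component that is neither big nor adjacent to \<open>x\<close> or \<open>y\<close> has exactly
  two attachments, by \<open>cl_two\<close>, and is even already.\<close>

lemma parity_valid_P: "\<exists>X. parity_valid X \<and> X \<subseteq> set P"
proof -
  define X where "X = {a \<in> A. odd (card (cl (comp (th a)) - A))}"
  have "even (card (cl D - A) + card (X \<inter> (D \<union> cl D)))" if D: "D \<in> comps" "\<not> xyD D" for D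
  proof -
    have XD: "X \<inter> (D \<union> cl D) = {a \<in> A \<inter> cl D. odd (card (cl D - A))}"
    proof -
      have "D \<inter> A = {}" using D_sub[OF D(1)] A_I unfolding I_def by blast
      moreover have "comp (th a) = D" if "a \<in> cl D" for a using cl_comp[OF D(1) that] .
      ultimately show ?thesis unfolding X_def by auto
    qed
    show ?thesis
    proof (cases "big D")
      case True
      then have "card (A \<inter> cl D) = 1" using A_comp[OF D(1)] by simp
      then obtain a where a: "A \<inter> cl D = {a}" using card_1_singletonE by blast
      show ?thesis
      proof (cases "odd (card (cl D - A))")
        case True
        then have "X \<inter> (D \<union> cl D) = {a}" using XD a by simp
        then show ?thesis using True by simp
      next
        case False
        then have "X \<inter> (D \<union> cl D) = {}" using XD by simp
        then show ?thesis using False by simp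
      qed
    next
      case False
      then have n: "A \<inter> cl D = {}" using A_comp[OF D(1)] by simp
      then have "cl D - A = cl D" "X \<inter> (D \<union> cl D) = {}" using XD by blast+
      moreover have "card (cl D) = 2" using False D(2) cl_two[OF D] unfolding big_def by simp
      ultimately show ?thesis by simp
    qed
  qed
  then have "parity_valid X" unfolding parity_valid_def X_def by blast
  moreover have "X \<subseteq> set P" using A_I unfolding X_def I_def by blast
  ultimately show ?thesis by blast
qed

text \<open>A valid set within \<open>P\<close> contains no cherries, so in each big component
  parity alone decides about the representative. Hence \<open>P\<close> is counted with exactly one
  retained set.\<close>

lemma parity_valid_P_unique:
  assumes X: "parity_valid X" "X \<subseteq> set P" and Y: "parity_valid Y" "Y \<subseteq> set P"
  shows "X = Y"
proof -
  have key: "a \<in> X \<longleftrightarrow> odd (card (cl (comp (th a)) - A))" if X: "parity_valid X" "X \<subseteq> set P" and a: "a \<in> A" for X a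
  proof -
    let ?D = "comp (th a)"
    have XA: "X \<subseteq> A" using X unfolding parity_valid_def cherries_def off_def by blast
    have "?D \<inter> A = {}" using D_sub[OF A_cl(1)[OF a]] A_I unfolding I_def by blast
    then have "X \<inter> (?D \<union> cl ?D) = X \<inter> {a}" using XA A_cl(2,4)[OF a] by blast
    moreover have "even (card (cl ?D - A) + card (X \<inter> (?D \<union> cl ?D)))"
      using X(1) A_cl(1,3)[OF a] unfolding parity_valid_def big_def by blast
    ultimately show ?thesis by (cases "a \<in> X") auto
  qed
  have "X \<subseteq> A" "Y \<subseteq> A" using X Y unfolding parity_valid_def cherries_def off_def by blast+
  then show ?thesis using key[OF X] key[OF Y] by blast
qed

text \<open>The pairs of a valid set and a covering path through it are even in number, and so are
  those with a bad path. The remaining pairs are even in number too and include exactly one with the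
  path \<open>P\<close>, so another path occurs.\<close>

lemma exists_not_bad:
  assumes ne: "V0 \<noteq> {}"
  shows "\<exists>r\<in>covering. r \<noteq> P \<and> \<not> bad r"
proof -
  define VS where "VS = {X. parity_valid X}"
  define Om where "Om = (SIGMA X : VS. {r \<in> covering. X \<subseteq> set r})"
  have fVS: "finite VS" by (rule finite_subset[of _ "Pow (A \<union> cherries)"]) (use finite_ACh in \<open>auto simp: VS_def parity_valid_def\<close>)
  have fOm: "finite Om" unfolding Om_def using fVS finite_covering by simp
  have "card Om = (\<Sum>X\<in>VS. card {r \<in> covering. X \<subseteq> set r})" unfolding Om_def using card_SigmaI[OF fVS, of "\<lambda>X. {r \<in> covering. X \<subseteq> set r}"] finite_covering by simp
  moreover have "even (\<Sum>X\<in>VS. card {r \<in> covering. X \<subseteq> set r})"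
    by (rule dvd_sum) (use even_parity_valid[OF _ ne] in \<open>simp add: VS_def\<close>)
  ultimately have evOm: "even (card Om)" by simp
  define tp where "tp r t \<longleftrightarrow> (\<exists>D\<in>comps. t \<subseteq> Z r D \<and> t \<noteq> {} \<and> (xyD D \<or> even (card t)))" for r t
  define tg where "tg r = (SOME t. tp r t)" for r
  have tg: "tp r (tg r)" if b: "bad r" for r
  proof -
    obtain D where D: "D \<in> comps" "if xyD D then Z r D \<noteq> {} else 2 \<le> card (Z r D)" using b unfolding bad_def by blast
    have "\<exists>t. tp r t"
    proof (cases "xyD D")
      case True
      then have "tp r (Z r D)" using D unfolding tp_def by (intro bexI[of _ D]) auto
      then show ?thesis by blast
    next
      case False
      then have "2 \<le> card (Z r D)" using D by simp
      then obtain t where t: "t \<subseteq> Z r D" "card t = 2" by (meson obtain_subset_with_card_n)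
      then have "tp r t" unfolding tp_def using D(1) by (intro bexI[of _ D]) auto
      then show ?thesis by blast
    qed
    then show ?thesis unfolding tg_def by (rule someI_ex)
  qed
  let ?B = "{p \<in> Om. bad (snd p)}" and ?G = "{p \<in> Om. \<not> bad (snd p)}"
  \<comment> \<open>The toggled set \<open>tg r\<close> depends on the path alone, which makes
    toggling an involution.\<close>
  define f where "f p = ((fst p - tg (snd p)) \<union> (tg (snd p) - fst p), snd p)" for p :: "'a set \<times> 'a list"
  have "even (card ?B)"
  proof (rule even_card_involution[where f = f])
    show "finite ?B" using fOm by simp
    fix p assume p: "p \<in> ?B"
    obtain X r where pp: "p = (X, r)" by force
    have h: "parity_valid X" "r \<in> covering" "X \<subseteq> set r" "bad r" using p unfolding pp Om_def VS_def by auto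
    obtain D where D: "D \<in> comps" "tg r \<subseteq> Z r D" "tg r \<noteq> {}" "xyD D \<or> even (card (tg r))" using tg[OF h(4)] unfolding tp_def by blast
    have fp: "f p = ((X - tg r) \<union> (tg r - X), r)" unfolding f_def pp by simp
    have "tg r \<subseteq> (A \<union> cherries) \<inter> block D" "tg r \<subseteq> set r" using D(2) unfolding Z_def by blast+
    then show "f p \<in> ?B" unfolding fp Om_def VS_def using parity_valid_toggle[OF h(1) D(1) _ D(4)] h by auto
    show "f (f p) = p" unfolding fp unfolding f_def pp by auto
    obtain t where "t \<in> tg r" using D(3) by blast
    then have "(X - tg r) \<union> (tg r - X) \<noteq> X" by blast
    then show "f p \<noteq> p" using fp pp by (metis prod.inject)
  qed
  moreover have "card Om = card ?B + card ?G"
  proof -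
    have "Om = ?B \<union> ?G" "?B \<inter> ?G = {}" by auto
    then show ?thesis using card_Un_disjoint[of ?B ?G] fOm by simp
  qed
  ultimately have evG: "even (card ?G)" using evOm by simp
  obtain X where X: "parity_valid X" "X \<subseteq> set P" using parity_valid_P by blast
  have inG: "(X, P) \<in> ?G" unfolding Om_def VS_def using X P_covering P_not_bad by simp
  have "?G \<noteq> {(X, P)}"
  proof
    assume "?G = {(X, P)}"
    then have "card ?G = 1" by simp
    then show False using evG by simp
  qed
  then obtain p where p: "p \<in> ?G" "p \<noteq> (X, P)" using inG by blast
  obtain Y r where "p = (Y, r)" by force
  then have Yr: "(Y, r) \<in> ?G" "(Y, r) \<noteq> (X, P)" using p by auto
  then have h: "parity_valid Y" "r \<in> covering" "Y \<subseteq> set r" "\<not> bad r" unfolding Om_def VS_def by auto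
  have "r \<noteq> P"
  proof
    assume "r = P"
    then have "Y = X" using parity_valid_P_unique[OF h(1) _ X] h(3) by simp
    then show False using Yr(2) \<open>r = P\<close> by simp
  qed
  then show ?thesis using h by blast
qed

text \<open>If \<open>r\<close> uses \<open>u\<close> off \<open>P\<close>, then \<open>u\<close> is
  the only vertex of \<open>r\<close> in its block that can be toggled; so the component is big and
  its representative is missed. This maps the vertices off \<open>P\<close> injectively to missed
  representatives, and \<open>equality_case\<close> makes the map onto.\<close>

lemma not_bad_good:
  assumes r: "r \<in> covering" and nb: "\<not> bad r"
  shows "good r"
proof -
  let ?U = "set r - set P"
  have rV: "set r \<subseteq> V" using r xypath_V unfolding covering_def by blast
  have key: "\<exists>a\<in>A - set r. comp u = comp (th a) \<and> comp u \<inter> set r = {u}" if u: "u \<in> ?U" for u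
  proof -
    have uC: "u \<in> cherries" using off_cherries(1)[OF r u] .
    then have uo: "u \<in> off" and e2: "card (ends0 u) = 2" unfolding cherries_def by auto
    let ?D = "comp u"
    have D: "?D \<in> comps" "u \<in> ?D" using comp_comps[OF uo] comp_self by auto
    have uZ: "u \<in> Z r ?D" using u uC D(2) unfolding Z_def block_def by blast
    have nx: "\<not> xyD ?D" using nb D(1) uZ unfolding bad_def by fastforce
    have "\<not> 2 \<le> card (Z r ?D)" using nb D(1) nx unfolding bad_def by fastforce
    moreover have fZ: "finite (Z r ?D)" unfolding Z_def by simp
    ultimately have "card (Z r ?D) = 1" using uZ by (metis One_nat_def card_0_eq empty_iff less_2_cases not_le)
    then have Zu: "Z r ?D = {u}" using uZ by (metis card_1_singletonE singletonD)
    have sub: "ends0 u \<subseteq> ends u" "ends u \<subseteq> cl ?D" using V0_I ends_cl[OF D] unfolding ends0_def ends_def by auto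
    \<comment> \<open>With only two attachments, both would hang on the cherry
      \<open>u\<close>.\<close>
    have "card (cl ?D) \<noteq> 2"
    proof
      assume c: "card (cl ?D) = 2"
      have "ends0 u = cl ?D" by (rule card_subset_eq[OF finite_cl]) (use sub c e2 in auto)
      then have "cl ?D = ends u" using sub by blast
      then show False using no_pair_cherry[OF D(1) nx D(2) _ c] by blast
    qed
    then have bg: "big ?D" using cl_two[OF D(1) nx] nx unfolding big_def by simp
    then have "card (A \<inter> cl ?D) = 1" using A_comp[OF D(1)] by simp
    then obtain a where a: "A \<inter> cl ?D = {a}" using card_1_singletonE by blast
    then have aA: "a \<in> A" "a \<in> cl ?D" by auto
    have ca: "comp (th a) = ?D" using cl_comp[OF D(1) aA(2)] .
    have "a \<notin> set r"
    proof
      assume "a \<in> set r"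
      then have "a \<in> Z r ?D" using aA unfolding Z_def block_def by blast
      then have "a = u" using Zu by blast
      then show False using aA(1) A_I u unfolding I_def by blast
    qed
    moreover have "?D \<inter> set r = {u}"
    proof (intro equalityI subsetI)
      fix d assume d: "d \<in> ?D \<inter> set r"
      then have "d \<in> ?U" using D_sub[OF D(1)] by blast
      then have "d \<in> cherries" using off_cherries(1)[OF r] by blast
      then have "d \<in> Z r ?D" using d unfolding Z_def block_def by blast
      then show "d \<in> {u}" using Zu by blast
    qed (use u D(2) in auto)
    ultimately show ?thesis using aA(1) ca by auto
  qed
  define \<phi> where "\<phi> u = (SOME a. a \<in> A - set r \<and> comp u = comp (th a) \<and> comp u \<inter> set r = {u})" for u
  have \<phi>: "\<phi> u \<in> A - set r \<and> comp u = comp (th (\<phi> u)) \<and> comp u \<inter> set r = {u}" if "u \<in> ?U" for u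
    unfolding \<phi>_def by (rule someI_ex) (use key[OF that] in blast)
  have inj: "inj_on \<phi> ?U"
  proof (rule inj_onI)
    fix u v assume uv: "u \<in> ?U" "v \<in> ?U" "\<phi> u = \<phi> v"
    then have "comp u = comp v" using \<phi>[OF uv(1)] \<phi>[OF uv(2)] by simp
    moreover have "comp u \<inter> set r = {u}" "comp v \<inter> set r = {v}" using \<phi>[OF uv(1)] \<phi>[OF uv(2)] by blast+
    ultimately have "{u} = {v}" by metis
    then show "u = v" by simp
  qed
  have img: "\<phi> ` ?U = A - set r"
    by (rule card_subset_eq) (use \<phi> finite_A card_image[OF inj] equality_case(1)[OF r] in auto)
  have sur: "\<exists>u\<in>?U. \<phi> u = a" if a: "a \<in> A - set r" for a
  proof -
    have "a \<in> \<phi> ` ?U" unfolding img by (rule a)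
    then show ?thesis by (elim imageE) blast
  qed
  show ?thesis unfolding good_def
  proof (intro conjI ballI)
    fix a assume a: "a \<in> A"
    show "(a \<in> set r \<and> comp (th a) \<inter> set r = {}) \<or> (a \<notin> set r \<and> (\<exists>d. comp (th a) \<inter> set r = {d}))"
    proof (cases "a \<in> set r")
      case True
      have "comp (th a) \<inter> set r = {}"
      proof (rule ccontr)
        assume "comp (th a) \<inter> set r \<noteq> {}"
        then obtain d where d: "d \<in> comp (th a)" "d \<in> set r" by blast
        then have "d \<in> ?U" using D_sub[OF A_cl(1)[OF a]] by blast
        note f = \<phi>[OF this]
        have "comp d = comp (th a)" using comp_eq[OF d(1)] .
        then have c: "comp (th (\<phi> d)) = comp (th a)" using f by simp
        have "\<phi> d \<in> A \<inter> cl (comp (th (\<phi> d)))" using A_cl(2)[of "\<phi> d"] f by blast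
        then have "\<phi> d = a" using A_cl(4)[OF a] unfolding c by blast
        then show False using f True by blast
      qed
      then show ?thesis using True by blast
    next
      case False
      then obtain u where "u \<in> ?U" "\<phi> u = a" using sur a by blast
      then show ?thesis using \<phi>[of u] False by auto
    qed
  next
    fix d assume "d \<in> ?U"
    from \<phi>[OF this] show "\<exists>a\<in>A - set r. d \<in> comp (th a)" using comp_self[of d] by auto
  qed
qed

theorem exists_good: "V0 \<noteq> {} \<Longrightarrow> \<exists>r\<in>covering. r \<noteq> P \<and> good r"
  using exists_not_bad not_bad_good by blast

end

section \<open>Exchanging missed vertices\<close>

fun edg :: "'v \<Rightarrow> ('l list \<times> 'v) list \<Rightarrow> ('v \<times> 'l list \<times> 'v) set" where
  "edg u [] = {}"
| "edg u ((l, v) # s) = insert (u, l, v) (edg v s)"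

lemma edg_append: "edg u (s @ t) = edg u s \<union> edg (final u s) t"
  by (induction u s rule: edg.induct) auto

lemma edg_revs: "(a, l, b) \<in> edg u s \<Longrightarrow> (b, rev l, a) \<in> edg (final u s) (revs u s)"
  by (induction u s rule: edg.induct) (auto simp: edg_append final_revs)

lemma edg_final:
  assumes "distinct (u # map snd s)" "(a, l, b) \<in> edg u s"
  shows "a \<noteq> final u s" "b = final u s \<Longrightarrow> \<exists>\<alpha>. s = \<alpha> @ [(l, b)] \<and> final u \<alpha> = a"
  using assms
proof (induction u s rule: edg.induct)
  case (2 u l' v s)
  {
    case 1
    show ?case
    proof (cases "(a, l, b) = (u, l', v)")
      case True
      have "final v s \<in> insert v (set (map snd s))" by (rule final_in)
      then show ?thesis using True 1 by auto
    next
      case False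
      then show ?thesis using 2(1) 1 by auto
    qed
  next
    case 2
    show ?case
    proof (cases "(a, l, b) = (u, l', v)")
      case True
      have "s = []"
      proof (rule ccontr)
        assume "s \<noteq> []"
        then obtain s' l2 v2 where "s = s' @ [(l2, v2)]" by (metis rev_exhaust surj_pair)
        then show False using 2(1,2) True by (simp add: final_append)
      qed
      then show ?thesis using True by (intro exI[of _ "[]"]) auto
    next
      case False
      then have "(a, l, b) \<in> edg v s" "b = final v s" "distinct (v # map snd s)" using 2 by auto
      then obtain \<alpha> where "s = \<alpha> @ [(l, b)]" "final v \<alpha> = a" using "2.IH"(2) by blast
      then show ?thesis by (intro exI[of _ "(l', v) # \<alpha>"]) simp
    qed
  }
qed auto

lemma split_unique:
  assumes "distinct r" "r = \<alpha> @ v # s" "r = \<alpha>' @ v # s'"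
  shows "\<alpha> = \<alpha>' \<and> s = s'"
proof -
  have "v \<notin> set \<alpha>" "v \<notin> set s" using assms(1,2) by auto
  moreover have "\<alpha> @ v # s = \<alpha>' @ v # s'" using assms(2,3) by simp
  ultimately show ?thesis using append_Cons_eq_iff[of v \<alpha> s \<alpha>' s'] by simp
qed

lemma path_eq_aux:
  assumes "distinct (\<alpha> @ [c, a] @ s)" "distinct (\<alpha> @ [c, a] @ t)" "last (a # s) = last (a # t)"
    and "\<And>v. v \<in> set (a # s) \<Longrightarrow> v \<noteq> last (a # s) \<Longrightarrow> nb (\<alpha> @ [c, a] @ s) v = nb (\<alpha> @ [c, a] @ t) v"
  shows "s = t"
  using assms
proof (induction s arbitrary: \<alpha> c a t)
  case Nil
  show ?case
  proof (cases t)
    case (Cons b t')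
    then have "a \<in> set t" using Nil(3) by (metis last.simps last_in_set list.distinct(1))
    then show ?thesis using Nil(2) by simp
  qed simp
next
  case (Cons b s)
  have al: "a \<noteq> last (a # b # s)" using Cons.prems(1) last_in_set[of "b # s"] by auto
  then have "t \<noteq> []" using Cons.prems(3) by auto
  then obtain b' t' where t: "t = b' # t'" by (cases t) auto
  have "nb (\<alpha> @ [c, a] @ (b # s)) a = {c, b}" "nb (\<alpha> @ [c, a] @ t) a = {c, b'}"
    using nb_eq[OF Cons.prems(1), of \<alpha> c a b s] nb_eq[OF Cons.prems(2), of \<alpha> c a b' t'] t by simp_all
  then have "{c, b} = {c, b'}" using Cons.prems(4)[of a] al by simp
  moreover have "b \<noteq> c" using Cons.prems(1) by auto
  ultimately have bb: "b' = b" by auto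
  have "s = t'"
    by (rule Cons.IH[of "\<alpha> @ [c]" a b t']) (use Cons.prems t bb in \<open>auto split: if_splits\<close>)
  then show ?case using t bb by simp
qed

text \<open>From the common start on, each inner vertex dictates the next one as its other
  neighbour. Length 3 provides an inner vertex next to \<open>hd p\<close>, which fixes the second
  vertex of \<open>q\<close>.\<close>

lemma path_eq:
  assumes d: "distinct p" "distinct q" and h: "hd p = hd q" "last p = last q" and len: "3 \<le> length p" "2 \<le> length q"
    and n: "\<And>v. v \<in> set p \<Longrightarrow> v \<noteq> hd p \<Longrightarrow> v \<noteq> last p \<Longrightarrow> nb p v = nb q v"
  shows "p = q"
proof -
  obtain x a b s where p: "p = x # a # b # s" using len(1) by (cases p; cases "tl p"; cases "tl (tl p)") auto
  obtain x' a' t where q: "q = x' # a' # t" using len(2) by (cases q; cases "tl q") auto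
  have xx: "x' = x" using h(1) p q by simp
  have "a \<noteq> last p" using d(1) p last_in_set[of "b # s"] by auto
  then have "nb p a = nb q a" using n[of a] d(1) p by auto
  moreover have "x \<in> nb p a" unfolding nb_def using p by (intro CollectI exI[of _ "[]"] exI[of _ "b # s"]) simp
  ultimately have "x \<in> nb q a" by simp
  then obtain \<gamma> \<delta> where "q = \<gamma> @ x # a # \<delta> \<or> q = (\<gamma> @ [a]) @ x # \<delta>" unfolding nb_def by auto
  moreover have q0: "q = [] @ x # (a' # t)" using q xx by simp
  ultimately have "a' # t = a # \<delta> \<or> \<gamma> @ [a] = []" using split_unique[OF d(2) q0] by metis
  then have aa: "a' = a" by auto
  have "b # s = t"
  proof (rule path_eq_aux[of "[]" x a])
    show "distinct ([] @ [x, a] @ b # s)" "distinct ([] @ [x, a] @ t)" using d p q xx aa by auto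
    show "last (a # b # s) = last (a # t)" using h(2) p q aa by simp
    fix v assume v: "v \<in> set (a # b # s)" "v \<noteq> last (a # b # s)"
    then have "v \<noteq> x" "v \<in> set p" "v \<noteq> last p" using d(1) p by auto
    then have "nb p v = nb q v" using n p by simp
    then show "nb ([] @ [x, a] @ b # s) v = nb ([] @ [x, a] @ t) v" using p q xx aa by simp
  qed
  then show ?thesis using p q xx aa by simp
qed

text \<open>If \<open>v\<close> is already on the path, the path is cut off there.\<close>

lemma path_extend:
  assumes "p \<noteq> []" "distinct p" "successively adj p" "adj (last p) v"
  shows "\<exists>q. q \<noteq> [] \<and> hd q = hd p \<and> last q = v \<and> distinct q \<and> successively adj q \<and> set q \<subseteq> insert v (set p)"
proof (cases "v \<in> set p")
  case True
  then obtain a b where p: "p = (a @ [v]) @ b" by (metis append_Cons append_Nil append_assoc split_list)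
  have "successively adj (a @ [v])" using assms(3) unfolding p successively_append_iff by blast
  moreover have "hd (a @ [v]) = hd p" unfolding p by (cases a) auto
  moreover have "distinct (a @ [v])" "set (a @ [v]) \<subseteq> insert v (set p)" using assms(2) unfolding p by auto
  ultimately show ?thesis by (intro exI[of _ "a @ [v]"]) simp
next
  case False
  have "successively adj (p @ [v])" using assms by (simp add: successively_append_iff)
  then show ?thesis using assms False by (intro exI[of _ "p @ [v]"]) auto
qed

context cubic_longest
begin

lemma comp_path:
  assumes D: "D \<in> comps" "e \<in> D" "d \<in> D"
  shows "\<exists>p. p \<noteq> [] \<and> hd p = e \<and> last p = d \<and> distinct p \<and> successively adj p \<and> set p \<subseteq> D"
proof -
  define S where "S = {d \<in> D. \<exists>p. p \<noteq> [] \<and> hd p = e \<and> last p = d \<and> distinct p \<and> successively adj p \<and> set p \<subseteq> D}"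
  have "e \<in> S" unfolding S_def using D(2) by (auto intro!: exI[of _ "[e]"])
  moreover have "v \<in> S" if u: "u \<in> S" and v: "v \<in> D" "adj u v" for u v
  proof -
    obtain p where p: "p \<noteq> []" "hd p = e" "last p = u" "distinct p" "successively adj p" "set p \<subseteq> D" using u unfolding S_def by blast
    have "adj (last p) v" using p(3) v(2) by simp
    from path_extend[OF p(1,4,5) this] obtain q where
      q: "q \<noteq> []" "hd q = hd p" "last q = v" "distinct q" "successively adj q" "set q \<subseteq> insert v (set p)" by blast
    have "set q \<subseteq> D" using q(6) p(6) v(1) by blast
    then show ?thesis unfolding S_def using q p(2) v(1) by auto
  qed
  ultimately have "S = D" by (intro comps_conn[OF D(1)]) (auto simp: S_def)
  then show ?thesis using D(3) unfolding S_def by blast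
qed

end

context chosen
begin

text \<open>Nothing is missed, so by \<open>equality_case\<close> nothing off \<open>P\<close> is
  visited. An inner vertex is left with its two path neighbours, and \<open>path_eq\<close>
  applies.\<close>

lemma no_missed_eq_P:
  assumes r: "r \<in> covering" and O: "A - set r = {}" and ne: "V0 \<noteq> {}"
  shows "r = P"
proof -
  have rx: "xypath r" using r unfolding covering_def by simp
  have U: "set r - set P = {}" using equality_case(1)[OF r] O by simp
  have IP: "I \<subseteq> set r" using r O unfolding covering_def V0_def by blast
  have "card {x, y} + card I \<le> card (set P)"
  proof -
    have "card ({x, y} \<union> I) = card {x, y} + card I" by (rule card_Un_disjoint) (auto simp: I_def)
    moreover have "card ({x, y} \<union> I) \<le> card (set P)" by (rule card_mono) (use xy_P in \<open>auto simp: I_def\<close>)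
    ultimately show ?thesis by simp
  qed
  moreover have "card I \<noteq> 0" using ne finite_I V0_I by auto
  moreover have "card (set P) = length P" using xypath_P distinct_card unfolding xypath_def by blast
  ultimately have len: "3 \<le> length P" using xy by simp
  have "P = r"
  proof (rule path_eq)
    show "distinct P" "distinct r" "hd P = hd r" "last P = last r" using xypath_P rx unfolding xypath_def by auto
    show "3 \<le> length P" "2 \<le> length r" using len equality_case(4)[OF r] by auto
    fix v assume v: "v \<in> set P" "v \<noteq> hd P" "v \<noteq> last P"
    then have vI: "v \<in> I" using xypath_P unfolding I_def xypath_def by auto
    have vr: "v \<in> set r" "v \<noteq> x" "v \<noteq> y" using IP vI unfolding I_def by auto
    have c: "card (nb r v) = 2" using card_nb_xypath[OF rx vr] by blast
    have "nb r v \<subseteq> nb P v"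
    proof
      fix u assume u: "u \<in> nb r v"
      then have "adj v u" "u \<in> set r" using nb_adj_xypath[OF rx u] nb_set[OF u] by auto
      then show "u \<in> nb P v" using adj_P_I[OF vI] U by blast
    qed
    then have "nb r v = nb P v" using card_subset_eq[OF nbrs_I(4)[OF vI], of "nb r v"] c nbrs_I(3)[OF vI] by simp
    then show "nb P v = nb r v" by (rule sym)
  qed
  then show ?thesis by simp
qed

end

section \<open>The multigraph of exchanges at the missed vertices\<close>

locale swap = chosen +
  fixes r :: "'a list"
  assumes r_covering: "r \<in> covering" and r_good: "good r" and r_ne: "r \<noteq> P" and V0_ne: "V0 \<noteq> {}"
    and minimal: "\<And>r'. r' \<in> covering \<Longrightarrow> good r' \<Longrightarrow> r' \<noteq> P \<Longrightarrow> card (A - set r) \<le> card (A - set r')"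
begin

definition M :: "'a set" where "M = A - set r"

definition detour :: "'a \<Rightarrow> 'a" where "detour a = (THE d. comp (th a) \<inter> set r = {d})"

definition W :: "'a set" where "W = leaving r"

lemma M_A: "a \<in> M \<Longrightarrow> a \<in> A \<and> a \<notin> set r \<and> a \<in> I \<and> a \<in> set P"
  using A_P unfolding M_def by blast

lemma detour: "a \<in> M \<Longrightarrow> comp (th a) \<inter> set r = {detour a}"
proof -
  assume "a \<in> M"
  then obtain d where d: "comp (th a) \<inter> set r = {d}" using r_good unfolding good_def M_def by blast
  then have "detour a = d" unfolding detour_def by auto
  then show ?thesis using d by simp
qed

lemma detour_comp: "a \<in> M \<Longrightarrow> comp (th a) \<in> comps \<and> detour a \<in> comp (th a) \<and> detour a \<in> set r - set P"
  using detour[of a] A_cl(1)[of a] M_A[of a] D_sub[of "comp (th a)"] by blast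

lemma comp_inj: "a \<in> A \<Longrightarrow> b \<in> A \<Longrightarrow> d \<in> comp (th a) \<Longrightarrow> d \<in> comp (th b) \<Longrightarrow> a = b"
proof -
  assume a: "a \<in> A" "b \<in> A" "d \<in> comp (th a)" "d \<in> comp (th b)"
  have "comp (th a) = comp (th b)" by (rule comps_disj[OF A_cl(1)[OF a(1)] A_cl(1)[OF a(2)] a(3) a(4)])
  have "{a} = A \<inter> cl (comp (th b))" using A_cl(4)[OF a(1)] unfolding \<open>comp (th a) = comp (th b)\<close> by (rule sym)
  then have "{a} = {b}" unfolding A_cl(4)[OF a(2)] .
  then show "a = b" by simp
qed

lemma off_detour: "d \<in> set r - set P \<Longrightarrow> \<exists>a\<in>M. d = detour a"
proof -
  assume d: "d \<in> set r - set P"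
  then obtain a where a: "a \<in> A - set r" "d \<in> comp (th a)" using r_good unfolding good_def by blast
  then have "d \<in> comp (th a) \<inter> set r" using d by blast
  then show ?thesis using detour[of a] a(1) unfolding M_def by blast
qed

lemma W_eq: "W = (\<Union>a\<in>M. nb P a)" and W_V0: "W \<subseteq> V0"
  using equality_case(2)[OF r_covering] unfolding W_def M_def leaving_def by auto

lemma W_P: "w \<in> W \<Longrightarrow> w \<in> I \<and> w \<in> set P \<and> w \<notin> A \<and> w \<notin> M \<and> w \<notin> off"
  using W_V0 V0_P unfolding M_def by blast

text \<open>Two missed vertices share no path neighbour, by \<open>missed_nb\<close>.\<close>

lemma W_o: "w \<in> W \<Longrightarrow> \<exists>o1. nb P w \<inter> M = {o1}"
proof -
  assume w: "w \<in> W"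
  then obtain a where a: "a \<in> M" "w \<in> nb P a" using W_eq by blast
  have "b = a" if "b \<in> nb P w \<inter> M" for b
  proof -
    have "w \<in> nb P b" using that nb_sym[of b P w] by blast
    then show ?thesis using missed_nb(2)[OF r_covering, of a w b] a that unfolding M_def by blast
  qed
  moreover have "a \<in> nb P w" using a nb_sym[of a P w] by blast
  ultimately show ?thesis using a(1) by blast
qed

text \<open>On \<open>r\<close> the vertex \<open>w\<close> steps off \<open>P\<close> to
  \<open>th w\<close>, which is the detour of one missed vertex, and distinct missed vertices have
  distinct components. That missed vertex need not be the one next to \<open>w\<close> on
  \<open>P\<close>.\<close>

lemma W_d: "w \<in> W \<Longrightarrow> \<exists>o1. {a \<in> M. w \<in> nb r (detour a)} = {o1}"
proof -
  assume w: "w \<in> W"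
  then have t: "th w \<in> nb r w" "w \<in> I" using W_P unfolding W_def leaving_def by auto
  have "th w \<in> set r - set P" using nb_set[OF t(1)] th[OF t(2)] by blast
  then obtain a where a: "a \<in> M" "th w = detour a" using off_detour by blast
  have "w \<in> nb r (detour a)" using t(1) nb_sym[of w r "detour a"] a(2) by simp
  moreover have "b = a" if "b \<in> M" "w \<in> nb r (detour b)" for b
  proof -
    have "th w = detour b" using off_nb(2)[OF r_covering _ that(2)] detour_comp[OF that(1)] by blast
    then have "detour a \<in> comp (th a)" "detour a \<in> comp (th b)" using a detour_comp[of a] detour_comp[of b] that by auto
    then show ?thesis using comp_inj[of b a "detour a"] M_A a(1) that(1) by blast
  qed
  ultimately show ?thesis using a(1) by blast
qed

lemma detour_W: "a \<in> M \<Longrightarrow> w \<in> nb r (detour a) \<Longrightarrow> w \<in> W \<and> adj (detour a) w"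
  using off_nb(3)[OF r_covering, of "detour a" w] detour_comp[of a] nb_adj_xypath[of r w "detour a"] r_covering unfolding W_def covering_def by blast

lemma M_W: "a \<in> M \<Longrightarrow> w \<in> nb P a \<Longrightarrow> w \<in> W"
  using W_eq by blast

lemma M_ne: "M \<noteq> {}"
  using no_missed_eq_P[OF r_covering _ V0_ne] r_ne unfolding M_def by blast

text \<open>The core runs from the first missed vertex to the vertex just behind the last one, so it
  ends in \<open>W\<close>, where the number of darts is known; \<open>pre\<close> and
  \<open>post\<close> will be kept unchanged.\<close>

lemma core_exists:
  "\<exists>pre o1 mid ok wl post. P = pre @ (o1 # mid @ [wl]) @ post \<and> o1 \<in> M \<and> ok \<in> M \<and> (\<exists>m. o1 # mid = m @ [ok]) \<and>
     set pre \<inter> M = {} \<and> wl \<in> W \<and> set post \<inter> M = {} \<and> pre \<noteq> [] \<and> last pre \<in> W \<and> post \<noteq> []"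
proof -
  have dP: "distinct P" "hd P = x" "last P = y" using xypath_P unfolding xypath_def by auto
  have "\<exists>v\<in>set P. v \<in> M" using M_ne M_A by blast
  from split_list_first_prop[OF this] obtain pre o1 R where R: "P = pre @ o1 # R" "o1 \<in> M" "\<forall>v\<in>set pre. v \<notin> M" by blast
  have "\<exists>v\<in>set (o1 # R). v \<in> M" using R(2) by simp
  from split_list_last_prop[OF this] obtain m ok ys where m: "o1 # R = m @ ok # ys" "ok \<in> M" "\<forall>v\<in>set ys. v \<notin> M" by blast
  have "pre \<noteq> []" using R dP(2) M_A[OF R(2)] unfolding I_def by auto
  then obtain pre' wf where pre: "pre = pre' @ [wf]" by (metis rev_exhaust)
  have "ys \<noteq> []"
  proof
    assume "ys = []"
    then have "last P = ok" using R(1) m(1) by simp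
    then show False using dP(3) M_A[OF m(2)] unfolding I_def by simp
  qed
  then obtain wl post where wlp: "ys = wl # post" by (cases ys) auto
  have P2: "P = pre @ m @ ok # wl # post" using R(1) m(1) wlp by simp
  have "wl \<in> nb P ok" by (rule nb_infix(2)[of P "pre @ m" ok wl post]) (use P2 in simp)
  then have wl: "wl \<in> W" using M_W[OF m(2)] by blast
  have "wf \<in> nb P o1" by (rule nb_infix(1)[of P pre' wf o1 R]) (use R(1) pre in simp)
  then have wf: "wf \<in> W" using M_W[OF R(2)] by blast
  have "post \<noteq> []"
  proof
    assume "post = []"
    then have "last P = wl" using P2 by simp
    then show False using dP(3) W_P[OF wl] unfolding I_def by simp
  qed
  obtain mid where mid: "m @ [ok] = o1 # mid" using m(1) by (cases m) auto
  have "P = pre @ (o1 # mid @ [wl]) @ post"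
  proof -
    have "P = pre @ (m @ [ok]) @ wl # post" using P2 by simp
    then show ?thesis unfolding mid by simp
  qed
  moreover have "set pre \<inter> M = {}" "set post \<inter> M = {}" using R(3) m(3) wlp by auto
  moreover have "\<exists>m. o1 # mid = m @ [ok]" using mid by metis
  ultimately show ?thesis using R(2) m(2) wl \<open>pre \<noteq> []\<close> wf pre \<open>post \<noteq> []\<close> by (metis last_snoc)
qed

definition detour_path :: "'a \<Rightarrow> 'a list" where
  "detour_path a = a # (SOME p. p \<noteq> [] \<and> hd p = th a \<and> last p = detour a \<and> distinct p \<and> successively adj p \<and> set p \<subseteq> comp (th a))"

lemma detour_path:
  assumes a: "a \<in> M"
  shows "hd (detour_path a) = a" "last (detour_path a) = detour a" "distinct (detour_path a)" "successively adj (detour_path a)"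
    "set (detour_path a) \<subseteq> insert a (comp (th a))" "2 \<le> length (detour_path a)"
proof -
  have c: "comp (th a) \<in> comps" "detour a \<in> comp (th a)" using detour_comp[OF a] by blast+
  have aI: "a \<in> I" "a \<in> set P" using M_A[OF a] by blast+
  have t: "th a \<in> comp (th a)" by (rule comp_self)
  obtain p where e: "detour_path a = a # p" and p: "p \<noteq> []" "hd p = th a" "last p = detour a" "distinct p" "successively adj p" "set p \<subseteq> comp (th a)"
    using someI_ex[OF comp_path[OF c(1) t c(2)]] unfolding detour_path_def by blast
  have "a \<notin> set p" using p(6) D_sub[OF c(1)] aI(2) by blast
  then show "hd (detour_path a) = a" "last (detour_path a) = detour a" "distinct (detour_path a)" "set (detour_path a) \<subseteq> insert a (comp (th a))" using p unfolding e by auto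
  show "successively adj (detour_path a)" using p(1,2,5) th[OF aI(1)] unfolding e by (cases p) auto
  show "2 \<le> length (detour_path a)" using p(1) unfolding e by (cases p) auto
qed

text \<open>
  A step with label \<open>[]\<close> is a step of \<open>P\<close>; a step with label \<open>[detour a]\<close> is an edge of \<open>r\<close> at \<open>detour a\<close> and
  counts as incident with \<open>a\<close>.  Where the labels \<open>i\<close> before and \<open>l\<close> after a missed vertex differ in kind, the
  two edges are joined through the component, which costs at least one more vertex.
\<close>

definition segment :: "'a \<Rightarrow> 'a list \<Rightarrow> 'a list \<Rightarrow> 'a list" where
  "segment u i l = (if u \<in> M then (if i = [] then (if l = [] then [u] else detour_path u) else (if l = [] then rev (detour_path u) else [detour u])) else [u])"

fun expand :: "'a list \<Rightarrow> 'a \<Rightarrow> ('a list \<times> 'a) list \<Rightarrow> 'a list" where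
  "expand i u [] = [u]"
| "expand i u ((l, v) # s) = segment u i l @ expand l v s"

fun unmixed :: "'a list \<Rightarrow> 'a \<Rightarrow> ('a list \<times> 'a) list \<Rightarrow> bool" where
  "unmixed i u [] = True"
| "unmixed i u ((l, v) # s) = ((u \<in> M \<longrightarrow> (i = [] \<longleftrightarrow> l = [])) \<and> unmixed l v s)"

definition swap_darts :: "('a \<times> 'a list \<times> 'a) set" where
  "swap_darts = {(u, l, v). u \<in> set P \<and> v \<in> set P \<and> ((l = [] \<and> v \<in> nb P u) \<or>
     (u \<in> M \<and> l = [detour u] \<and> v \<in> nb r (detour u)) \<or> (v \<in> M \<and> l = [detour v] \<and> u \<in> nb r (detour v)))}"

text \<open>The vertices that may stand for \<open>v\<close> in an expansion. Disjointness of cells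
  keeps expansions free of repetitions.\<close>

definition cell :: "'a \<Rightarrow> 'a set" where "cell v = (if v \<in> M then insert v (comp (th v)) else {v})"

lemma segment_props:
  assumes "u \<in> set P"
  shows "segment u i l \<noteq> []" "distinct (segment u i l)" "successively adj (segment u i l)" "set (segment u i l) \<subseteq> cell u"
    "hd (segment u i l) = (if u \<in> M \<and> i \<noteq> [] then detour u else u)" "last (segment u i l) = (if u \<in> M \<and> l \<noteq> [] then detour u else u)"
    "1 \<le> length (segment u i l)" "u \<in> M \<Longrightarrow> (i = []) \<noteq> (l = []) \<Longrightarrow> 2 \<le> length (segment u i l)"
proof -
  have "(segment u i l \<noteq> [] \<and> distinct (segment u i l) \<and> successively adj (segment u i l) \<and> set (segment u i l) \<subseteq> cell u \<and>
    hd (segment u i l) = (if u \<in> M \<and> i \<noteq> [] then detour u else u) \<and> last (segment u i l) = (if u \<in> M \<and> l \<noteq> [] then detour u else u)) \<and>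
    (u \<in> M \<and> (i = []) \<noteq> (l = []) \<longrightarrow> 2 \<le> length (segment u i l))"
  proof (cases "u \<in> M")
    case False
    then show ?thesis unfolding segment_def cell_def by simp
  next
    case True
    note p = detour_path[OF True]
    have n: "detour_path u \<noteq> []" using p(6) by auto
    have "successively (\<lambda>a b. adj b a) (detour_path u)" using p(4) adj_sym by (rule successively_mono)
    then have s: "successively adj (rev (detour_path u))" by (simp add: successively_rev)
    have d: "detour u \<in> comp (th u)" using detour_comp[OF True] by blast
    show ?thesis using True p n s d unfolding segment_def cell_def by (simp add: hd_rev last_rev)
  qed
  then show "segment u i l \<noteq> []" "distinct (segment u i l)" "successively adj (segment u i l)" "set (segment u i l) \<subseteq> cell u"
    "hd (segment u i l) = (if u \<in> M \<and> i \<noteq> [] then detour u else u)" "last (segment u i l) = (if u \<in> M \<and> l \<noteq> [] then detour u else u)"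
    "u \<in> M \<Longrightarrow> (i = []) \<noteq> (l = []) \<Longrightarrow> 2 \<le> length (segment u i l)" by blast+
  then show "1 \<le> length (segment u i l)" by (cases "segment u i l") auto
qed

lemma cell_disj: "u \<in> set P \<Longrightarrow> v \<in> set P \<Longrightarrow> u \<noteq> v \<Longrightarrow> cell u \<inter> cell v = {}"
proof -
  assume uv: "u \<in> set P" "v \<in> set P" "u \<noteq> v"
  have c: "comp (th a) \<inter> set P = {}" if "a \<in> M" for a using detour_comp[OF that] D_sub by blast
  have "comp (th u) \<inter> comp (th v) = {}" if "u \<in> M" "v \<in> M"
    using comp_inj[of u v] M_A[OF that(1)] M_A[OF that(2)] uv(3) by blast
  then show ?thesis using uv c[of u] c[of v] unfolding cell_def by auto
qed

lemma swap_darts_dart: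
  assumes "(u, l, v) \<in> swap_darts"
  shows "u \<in> set P" "v \<in> set P" "u \<noteq> v" "(v, rev l, u) \<in> swap_darts"
    "(l = [] \<and> v \<in> nb P u \<and> adj u v) \<or> (u \<in> M \<and> v \<in> W \<and> l = [detour u] \<and> adj (detour u) v) \<or> (v \<in> M \<and> u \<in> W \<and> l = [detour v] \<and> adj u (detour v))"
proof -
  show P: "u \<in> set P" "v \<in> set P" using assms unfolding swap_darts_def by auto
  show "(v, rev l, u) \<in> swap_darts" using assms nb_sym[of u P v] unfolding swap_darts_def by auto
  have c: "(l = [] \<and> v \<in> nb P u) \<or> (u \<in> M \<and> l = [detour u] \<and> v \<in> nb r (detour u)) \<or> (v \<in> M \<and> l = [detour v] \<and> u \<in> nb r (detour v))"
    using assms unfolding swap_darts_def by blast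
  then show e: "(l = [] \<and> v \<in> nb P u \<and> adj u v) \<or> (u \<in> M \<and> v \<in> W \<and> l = [detour u] \<and> adj (detour u) v) \<or> (v \<in> M \<and> u \<in> W \<and> l = [detour v] \<and> adj u (detour v))"
    using nb_adj_xypath[OF xypath_P, of v u] detour_W[of u v] detour_W[of v u] adj_sym[of "detour v" u] by blast
  show "u \<noteq> v" using e adj_irrefl[of u] W_P by blast
qed

lemma walk_swap_darts: "walk swap_darts u s \<Longrightarrow> set (map snd s) \<subseteq> set P"
proof (induction s arbitrary: u)
  case (Cons p s)
  obtain l v where p: "p = (l, v)" by force
  have "(u, l, v) \<in> swap_darts" "walk swap_darts v s" using Cons.prems p by simp_all
  then have "v \<in> set P" "set (map snd s) \<subseteq> set P" using swap_darts_dart(2)[of u l v] Cons.IH[of v] by auto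
  then show ?case using p by simp
qed simp

lemma finite_swap_darts: "finite swap_darts"
proof (rule finite_subset)
  show "swap_darts \<subseteq> set P \<times> ({[]} \<union> (\<lambda>a. [detour a]) ` set P) \<times> set P" unfolding swap_darts_def by auto
qed simp

text \<open>Each vertex of the walk expands to at least one vertex, and a missed vertex with labels
  of different kinds to at least two, since \<open>detour_path\<close> contains both
  \<open>u\<close> and \<open>detour u\<close>. So an expansion of minimal length is
  unmixed.\<close>

lemma expand_props:
  assumes "walk swap_darts u s" "distinct (u # map snd s)" "u \<in> set P" "final u s \<notin> M" "u \<in> M \<Longrightarrow> i = [] \<or> i = [detour u]"
  shows "distinct (expand i u s) \<and> successively adj (expand i u s) \<and> expand i u s \<noteq> [] \<and> hd (expand i u s) = (if u \<in> M \<and> i \<noteq> [] then detour u else u) \<and>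
    last (expand i u s) = final u s \<and> set (expand i u s) \<subseteq> (\<Union>v\<in>set (u # map snd s). cell v) \<and> set (u # map snd s) - M \<subseteq> set (expand i u s) \<and>
    Suc (length s) \<le> length (expand i u s) \<and> (length (expand i u s) = Suc (length s) \<longrightarrow> unmixed i u s)"
  using assms
proof (induction s arbitrary: u i)
  case Nil
  then show ?case unfolding cell_def by auto
next
  case (Cons p s)
  obtain l v where p: "p = (l, v)" by force
  have e: "(u, l, v) \<in> swap_darts" and w: "walk swap_darts v s" using Cons.prems(1) p by auto
  have d: "distinct (v # map snd s)" "u \<notin> set (v # map snd s)" using Cons.prems(2) p by auto
  note E = swap_darts_dart[OF e]
  have fv: "final v s \<notin> M" using Cons.prems(4) p by simp
  have iv: "l = [] \<or> l = [detour v]" if "v \<in> M"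
  proof -
    have "v \<notin> W" using that W_P by blast
    then show ?thesis using E(5) by blast
  qed
  note IH = Cons.IH[OF w d(1) E(2) fv iv]
  note q = segment_props[OF Cons.prems(3), of i l]
  have vs: "set (v # map snd s) \<subseteq> set P"
  proof -
    show ?thesis using walk_swap_darts[OF w] E(2) by auto
  qed
  have "cell u \<inter> (\<Union>v\<in>set (v # map snd s). cell v) = {}"
  proof -
    have "cell u \<inter> cell w = {}" if "w \<in> set (v # map snd s)" for w
      by (rule cell_disj[OF Cons.prems(3)]) (use that vs d(2) in blast)+
    then show ?thesis by blast
  qed
  then have dis: "set (segment u i l) \<inter> set (expand l v s) = {}" using q(4) IH by blast
  have expand: "expand i u (p # s) = segment u i l @ expand l v s" using p by simp
  have j: "adj (last (segment u i l)) (hd (expand l v s))"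
    using E(5) W_P[of u] W_P[of v] IH unfolding q(6) by auto
  have "distinct (expand i u (p # s))" unfolding expand using q(2) IH dis by simp
  moreover have "successively adj (expand i u (p # s))" unfolding expand successively_append_iff using q(3) IH j by blast
  moreover have "expand i u (p # s) \<noteq> []" "hd (expand i u (p # s)) = (if u \<in> M \<and> i \<noteq> [] then detour u else u)" unfolding expand using q(1,5) by simp_all
  moreover have "last (expand i u (p # s)) = final u (p # s)" unfolding expand using IH p by simp
  moreover have "set (expand i u (p # s)) \<subseteq> (\<Union>v\<in>set (u # map snd (p # s)). cell v)" unfolding expand using q(4) IH p by auto
  moreover have "set (u # map snd (p # s)) - M \<subseteq> set (expand i u (p # s))"
  proof -
    have "u \<in> set (segment u i l)" if "u \<notin> M" using that unfolding segment_def by simp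
    then show ?thesis unfolding expand using IH p by auto
  qed
  moreover have "Suc (length (p # s)) \<le> length (expand i u (p # s))" unfolding expand using q(7) IH by simp
  moreover have "unmixed i u (p # s)" if "length (expand i u (p # s)) = Suc (length (p # s))"
  proof -
    have l1: "length (segment u i l) + length (expand l v s) = Suc (Suc (length s))" using that unfolding expand by simp
    have l2: "Suc (length s) \<le> length (expand l v s)" using IH by blast
    have "length (segment u i l) = 1" "length (expand l v s) = Suc (length s)" using l1 l2 q(7) by linarith+
    moreover have "\<not> 2 \<le> length (segment u i l)" using calculation(1) by simp
    ultimately show ?thesis using IH q(8) p by auto
  qed
  ultimately show ?case by blast
qed

text \<open>Without mixing, \<open>a\<close> expands to \<open>[a]\<close> or
  \<open>[detour a]\<close>, and the expansions of other vertices stay out of its cell.\<close>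

lemma unmixed_piece:
  assumes "unmixed i u s" "distinct (u # map snd s)" "set (u # map snd s) \<subseteq> set P" "final u s \<notin> M" "a \<in> M" "a \<in> set (u # map snd s)"
  shows "set (expand i u s) \<inter> cell a = {a} \<or> set (expand i u s) \<inter> cell a = {detour a}"
  using assms
proof (induction s arbitrary: u i)
  case (Cons p s)
  obtain l v where p: "p = (l, v)" by force
  have expand: "expand i u (p # s) = segment u i l @ expand l v s" using p by simp
  have sub: "set (expand l v s) \<subseteq> (\<Union>w\<in>set (v # map snd s). cell w)"
  proof -
    have "set (w # map snd t) \<subseteq> set P \<Longrightarrow> set (expand i w t) \<subseteq> (\<Union>w\<in>set (w # map snd t). cell w)" for i w t
    proof (induction t arbitrary: i w)
      case Nil then show ?case unfolding cell_def by auto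
    next
      case (Cons q t)
      obtain l' v' where q: "q = (l', v')" by force
      have "set (expand l' v' t) \<subseteq> (\<Union>w\<in>set (v' # map snd t). cell w)" using Cons q by simp
      moreover have "set (segment w i l') \<subseteq> cell w" using segment_props(4)[of w i l'] Cons.prems by simp
      ultimately show ?case using q by auto
    qed
    then show ?thesis using Cons.prems(3) p by simp
  qed
  show ?case
  proof (cases "a = u")
    case True
    have "cell w \<inter> cell u = {}" if "w \<in> set (v # map snd s)" for w
      by (rule cell_disj) (use that Cons.prems(2,3) p in auto)
    then have "set (expand l v s) \<inter> cell u = {}" using sub by blast
    moreover have "set (segment u i l) = {u} \<or> set (segment u i l) = {detour u}" using Cons.prems(1,5) True p unfolding segment_def by auto
    moreover have "u \<in> cell u" "detour u \<in> cell u" using detour_comp[of u] Cons.prems(5) True unfolding cell_def by auto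
    ultimately show ?thesis unfolding expand True by auto
  next
    case False
    have "cell u \<inter> cell a = {}" by (rule cell_disj) (use False Cons.prems in auto)
    moreover have "set (segment u i l) \<subseteq> cell u" using segment_props(4)[of u i l] Cons.prems(3) by simp
    ultimately have "set (segment u i l) \<inter> cell a = {}" by blast
    moreover have "set (expand l v s) \<inter> cell a = {a} \<or> set (expand l v s) \<inter> cell a = {detour a}"
      by (rule Cons.IH) (use Cons.prems False p in auto)
    ultimately show ?thesis unfolding expand by auto
  qed
qed auto

text \<open>The first step with a nonempty label would lead from a vertex outside \<open>M\<close>
  into a missed \<open>v\<close>; being unmixed, the walk would continue through
  \<open>detour v\<close>, which lies off \<open>P\<close>.\<close>

lemma unmixed_plain:
  assumes "unmixed i u s" "walk swap_darts u s" "final u s \<notin> M" "set (expand i u s) \<subseteq> set P" "u \<in> M \<Longrightarrow> i = []"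
  shows "s = map (\<lambda>v. ([], v)) (map snd s) \<and> expand i u s = u # map snd s"
  using assms
proof (induction s arbitrary: u i)
  case (Cons p s)
  obtain l v where p: "p = (l, v)" by force
  have e: "(u, l, v) \<in> swap_darts" using Cons.prems(2) p by simp
  have expand: "expand i u (p # s) = segment u i l @ expand l v s" using p by simp
  have ddP: "detour a \<notin> set P" if "a \<in> M" for a using detour_comp[OF that] by blast
  have "l = []"
  proof (rule ccontr)
    assume n: "l \<noteq> []"
    then have "u \<notin> M" using Cons.prems(1,5) p by auto
    then have v: "v \<in> M" using swap_darts_dart(5)[OF e] n by blast
    show False
    proof (cases s)
      case Nil
      then show False using v Cons.prems(3) p by simp
    next
      case (Cons q t)
      obtain l2 v2 where q: "q = (l2, v2)" by force
      have "l2 \<noteq> []" using Cons.prems(1) p Cons q n v by simp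
      then have "detour v \<in> set (expand l v s)" using Cons q n v by (simp add: segment_def)
      then show False using ddP[OF v] Cons.prems(4) unfolding expand by auto
    qed
  qed
  moreover have "segment u i l = [u]" using Cons.prems(5) \<open>l = []\<close> unfolding segment_def by simp
  moreover have "s = map (\<lambda>v. ([], v)) (map snd s) \<and> expand l v s = v # map snd s"
    by (rule Cons.IH) (use Cons.prems p \<open>l = []\<close> in auto)
  ultimately show ?case using p expand by simp
qed simp

end

section \<open>The lollipop argument on the core\<close>

lemma edg_source: "(a, l, b) \<in> edg u s \<Longrightarrow> a \<in> set (u # map snd s)"
  by (induction u s rule: edg.induct) auto

lemma edg_unique:
  "distinct (u # map snd s) \<Longrightarrow> (a, l, b) \<in> edg u s \<Longrightarrow> (a, l', b') \<in> edg u s \<Longrightarrow> l = l' \<and> b = b'"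
proof (induction u s rule: edg.induct)
  case (2 u m v s)
  have d: "distinct (v # map snd s)" "u \<notin> set (v # map snd s)" using 2(2) by auto
  have "(a, k, c) = (u, m, v) \<or> ((a, k, c) \<in> edg v s \<and> a \<noteq> u)" if "(a, k, c) \<in> edg u ((m, v) # s)" for k c
  proof (cases "(a, k, c) = (u, m, v)")
    case False
    then have "(a, k, c) \<in> edg v s" using that by auto
    then show ?thesis using edg_source[of a k c v s] d(2) by blast
  qed simp
  from this[OF 2(3)] this[OF 2(4)] show ?case using 2(1)[OF d(1)] by blast
qed simp

lemma walk_mono: "walk E u s \<Longrightarrow> E \<subseteq> F \<Longrightarrow> walk F u s"
  by (induction u s rule: final.induct) auto

lemma walk_plain:
  "(\<And>\<alpha> a b \<beta>. u # vs = \<alpha> @ a # b # \<beta> \<Longrightarrow> (a, [], b) \<in> E) \<Longrightarrow> walk E u (map (\<lambda>v. ([], v)) vs)"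
proof (induction vs arbitrary: u)
  case (Cons v vs)
  have "(u, [], v) \<in> E" by (rule Cons.prems[of "[]" u v vs]) simp
  moreover have "walk E v (map (\<lambda>v. ([], v)) vs)"
    by (rule Cons.IH) (rule Cons.prems[of "u # _"], simp)
  ultimately show ?case by simp
qed simp

lemma edg_plain: "u # vs = \<alpha> @ a # b # \<beta> \<Longrightarrow> (a, [], b) \<in> edg u (map (\<lambda>v. ([], v)) vs)"
proof (induction vs arbitrary: u \<alpha>)
  case (Cons v vs)
  show ?case
  proof (cases \<alpha>)
    case Nil
    then show ?thesis using Cons.prems by simp
  next
    case \<alpha>: (Cons c \<alpha>')
    then have "v # vs = \<alpha>' @ a # b # \<beta>" using Cons.prems by simp
    from Cons.IH[OF this] show ?thesis by simp
  qed
qed simp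

lemma map_snd_plain: "map snd (map (\<lambda>v. (l, v)) vs) = vs"
  by (induction vs) simp_all

lemma infix_middle:
  assumes d: "distinct (pre @ c @ post)" and e: "pre @ c @ post = \<alpha> @ a # b # \<beta>" and ab: "a \<in> set c" "b \<in> set c"
  shows "\<exists>\<gamma> \<delta>. c = \<gamma> @ a # b # \<delta>"
proof -
  obtain \<gamma> \<delta> where c: "c = \<gamma> @ a # \<delta>" using ab(1) by (meson split_list)
  have "pre @ c @ post = (pre @ \<gamma>) @ a # (\<delta> @ post)" using c by simp
  from split_unique[OF d this e] have p: "\<delta> @ post = b # \<beta>" by blast
  have "\<delta> \<noteq> []"
  proof
    assume "\<delta> = []"
    then have "b \<in> set post" using p by simp
    then show False using d ab(2) by auto
  qed
  then have "\<delta> = b # tl \<delta>" using p by (cases \<delta>) auto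
  then show ?thesis using c by metis
qed

locale core = swap +
  fixes pre :: "'a list" and o1 :: 'a and mid :: "'a list" and wl :: 'a and post :: "'a list"
  assumes P_core: "P = pre @ (o1 # mid @ [wl]) @ post" and o1: "o1 \<in> M" and ok: "\<exists>m ok. o1 # mid = m @ [ok] \<and> ok \<in> M"
    and pre: "set pre \<inter> M = {}" "pre \<noteq> []" "last pre \<in> W" and wl: "wl \<in> W" and post: "set post \<inter> M = {}" "post \<noteq> []"
begin

definition K :: "'a set" where "K = set (o1 # mid @ [wl])"

definition core_darts :: "('a \<times> 'a list \<times> 'a) set" where "core_darts = {(u, l, v) \<in> swap_darts. u \<in> K \<and> v \<in> K}"

text \<open>
  Edges of \<open>P\<close> between vertices that are not missed have to be used, so rotations only happen at
  missed vertices.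
\<close>

definition forced :: "('a list \<times> 'a) list \<Rightarrow> bool" where
  "forced s \<longleftrightarrow> (\<forall>u\<in>K - M. \<forall>v\<in>K - M. v \<in> nb P u \<longrightarrow> (u, [], v) \<in> edg o1 s \<or> (v, [], u) \<in> edg o1 s)"

text \<open>The end is kept in \<open>W\<close> because \<open>degree_W\<close> determines the
  number of darts there.\<close>

definition core_walks :: "('a list \<times> 'a) list set" where
  "core_walks = {s. walk core_darts o1 s \<and> distinct (o1 # map snd s) \<and> set (map snd s) = K - {o1} \<and> final o1 s \<in> W \<and> forced s}"

lemma distinct_P: "distinct P" using xypath_P unfolding xypath_def by simp

lemma K_P: "K \<subseteq> set P" unfolding K_def by (subst P_core) auto

lemma o1K: "o1 \<in> K" unfolding K_def by simp

lemma set_P: "set P = set pre \<union> K \<union> set post"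
  unfolding K_def using arg_cong[OF P_core, of set] by simp blast

lemma M_K: "M \<subseteq> K"
proof
  fix a assume "a \<in> M"
  then show "a \<in> K" using M_A[of a] set_P pre(1) post(1) by blast
qed

lemma pre_post_K: "set pre \<inter> K = {}" "set post \<inter> K = {}"
proof -
  have "distinct (pre @ (o1 # mid @ [wl]) @ post)" using distinct_P P_core by simp
  then show "set pre \<inter> K = {}" "set post \<inter> K = {}" unfolding K_def by auto
qed

lemma core_darts_dart:
  assumes "(u, l, v) \<in> core_darts"
  shows "(u, l, v) \<in> swap_darts" "u \<in> K" "v \<in> K" "(v, rev l, u) \<in> core_darts" "u \<noteq> v"
  using assms swap_darts_dart(3,4)[of u l v] unfolding core_darts_def by blast+

lemma core_darts_swap_darts: "core_darts \<subseteq> swap_darts" unfolding core_darts_def by blast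

lemma finite_core_darts: "finite core_darts" by (rule finite_subset[OF core_darts_swap_darts finite_swap_darts])

lemma finite_core_walks: "finite core_walks"
  by (rule finite_subset[OF _ finite_walks[OF finite_core_darts, of o1]]) (auto simp: core_walks_def)

text \<open>The dart of the rotation leads to a missed vertex: otherwise it is a forced edge of
  \<open>P\<close> at the end of the walk, hence the last step itself, which is excluded. So the new
  end was joined to a missed vertex and lies in \<open>W\<close>, and the dropped edge, being
  incident with a missed vertex, is not a forced one.\<close>

lemma core_walks_rot: "rot_closed core_darts o1 core_walks"
  unfolding rot_closed_def
proof (intro allI impI)
  fix \<alpha> l' v' \<beta> l
  assume s: "\<alpha> @ (l', v') # \<beta> \<in> core_walks" and e: "(final v' \<beta>, l, final o1 \<alpha>) \<in> core_darts" and ne: "\<beta> = [] \<longrightarrow> l \<noteq> rev l'"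
  let ?s = "\<alpha> @ (l', v') # \<beta>" and ?w = "final v' \<beta>" and ?z = "final o1 \<alpha>"
  let ?t = "\<alpha> @ (rev l, ?w) # revs v' \<beta>"
  have h: "walk core_darts o1 ?s" "distinct (o1 # map snd ?s)" "set (map snd ?s) = K - {o1}" "final o1 ?s \<in> W" "forced ?s"
    using s unfolding core_walks_def by blast+
  have fs: "final o1 ?s = ?w" by (simp add: final_append)
  have wW: "?w \<in> W" using h(4) unfolding fs .
  have w: "walk core_darts o1 \<alpha>" "(?z, l', v') \<in> core_darts" "walk core_darts v' \<beta>" using h(1) by (simp_all add: walk_append)
  have E_s: "edg o1 ?s = edg o1 \<alpha> \<union> insert (?z, l', v') (edg v' \<beta>)" by (simp add: edg_append)
  have zM: "?z \<in> M"
  proof (rule ccontr)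
    assume z: "?z \<notin> M"
    have "l = [] \<and> ?z \<in> nb P ?w" using swap_darts_dart(5)[OF core_darts_dart(1)[OF e]] z W_P[OF wW] by blast
    moreover have "?w \<in> K - M" "?z \<in> K - M" using core_darts_dart(2,3)[OF e] z W_P[OF wW] by blast+
    ultimately have "l = []" "(?w, [], ?z) \<in> edg o1 ?s \<or> (?z, [], ?w) \<in> edg o1 ?s" using h(5) unfolding forced_def by blast+
    moreover have "(?w, [], ?z) \<notin> edg o1 ?s" using edg_final(1)[OF h(2), of ?w "[]" ?z] fs by metis
    ultimately have "(?z, [], ?w) \<in> edg o1 ?s" by blast
    moreover have "(?z, l', v') \<in> edg o1 ?s" unfolding E_s by blast
    ultimately have lv: "l' = []" "?w = v'" using edg_unique[OF h(2)] by blast+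
    have "\<beta> = []"
    proof (rule ccontr)
      assume "\<beta> \<noteq> []"
      then obtain \<beta>' l2 v2 where b: "\<beta> = \<beta>' @ [(l2, v2)]" by (metis rev_exhaust surj_pair)
      then have "v2 = v'" using lv(2) by (simp add: final_append)
      then show False using h(2) b by simp
    qed
    then show False using ne lv(1) \<open>l = []\<close> by simp
  qed
  have vs: "map snd ?t = map snd \<alpha> @ rev (v' # map snd \<beta>)" using vertices_revs[of v' \<beta>] by simp
  have "walk core_darts o1 ?t" using w(1) core_darts_dart(4)[OF e] walk_revs[OF core_darts_dart(4) w(3)] by (simp add: walk_append)
  moreover have "distinct (o1 # map snd ?t)" using h(2) unfolding vs by auto
  moreover have "set (map snd ?t) = K - {o1}" unfolding vs using h(3) by auto
  moreover have "final o1 ?t \<in> W"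
  proof -
    have "v' \<in> W" using swap_darts_dart(5)[OF core_darts_dart(1)[OF w(2)]] zM M_W[of ?z v'] W_P[of ?z] by blast
    then show ?thesis by (simp add: final_append final_revs)
  qed
  moreover have "forced ?t"
  proof -
    have E_t: "edg o1 ?t = edg o1 \<alpha> \<union> insert (?z, rev l, ?w) (edg ?w (revs v' \<beta>))" by (simp add: edg_append)
    have "(u, [], v) \<in> edg o1 ?t \<or> (v, [], u) \<in> edg o1 ?t" if "(u, [], v) \<in> edg o1 ?s" "u \<notin> M" for u v
    proof -
      have "(u, [], v) \<in> edg o1 \<alpha> \<or> (u, [], v) \<in> edg v' \<beta>" using that zM unfolding E_s by blast
      then show ?thesis using edg_revs[of u "[]" v v' \<beta>] unfolding E_t by auto
    qed
    then show ?thesis using h(5) unfolding forced_def by blast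
  qed
  ultimately show "?t \<in> core_walks" unfolding core_walks_def by blast
qed

lemma core_infix: "u \<in> K \<Longrightarrow> v \<in> K \<Longrightarrow> v \<in> nb P u \<Longrightarrow> \<exists>\<gamma> \<delta>. o1 # mid @ [wl] = \<gamma> @ u # v # \<delta> \<or> o1 # mid @ [wl] = \<gamma> @ v # u # \<delta>"
proof -
  assume uv: "u \<in> K" "v \<in> K" "v \<in> nb P u"
  have d: "distinct (pre @ (o1 # mid @ [wl]) @ post)" using distinct_P P_core by simp
  obtain \<alpha> \<beta> where "P = \<alpha> @ v # u # \<beta> \<or> P = \<alpha> @ u # v # \<beta>" using uv(3) unfolding nb_def by auto
  then show ?thesis
  proof
    assume "P = \<alpha> @ v # u # \<beta>"
    then have "pre @ (o1 # mid @ [wl]) @ post = \<alpha> @ v # u # \<beta>" using P_core by simp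
    from infix_middle[OF d this] show ?thesis using uv(1,2) unfolding K_def by blast
  next
    assume "P = \<alpha> @ u # v # \<beta>"
    then have "pre @ (o1 # mid @ [wl]) @ post = \<alpha> @ u # v # \<beta>" using P_core by simp
    from infix_middle[OF d this] show ?thesis using uv(1,2) unfolding K_def by blast
  qed
qed

lemma nb_mid: "v \<in> set mid \<Longrightarrow> nb P v \<subseteq> K"
proof -
  assume "v \<in> set mid"
  then obtain m1 m2 where m: "mid = m1 @ v # m2" by (meson split_list)
  obtain b p where b: "o1 # m1 = b @ [p]" by (metis list.distinct(1) rev_exhaust)
  obtain q c where q: "m2 @ [wl] = q # c" by (cases m2) auto
  have core: "o1 # mid @ [wl] = (b @ [p]) @ v # (q # c)" unfolding b[symmetric] q[symmetric] m by simp
  then have "P = pre @ ((b @ [p]) @ v # (q # c)) @ post" using P_core by simp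
  then have "P = (pre @ b) @ [p, v, q] @ (c @ post)" by simp
  from nb_eq[OF distinct_P this] have "nb P v = {p, q}" .
  moreover have "p \<in> K" "q \<in> K" unfolding K_def core by auto
  ultimately show ?thesis by simp
qed

lemma nb_wl: "\<exists>ok\<in>M. nb P wl = {ok, hd post}"
proof -
  obtain m ok where m: "o1 # mid = m @ [ok]" "ok \<in> M" using ok by blast
  obtain q c where q: "post = q # c" using post(2) by (cases post) auto
  have "P = pre @ (o1 # mid) @ [wl] @ post" using P_core by simp
  then have "P = (pre @ m) @ [ok, wl, q] @ c" unfolding m(1) q by simp
  from nb_eq[OF distinct_P this] show ?thesis using m(2) q by auto
qed

text \<open>There are two darts to path neighbours and one through the detour given by
  \<open>W_d\<close>; at \<open>wl\<close> the path neighbour in \<open>post\<close> is outside the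
  core.\<close>

lemma degree_W:
  assumes w: "w \<in> W" "w \<in> K"
  shows "card {(l, z). (w, l, z) \<in> core_darts} = (if w = wl then 2 else 3)"
proof -
  obtain a where a: "nb P w \<inter> M = {a}" using W_o[OF w(1)] by blast
  obtain b where b: "{b \<in> M. w \<in> nb r (detour b)} = {b}" using W_d[OF w(1)] by blast
  have aM: "a \<in> M" "a \<in> nb P w" "b \<in> M" "w \<in> nb r (detour b)" using a b by auto
  have abK: "a \<in> K" "b \<in> K" using aM M_K by blast+
  have wI: "w \<in> I" "w \<notin> M" "w \<in> set P" using W_P[OF w(1)] by blast+
  have eq: "{(l, z). (w, l, z) \<in> core_darts} = insert ([detour b], b) ((\<lambda>z. ([], z)) ` (nb P w \<inter> K))"
  proof -
    have "(w, l, z) \<in> core_darts \<longleftrightarrow> (l = [detour b] \<and> z = b) \<or> (l = [] \<and> z \<in> nb P w \<inter> K)" for l z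
    proof -
      have "(w, l, z) \<in> core_darts \<longleftrightarrow> z \<in> K \<and> ((l = [] \<and> z \<in> nb P w) \<or> (z \<in> M \<and> l = [detour z] \<and> w \<in> nb r (detour z)))"
        unfolding core_darts_def swap_darts_def using wI(2,3) w(2) K_P by auto
      moreover have "z \<in> M \<and> w \<in> nb r (detour z) \<longleftrightarrow> z = b" using b by blast
      ultimately show ?thesis using abK(2) by blast
    qed
    then show ?thesis by auto
  qed
  have c2: "card (nb P w) = 2" "finite (nb P w)" using nbrs_I(3,4)[OF wI(1)] by blast+
  have "card (nb P w \<inter> K) = (if w = wl then 1 else 2)"
  proof (cases "w = wl")
    case True
    obtain ok where ok: "ok \<in> M" "nb P wl = {ok, hd post}" using nb_wl by blast
    have "hd post \<notin> K" using pre_post_K(2) post(2) by (meson disjoint_iff hd_in_set)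
    then have "nb P w \<inter> K = {ok}" using ok M_K unfolding True by blast
    then show ?thesis using True by simp
  next
    case False
    then have "w \<in> set mid" using w(2) wI(2) o1 unfolding K_def by auto
    then have "nb P w \<inter> K = nb P w" using nb_mid by blast
    then show ?thesis using c2 False by simp
  qed
  moreover have "card ((\<lambda>z. ([] :: 'a list, z)) ` (nb P w \<inter> K)) = card (nb P w \<inter> K)"
    by (rule card_image) (simp add: inj_on_def)
  moreover have "([detour b], b) \<notin> (\<lambda>z. ([], z)) ` (nb P w \<inter> K)" by auto
  moreover have "finite ((\<lambda>z. ([] :: 'a list, z)) ` (nb P w \<inter> K))" using c2(2) by simp
  ultimately show ?thesis unfolding eq by simp
qed

text \<open>All darts at the end stay in the core, which the walk covers, so a walk has two
  rotations, or one if it ends in \<open>wl\<close>. By \<open>lollipop\<close> the walks with a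
  single rotation are even in number.\<close>

lemma even_core_walks: "even (card {s \<in> core_walks. final o1 s = wl})"
proof -
  let ?f = "\<lambda>s. card {(l, z). (final o1 s, l, z) \<in> core_darts \<and> z \<in> insert o1 (set (map snd s))} - 1"
  have f: "?f s = (if final o1 s = wl then 1 else 2)" if s: "s \<in> core_walks" for s
  proof -
    have h: "set (map snd s) = K - {o1}" "final o1 s \<in> W" using s unfolding core_walks_def by blast+
    have K: "insert o1 (set (map snd s)) = K" unfolding h(1) using o1K by blast
    then have "final o1 s \<in> K" using final_in[of o1 s] by blast
    then have "card {(l, z). (final o1 s, l, z) \<in> core_darts} = (if final o1 s = wl then 2 else 3)" by (rule degree_W[OF h(2)])
    moreover have "{(l, z). (final o1 s, l, z) \<in> core_darts \<and> z \<in> K} = {(l, z). (final o1 s, l, z) \<in> core_darts}" unfolding core_darts_def by blast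
    ultimately show ?thesis unfolding K by simp
  qed
  have "even (\<Sum>s\<in>core_walks. ?f s)"
  proof (rule lollipop[OF core_darts_dart(4) core_darts_dart(5) finite_core_darts finite_core_walks _ core_walks_rot])
    fix s assume "s \<in> core_walks"
    then have h: "walk core_darts o1 s" "distinct (o1 # map snd s)" "final o1 s \<in> W" unfolding core_walks_def by blast+
    then have "s \<noteq> []" using o1 W_P[of o1] by auto
    then show "walk core_darts o1 s \<and> s \<noteq> [] \<and> distinct (o1 # map snd s)" using h by blast
  qed
  moreover have "(\<Sum>s\<in>core_walks. ?f s) = (\<Sum>s\<in>core_walks. if final o1 s = wl then 1 else 2)" by (rule sum.cong[OF refl f])
  moreover have "\<dots> = card {s \<in> core_walks. final o1 s = wl} + 2 * card {s \<in> core_walks. final o1 s \<noteq> wl}"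
    using finite_core_walks by (simp add: sum.If_cases Int_def)
  ultimately show ?thesis by simp
qed

lemma plain_core_walks: "map (\<lambda>v. ([], v)) (mid @ [wl]) \<in> core_walks"
proof -
  let ?s = "map (\<lambda>v. ([], v)) (mid @ [wl]) :: ('a list \<times> 'a) list"
  have dc: "distinct (o1 # mid @ [wl])" using distinct_P P_core by simp
  have "walk core_darts o1 ?s"
  proof (rule walk_plain)
    fix \<alpha> a b \<beta> assume e: "o1 # mid @ [wl] = \<alpha> @ a # b # \<beta>"
    have ab: "a \<in> K" "b \<in> K" unfolding K_def e by auto
    have "P = (pre @ \<alpha>) @ a # b # (\<beta> @ post)" using P_core e by simp
    from nb_infix(2)[OF this] show "(a, [], b) \<in> core_darts" using ab K_P unfolding core_darts_def swap_darts_def by blast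
  qed
  moreover have "distinct (o1 # map snd ?s)" unfolding map_snd_plain by (rule dc)
  moreover have "set (map snd ?s) = K - {o1}" unfolding map_snd_plain K_def using dc by auto
  moreover have "final o1 ?s \<in> W" using wl by (simp add: final_append)
  moreover have "forced ?s"
    unfolding forced_def
  proof (intro ballI impI)
    fix u v assume uv: "u \<in> K - M" "v \<in> K - M" "v \<in> nb P u"
    then obtain \<gamma> \<delta> where "o1 # mid @ [wl] = \<gamma> @ u # v # \<delta> \<or> o1 # mid @ [wl] = \<gamma> @ v # u # \<delta>" using core_infix by blast
    then show "(u, [], v) \<in> edg o1 ?s \<or> (v, [], u) \<in> edg o1 ?s" using edg_plain by metis
  qed
  ultimately show ?thesis unfolding core_walks_def by blast
qed

lemma other_walk: "\<exists>s\<in>core_walks. final o1 s = wl \<and> s \<noteq> map (\<lambda>v. ([], v)) (mid @ [wl])"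
proof (rule ccontr)
  let ?s = "map (\<lambda>v. ([], v)) (mid @ [wl]) :: ('a list \<times> 'a) list"
  assume n: "\<not> ?thesis"
  have "final o1 ?s = wl" by (simp add: final_append)
  then have "{s \<in> core_walks. final o1 s = wl} = {?s}" using n plain_core_walks by blast
  then show False using even_core_walks by simp
qed

lemma cell_P: "v \<in> set P \<Longrightarrow> cell v \<inter> set P = {v}"
proof -
  assume v: "v \<in> set P"
  have "comp (th v) \<inter> set P = {}" if "v \<in> M" using detour_comp[OF that] D_sub by blast
  then show ?thesis using v unfolding cell_def by auto
qed

text \<open>A mixed vertex would make the expanded path longer than \<open>P\<close>, whereas
  \<open>equality_case\<close> gives every covering path the length of \<open>P\<close>. The label
  in front of \<open>o1\<close> is \<open>[]\<close> because \<open>pre\<close> enters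
  \<open>o1\<close> along \<open>P\<close>, so \<open>o1\<close> itself stays on the path.\<close>

lemma lifted:
  assumes s: "s \<in> core_walks" "final o1 s = wl"
  defines "L \<equiv> expand [] o1 s"
  defines "R \<equiv> pre @ L @ post"
  shows "R \<in> covering" "unmixed [] o1 s" "set L \<subseteq> (\<Union>v\<in>K. cell v)" "K - M \<subseteq> set L" "o1 \<in> set L"
proof -
  have h: "walk core_darts o1 s" "distinct (o1 # map snd s)" "set (map snd s) = K - {o1}" using s unfolding core_walks_def by blast+
  have K: "set (o1 # map snd s) = K" using h(3) o1K by auto
  have fM: "final o1 s \<notin> M" using s(2) W_P[OF wl] by simp
  have oP: "o1 \<in> set P" using o1K K_P by blast
  have LP: "distinct L \<and> successively adj L \<and> L \<noteq> [] \<and> hd L = (if o1 \<in> M \<and> [] \<noteq> ([] :: 'a list) then detour o1 else o1) \<and>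
    last L = final o1 s \<and> set L \<subseteq> (\<Union>v\<in>set (o1 # map snd s). cell v) \<and> set (o1 # map snd s) - M \<subseteq> set L \<and>
    Suc (length s) \<le> length L \<and> (length L = Suc (length s) \<longrightarrow> unmixed [] o1 s)"
    unfolding L_def by (rule expand_props[OF walk_mono[OF h(1) core_darts_swap_darts] h(2) oP fM]) blast
  then have L: "distinct L" "successively adj L" "L \<noteq> []" "hd L = o1" "last L = wl" "length L = Suc (length s) \<longrightarrow> unmixed [] o1 s"
    using s(2) by simp_all
  show bkL: "set L \<subseteq> (\<Union>v\<in>K. cell v)" and KM: "K - M \<subseteq> set L" using LP unfolding K by blast+
  show "o1 \<in> set L" using L(3,4) hd_in_set by blast
  have LPK: "set L \<inter> set P \<subseteq> K"
  proof
    fix d assume d: "d \<in> set L \<inter> set P"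
    then obtain v where v: "v \<in> K" "d \<in> cell v" using bkL by blast
    then have "d = v" using cell_P[of v] K_P d by blast
    then show "d \<in> K" using v(1) by simp
  qed
  have P0: "distinct P" "successively adj P" "hd P = x" "last P = y" using xypath_P unfolding xypath_def by blast+
  have dR: "distinct R"
  proof -
    have "distinct pre" "distinct post" "set pre \<inter> set post = {}" using P0(1) P_core by auto
    moreover have "set pre \<inter> set L = {}" "set post \<inter> set L = {}" using LPK pre_post_K set_P by blast+
    ultimately show ?thesis unfolding R_def using L(1) by auto
  qed
  have sR: "successively adj R"
  proof -
    have sP: "successively adj (pre @ (o1 # mid @ [wl]) @ post)" using P0(2) P_core by simp
    have "successively adj pre" "adj (last pre) o1" using sP pre(2) unfolding successively_append_iff by auto
    moreover have "successively adj post" "adj wl (hd post)"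
    proof -
      have "pre @ (o1 # mid @ [wl]) @ post = (pre @ o1 # mid @ [wl]) @ post" by simp
      then have "successively adj ((pre @ o1 # mid @ [wl]) @ post)" using sP by simp
      then show "successively adj post" "adj wl (hd post)" using post(2) unfolding successively_append_iff by simp_all
    qed
    ultimately show ?thesis unfolding R_def successively_append_iff using L(2,3,4,5) by simp
  qed
  have "hd R = x" "last R = y" using P0(3,4) pre(2) post(2) P_core unfolding R_def by auto
  then have "xypath R" unfolding xypath_def using dR sR pre(2) by (simp add: R_def)
  moreover have "V0 \<subseteq> set R"
  proof
    fix v assume "v \<in> V0"
    then have "v \<in> set P" "v \<notin> M" using V0_P[of v] M_A[of v] by blast+
    then show "v \<in> set R" using set_P KM unfolding R_def by auto
  qed
  ultimately show "R \<in> covering" unfolding covering_def by blast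
  then have "length R = length P" by (rule equality_case(4))
  then have "length L = length (o1 # mid @ [wl])" unfolding R_def by (subst (asm) P_core) simp
  moreover have "length (o1 # map snd s) = length (o1 # mid @ [wl])"
  proof -
    have "distinct (o1 # mid @ [wl])" using P0(1) P_core by simp
    then have "length (o1 # mid @ [wl]) = card K" unfolding K_def by (rule distinct_card[symmetric])
    moreover have "length (o1 # map snd s) = card K" unfolding K[symmetric] by (rule distinct_card[OF h(2), symmetric])
    ultimately show ?thesis by simp
  qed
  ultimately show "unmixed [] o1 s" using L(6) by simp
qed

lemma core_False: False
proof -
  obtain s where s: "s \<in> core_walks" "final o1 s = wl" "s \<noteq> map (\<lambda>v. ([], v)) (mid @ [wl])" using other_walk by blast
  define L where "L = expand [] o1 s"
  define R where "R = pre @ L @ post"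
  note l = lifted[OF s(1,2), folded L_def, folded R_def]
  have h: "walk core_darts o1 s" "distinct (o1 # map snd s)" "set (map snd s) = K - {o1}" using s(1) unfolding core_walks_def by blast+
  have K: "set (o1 # map snd s) = K" using h(3) o1K by auto
  have fM: "final o1 s \<notin> M" using s(2) W_P[OF wl] by simp
  have oP: "o1 \<in> set P" using o1K K_P by blast
  have off_R: "\<exists>v\<in>M. d \<in> comp (th v)" if d: "d \<in> set R" "d \<notin> set P" for d
  proof -
    have "d \<in> set L" using d set_P unfolding R_def by auto
    then obtain v where v: "v \<in> K" "d \<in> cell v" using l(3) by blast
    have "d \<noteq> v" using v(1) d(2) K_P by blast
    then show ?thesis using v(2) unfolding cell_def by (auto split: if_splits)
  qed
  have cP: "comp (th a) \<inter> set P = {}" if "a \<in> A" for a using A_cl(1)[OF that] D_sub by blast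
  have piece: "set R \<inter> cell a = {a} \<or> set R \<inter> cell a = {detour a}" if a: "a \<in> M" for a
  proof -
    have aK: "a \<in> K" using a M_K by blast
    have "set L \<inter> cell a = {a} \<or> set L \<inter> cell a = {detour a}"
    proof -
      have "set (o1 # map snd s) \<subseteq> set P" "a \<in> set (o1 # map snd s)" unfolding K using K_P aK by blast+
      then show ?thesis unfolding L_def by (intro unmixed_piece[OF l(2) h(2) _ fM a])
    qed
    moreover have "set pre \<inter> cell a = {}" "set post \<inter> cell a = {}"
    proof -
      have "cell a \<inter> set P = {a}" by (rule cell_P) (use aK K_P in blast)
      moreover have "a \<notin> set pre" "a \<notin> set post" using aK pre_post_K by blast+
      moreover have "set pre \<subseteq> set P" "set post \<subseteq> set P" using set_P by blast+
      ultimately show "set pre \<inter> cell a = {}" "set post \<inter> cell a = {}" by auto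
    qed
    ultimately show ?thesis unfolding R_def by auto
  qed
  have pieces: "(a \<in> set R \<and> comp (th a) \<inter> set R = {}) \<or> (a \<notin> set R \<and> comp (th a) \<inter> set R = {detour a})" if a: "a \<in> M" for a
  proof -
    have aA: "a \<in> A" "a \<in> set P" using M_A[OF a] by blast+
    have b: "cell a = insert a (comp (th a))" using a unfolding cell_def by simp
    have dc: "detour a \<in> comp (th a)" using detour_comp[OF a] by (elim conjE)
    have c0: "comp (th a) \<inter> set P = {}" by (rule cP[OF aA(1)])
    have n: "a \<notin> comp (th a)" using c0 aA(2) by auto
    then have n2: "detour a \<noteq> a" using dc by auto
    show ?thesis
    proof (cases "a \<in> set R")
      case True
      then have "set R \<inter> insert a (comp (th a)) = {a}" using piece[OF a] n2 unfolding b by auto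
      then show ?thesis using True n by auto
    next
      case False
      then have "set R \<inter> insert a (comp (th a)) = {detour a}" using piece[OF a] unfolding b by auto
      then show ?thesis using False by auto
    qed
  qed
  have nonM: "a \<in> set R \<and> comp (th a) \<inter> set R = {}" if a: "a \<in> A" "a \<notin> M" for a
  proof
    have "a \<in> set P" using A_P[OF a(1)] by blast
    then show "a \<in> set R" using set_P l(4) a(2) unfolding R_def by auto
    show "comp (th a) \<inter> set R = {}"
    proof (rule ccontr)
      assume "comp (th a) \<inter> set R \<noteq> {}"
      then obtain d where d: "d \<in> comp (th a)" "d \<in> set R" by blast
      then obtain v where "v \<in> M" "d \<in> comp (th v)" using off_R[of d] cP[OF a(1)] by blast
      then show False using comp_inj[OF a(1) _ d(1), of v] M_A a(2) by blast
    qed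
  qed
  have "good R"
    unfolding good_def
  proof (intro conjI ballI)
    fix a assume "a \<in> A"
    then show "(a \<in> set R \<and> comp (th a) \<inter> set R = {}) \<or> (a \<notin> set R \<and> (\<exists>d. comp (th a) \<inter> set R = {d}))"
      using nonM[of a] pieces[of a] by blast
  next
    fix d assume d: "d \<in> set R - set P"
    then obtain v where v: "v \<in> M" "d \<in> comp (th v)" using off_R by blast
    then have "v \<notin> set R" using pieces[OF v(1)] d by blast
    then show "\<exists>a\<in>A - set R. d \<in> comp (th a)" using v M_A[OF v(1)] by blast
  qed
  moreover have "card (A - set R) < card (A - set r)"
  proof -
    have fM: "finite (A - set r)" using finite_A by simp
    \<comment> \<open>\<open>o1\<close> is missed by \<open>r\<close> but kept by \<open>R\<close>,
      and nothing is newly missed.\<close>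
    have "A - set R \<subseteq> (A - set r) - {o1}" using nonM l(5) unfolding M_def R_def by auto
    then have "card (A - set R) \<le> card ((A - set r) - {o1})" by (rule card_mono[rotated]) (use fM in simp)
    also have "\<dots> < card (A - set r)" by (rule card_Diff1_less[OF fM]) (use o1 in \<open>simp add: M_def\<close>)
    finally show ?thesis .
  qed
  ultimately have RP: "R = P" using minimal[OF l(1)] by (meson not_le)
  then have LP: "set L \<subseteq> set P" unfolding R_def by auto
  have pl: "s = map (\<lambda>v. ([], v)) (map snd s) \<and> L = o1 # map snd s"
    unfolding L_def by (rule unmixed_plain[OF l(2) walk_mono[OF h(1) core_darts_swap_darts] fM]) (use LP in \<open>simp_all add: L_def\<close>)
  have "pre @ L @ post = pre @ (o1 # mid @ [wl]) @ post" using RP P_core unfolding R_def by simp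
  then have "L = o1 # mid @ [wl]" by simp
  then have "map snd s = mid @ [wl]" using pl by simp
  then show False using pl s(3) by simp
qed

end

context swap
begin

lemma swap_False: False
proof -
  obtain pre o1 mid ok wl post where c: "P = pre @ (o1 # mid @ [wl]) @ post" "o1 \<in> M" "ok \<in> M" "\<exists>m. o1 # mid = m @ [ok]"
     "set pre \<inter> M = {}" "wl \<in> W" "set post \<inter> M = {}" "pre \<noteq> []" "last pre \<in> W" "post \<noteq> []" using core_exists by blast
  have "core adj V P x y A r pre o1 mid wl post"
    by unfold_locales (use c in blast)+
  then show False by (rule core.core_False)
qed

end

section \<open>Conclusion: no inner vertices, yet a path with an inner vertex\<close>

context chosen
begin

lemma V0_empty: "V0 = {}"
proof (rule ccontr)
  assume ne: "V0 \<noteq> {}"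
  define Q where "Q r \<longleftrightarrow> r \<in> covering \<and> good r \<and> r \<noteq> P" for r
  have "\<exists>r. Q r" using exists_good[OF ne] unfolding Q_def by blast
  then obtain r where r: "Q r" "\<And>r'. Q r' \<Longrightarrow> card (A - set r) \<le> card (A - set r')"
    using ex_has_least_nat[of Q _ "\<lambda>r. card (A - set r)"] by blast
  have "swap adj V P x y A r"
    by unfold_locales (use r ne in \<open>unfold Q_def, blast+\<close>)
  then show False by (rule swap.swap_False)
qed

text \<open>With \<open>V0\<close> empty every inner vertex lies in \<open>A\<close>, but the path
  neighbours of a vertex of \<open>A\<close> lie in \<open>V0\<close>.\<close>

lemma I_empty: "I = {}"
proof (rule ccontr)
  assume "I \<noteq> {}"
  then obtain v where v: "v \<in> I" by blast
  then have "v \<in> A" using V0_empty unfolding V0_def by blast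
  then have "nb P v \<subseteq> {}" using A_nb[of v] V0_empty unfolding V0_def by blast
  then show False using nbrs_I(3)[OF v] by simp
qed

end

context cubic_longest
begin

theorem no_inner: "I = {}"
proof -
  obtain A where A: "reps adj V P x y A" "\<forall>D\<in>comps. if big D then card (A \<inter> cl D) = 1 else A \<inter> cl D = {}" using exists_reps by blast
  interpret reps adj V P x y A by (rule A(1))
  have "chosen adj V P x y A" by unfold_locales (use A(2) in blast)
  then show ?thesis by (rule chosen.I_empty)
qed

text \<open>\<open>x\<close> has a neighbour \<open>z\<close> other than \<open>y\<close>, and the
  graph without \<open>x\<close> is connected, so some path from \<open>x\<close> to
  \<open>y\<close> begins with the edge to \<open>z\<close>.\<close>

lemma long_path: "\<exists>q. distinct q \<and> successively adj q \<and> q \<noteq> [] \<and> hd q = x \<and> last q = y \<and> 3 \<le> length q"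
proof -
  have "\<not> {w. adj x w} \<subseteq> {y}"
  proof
    assume "{w. adj x w} \<subseteq> {y}"
    then have "card {w. adj x w} \<le> card {y}" by (rule card_mono[rotated]) simp
    then show False using cubic[OF xV] by simp
  qed
  then obtain z where z: "adj x z" "z \<noteq> y" by blast
  have zV: "z \<in> V - {x}" using z(1) adjV[OF adj_sym[OF z(1)]] adj_irrefl[of x] by auto
  define S where "S = {v \<in> V - {x}. \<exists>p. p \<noteq> [] \<and> hd p = z \<and> last p = v \<and> distinct p \<and> successively adj p \<and> x \<notin> set p}"
  have "S = V - {x}"
  proof (rule two_conn[OF xV])
    show "S \<subseteq> V - {x}" unfolding S_def by blast
    have "z \<in> S" unfolding S_def using zV by (auto intro!: exI[of _ "[z]"])
    then show "S \<noteq> {}" by blast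
    fix u v assume u: "u \<in> S" and v: "v \<in> V - {x}" "adj u v"
    obtain p where p: "p \<noteq> []" "hd p = z" "last p = u" "distinct p" "successively adj p" "x \<notin> set p" using u unfolding S_def by blast
    have "adj (last p) v" using p(3) v(2) by simp
    from path_extend[OF p(1,4,5) this] obtain q where
      q: "q \<noteq> []" "hd q = hd p" "last q = v" "distinct q" "successively adj q" "set q \<subseteq> insert v (set p)" by blast
    have "x \<notin> set q" using q(6) p(6) v(1) by blast
    then show "v \<in> S" unfolding S_def using q p(2) v(1) by auto
  qed
  then have "y \<in> S" using yV xy by simp
  then obtain p where p: "p \<noteq> []" "hd p = z" "last p = y" "distinct p" "successively adj p" "x \<notin> set p" unfolding S_def by blast
  have "2 \<le> length p" using p(1-3) z(2) by (cases p; cases "tl p") auto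
  moreover have "successively adj (x # p)" using p(1,2,5) z(1) by (cases p) auto
  ultimately show ?thesis using p by (intro exI[of _ "x # p"]) simp
qed

theorem contradiction: False
proof -
  obtain q where q: "distinct q" "successively adj q" "q \<noteq> []" "hd q = x" "last q = y" "3 \<le> length q" using long_path by blast
  have "3 \<le> length P" using q(6) longest[OF q(1-5)] by linarith
  moreover have "length P = card (set P)" by (rule distinct_card[OF P_path(1), symmetric])
  moreover have "card (set P) \<le> card {x, y}"
    by (rule card_mono) (use no_inner in \<open>auto simp: I_def\<close>)
  moreover have "card {x, y} \<le> 2" by (simp add: card_insert_if)
  ultimately show False by linarith
qed

end

section \<open>The theorem for digraph-based graphs\<close>

lemma (in graph) card_dominated: "card {w. v \<rightarrow>\<^bsub>G\<^esub> w} = out_degree G v"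
proof -
  have "head G ` out_arcs G v = {w. v \<rightarrow>\<^bsub>G\<^esub> w}" unfolding arcs_ends_conv by force
  moreover have "inj_on (head G) (out_arcs G v)"
  proof (rule inj_onI)
    fix e f assume "e \<in> out_arcs G v" "f \<in> out_arcs G v" "head G e = head G f"
    then show "e = f" using no_multi_arcs[of e f] by (simp add: arc_to_ends_def)
  qed
  ultimately show ?thesis unfolding out_degree_def using card_image by metis
qed

lemma vwalk_arcs_successively: "set (vwalk_arcs p) \<subseteq> arcs_ends G \<longleftrightarrow> successively (dominates G) p"
  by (induction p rule: vwalk_arcs.induct) auto

text \<open>A walk that starts in the graph stays in it. The start must be assumed a vertex, since a
  one-vertex list has no arc to witness this.\<close>

lemma (in wf_digraph) xy_path_iff:
  assumes "x \<in> verts G"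
  shows "xy_path G x y p \<longleftrightarrow> distinct p \<and> successively (dominates G) p \<and> p \<noteq> [] \<and> hd p = x \<and> last p = y"
proof -
  have "set p \<subseteq> verts G" if "successively (dominates G) p" "p \<noteq> []" "hd p \<in> verts G" for p
    using that
  proof (induction p rule: induct_list012)
    case (3 a b p)
    then have "dominates G a b" "successively (dominates G) (b # p)" by simp_all
    then show ?case using 3 adj_in_verts[of a b] by simp
  qed simp_all
  then show ?thesis using assms
    unfolding xy_path_def vpath_def vwalk_def vwalk_arcs_successively by auto
qed

text \<open>Connectedness is defined as strong connectedness of the symmetric closure; this turns it
  into the closed-set form of \<open>two_conn\<close>.\<close>

lemma connected_closed:
  assumes c: "Digraph_Component.connected (G \<restriction> W)" and sym: "\<And>u v. u \<rightarrow>\<^bsub>G\<^esub> v \<Longrightarrow> v \<rightarrow>\<^bsub>G\<^esub> u"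
    and S: "S \<subseteq> W" "S \<noteq> {}" and closed: "\<And>u v. u \<in> S \<Longrightarrow> v \<in> W \<Longrightarrow> u \<rightarrow>\<^bsub>G\<^esub> v \<Longrightarrow> v \<in> S"
  shows "S = W"
proof
  obtain s where s: "s \<in> S" using S(2) by blast
  let ?H = "with_proj (mk_symmetric (G \<restriction> W))"
  have H: "v \<in> W \<and> u \<rightarrow>\<^bsub>G\<^esub> v" if "u \<rightarrow>\<^bsub>?H\<^esub> v" for u v
  proof -
    have "(u, v) \<in> parcs (mk_symmetric (G \<restriction> W))" using that unfolding arcs_ends_conv by simp
    then obtain e where "e \<in> arcs G" "tail G e \<in> W" "head G e \<in> W" "(u, v) = (tail G e, head G e) \<or> (u, v) = (head G e, tail G e)"
      unfolding mk_symmetric_def by (auto simp: induce_subgraph_def)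
    moreover have "tail G e \<rightarrow>\<^bsub>G\<^esub> head G e" using calculation(1) unfolding arcs_ends_conv by blast
    ultimately show ?thesis using sym by auto
  qed
  show "W \<subseteq> S"
  proof
    fix v assume "v \<in> W"
    then have "s \<rightarrow>\<^sup>*\<^bsub>?H\<^esub> v" using c s S(1) unfolding connected_def strongly_connected_def by (auto simp: mk_symmetric_def)
    then show "v \<in> S"
      unfolding reachable_def
    proof (induction rule: rtrancl_on_induct)
      case (step u v)
      then show ?case using H[of u v] closed[of u v] by blast
    qed (rule s)
  qed
qed (rule S(1))

theorem theorem1p5:
  fixes G :: "('a, 'b) pre_digraph" and x y :: 'a and P :: "'a vwalk"
  assumes "graph G"
    and "k_connected 2 G"
    and "cubic G"
    and "x \<in> verts G" and "y \<in> verts G" and "x \<noteq> y"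
    and "longest_xy_path G x y P"
  shows "\<exists>v \<in> internal_vertices P. bound_in G (path_graph G P) v"
proof (rule ccontr)
  assume none: "\<not> ?thesis"
  interpret graph G by (rule assms(1))
  have sym: "v \<rightarrow>\<^bsub>G\<^esub> u" if "u \<rightarrow>\<^bsub>G\<^esub> v" for u v
    by (rule arcs_ends_symmetric[OF sym_arcs that])
  have out: "{w. v \<rightarrow>\<^bsub>G\<^esub> w} \<subseteq> verts G" for v using adj_in_verts(2) by blast
  have deg: "card {w. v \<rightarrow>\<^bsub>G\<^esub> w} = 3" if "v \<in> verts G" for v
    using assms(3) that unfolding card_dominated cubic_def by blast
  have P: "xy_path G x y P" using assms(7) unfolding longest_xy_path_def by blast
  then have P': "distinct P" "successively (dominates G) P" "P \<noteq> []" "hd P = x" "last P = y"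
    unfolding xy_path_iff[OF assms(4)] by blast+
  have "cubic_longest (dominates G) (verts G) P x y"
  proof
    show "\<not> u \<rightarrow>\<^bsub>G\<^esub> u" for u using adj_not_same by blast
    show "finite {w. u \<rightarrow>\<^bsub>G\<^esub> w}" for u by (rule finite_subset[OF out]) simp
    show "card {w. u \<rightarrow>\<^bsub>G\<^esub> w} \<le> 3" for u
    proof (cases "u \<in> verts G")
      case False
      then have "{w. u \<rightarrow>\<^bsub>G\<^esub> w} = {}" using adj_in_verts(1) by blast
      then show ?thesis by simp
    qed (simp add: deg)
    show "u \<in> verts G" if "u \<rightarrow>\<^bsub>G\<^esub> v" for u v using adj_in_verts(1)[OF that] .
    show "S = verts G - {z}"
      if "z \<in> verts G" "S \<subseteq> verts G - {z}" "S \<noteq> {}" "\<And>u v. u \<in> S \<Longrightarrow> v \<in> verts G - {z} \<Longrightarrow> u \<rightarrow>\<^bsub>G\<^esub> v \<Longrightarrow> v \<in> S" for z S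
    proof (rule connected_closed[OF _ sym that(2-4)])
      have "{z} \<subseteq> verts G" "card {z} < 2" using that(1) by simp_all
      then show "Digraph_Component.connected (G \<restriction> (verts G - {z}))" using assms(2) unfolding k_connected_def by blast
    qed
    show "length q \<le> length P"
      if "distinct q" "successively (dominates G) q" "q \<noteq> []" "hd q = x" "last q = y" for q
    proof -
      have "xy_path G x y q" unfolding xy_path_iff[OF assms(4)] using that by blast
      \<comment> \<open>\<open>vwalk_length\<close> counts arcs, one less than the number of
        vertices.\<close>
      then have "length q - 1 \<le> length P - 1" using assms(7) unfolding longest_xy_path_def by simp
      then show ?thesis using P'(3) by (cases P) auto
    qed
    show "\<exists>w. v \<rightarrow>\<^bsub>G\<^esub> w \<and> w \<notin> set P" if "v \<in> set P" "v \<noteq> x" "v \<noteq> y" for v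
    proof -
      have "v \<in> internal_vertices P" using that P'(4,5) unfolding internal_vertices_def by simp
      then have "\<not> bound_in G (path_graph G P) v" using none by blast
      then show ?thesis using that(1) unfolding bound_in_def neighborhood_def path_graph_def by auto
    qed
  qed (use assms(4-6) P' deg sym in simp_all)
  then show False by (rule cubic_longest.contradiction)
qed

end
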